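(* Let $H=H(C,D,\Omega)$ for a symmetrizable generalized Cartan matrix $C\in M_n(\mathbb Z)$, a symmetrizer $D=\mathrm{diag}(c_1,\ldots,c_n)$ and an orientation $\Omega$. Let $\mathbf d=(d_1,\ldots,d_n)\in\mathbb N^n$ be $D$-divisible, i.e. $c_i$ divides $d_i$ for every $i$. Set $r_i:=d_i/c_i$ and $\mathbf r=(r_1,\ldots,r_n)$. Then $\mathrm{rep}_{\mathrm{l.f.}}(H,\mathbf r)$ is a non-empty open subset of $\mathrm{rep}(H,\mathbf d)$. Moreover: (i) The map $\bar\pi\colon\mathrm{rep}_{\mathrm{l.f.}}(H,\mathbf r)\to\mathcal O_{E^{\mathbf r}}$, $M\mapsto (M(\varepsilon_1),\ldots,M(\varepsilon_n))$, defines a vector bundle of rank $\sum_{(i,j)\in\Omega}c_i|c_{ij}|r_ir_j$. In particular, $\mathrm{rep}_{\mathrm{l.f.}}(H,\mathbf r)$ is smooth and irreducible of dimension $$\sum_{i=1}^n c_i(c_i-1)r_i^2+\sum_{(i,j)\in\Omega}c_i|c_{ij}|r_ir_j=\dim(G_{\mathbf d})-q_H(\mathbf r).$$ (ii) If $q_H(\mathbf r)\le 0$, then $\mathrm{rep}_{\mathrm{l.f.}}(H,\mathbf r)$ has infinitely many $G_{\mathbf d}$-orbits.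
   Context: $K$ is an algebraically closed field, $\mathbb N=\{0,1,2,\ldots\}$; modules are finite-dimensional left modules. The algebra $H(C,D,\Omega)$: $C=(c_{ij})\in M_n(\mathbb Z)$ satisfies $c_{ii}=2$ and $c_{ij}\le 0$ for $i\ne j$; a symmetrizer is $D=\mathrm{diag}(c_1,\ldots,c_n)$ with $c_i\in\mathbb Z_{>0}$ and $c_ic_{ij}=c_jc_{ji}$ for all $i,j$. When $c_{ij}<0$ put $g_{ij}=|\gcd(c_{ij},c_{ji})|$, $f_{ij}=|c_{ij}|/g_{ij}$. An orientation is a subset $\Omega\subset\{1,\ldots,n\}^2$ such that $\{(i,j),(j,i)\}\cap\Omega\neq\varnothing$ iff $c_{ij}<0$, and such that for each sequence $(i_1,i_2),(i_2,i_3),\ldots,(i_t,i_{t+1})$ of elements of $\Omega$ with $t\ge 1$ one has $i_1\neq i_{t+1}$. Let $Q$ be the quiver with vertices $1,\ldots,n$ and arrows $\alpha_{ij}^{(g)}\colon j\to i$ for $(i,j)\in\Omega$, $1\le g\le g_{ij}$, and loops $\varepsilon_i\colon i\to i$ for $1\le i\le n$. Then $H(C,D,\Omega)=KQ/I$, where $I$ is generated by the relations $\varepsilon_i^{c_i}=0$ for all $i$ and $\varepsilon_i^{f_{ji}}\alpha_{ij}^{(g)}=\alpha_{ij}^{(g)}\varepsilon_j^{f_{ij}}$ for all $(i,j)\in\Omega$, $1\le g\le g_{ij}$. Let $H_i\cong K[x]/(x^{c_i})$ be the subalgebra of $H$ generated by $\varepsilon_i$. An $H$-module $M$, viewed as a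 representation $(M_i,M(\varepsilon_i),M(\alpha_{ij}^{(g)}))$, is locally free if each $M_i$ is a free $H_i$-module; its rank vector is $(\mathrm{rank}(M_1),\ldots,\mathrm{rank}(M_n))\in\mathbb N^n$. $\mathrm{rep}(H,\mathbf d)$ is the affine variety of representations of $H$ with dimension vector $\mathbf d$ (with $M_i=K^{d_i}$), on which $G_{\mathbf d}=\prod_{i=1}^n\mathrm{GL}_{d_i}(K)$ acts by conjugation; orbits correspond to isomorphism classes. $\mathrm{rep}_{\mathrm{l.f.}}(H,\mathbf r)\subset\mathrm{rep}(H,\mathbf d)$ is the subset of locally free modules of rank vector $\mathbf r$. $\mathcal O_{E^{\mathbf r}}=\mathcal O_{H_1^{r_1}}\times\cdots\times\mathcal O_{H_n^{r_n}}$, where $\mathcal O_{H_i^{r_i}}$ is the $\mathrm{GL}_{d_i}(K)$-orbit of the free $H_i$-module of rank $r_i$ in the variety $\mathrm{rep}(H_i,d_i)$ of $d_i$-dimensional $H_i$-modules; it is the image of the map $(M(\alpha))_{\alpha}\mapsto(M(\varepsilon_1),\ldots,M(\varepsilon_n))$ on $\mathrm{rep}_{\mathrm{l.f.}}(H,\mathbf r)$. $q_H(\mathbf r)=\sum_{i=1}^n c_ir_i^2+\sum_{(i,j)\in\Omega}c_ic_{ij}r_jr_i$.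
   Formalization: In part (ii) the rank vector r is additionally assumed to be non-zero, since for d = 0 one has q_H(r) = 0 while the variety of locally free modules is a single point with exactly one orbit; all other parts are stated for every D-divisible d. *)

theory Defs
  imports
    "HOL-Analysis.Abstract_Topology"
    "HOL-Library.Extended_Nat"
    "HOL-Library.Function_Algebras"
    "HOL-Computational_Algebra.Polynomial"
    "HOL-Algebra.Group_Action"
    "HOL-Algebra.Product_Groups"
    "Jordan_Normal_Form.Matrix"
begin

section \<open>Quasi-affine varieties over an algebraically closed field\<close>

text \<open>
  Affine space with finite coordinate set \<open>X\<close> is realised as the linear subspace of all
  functions \<open>'x \<Rightarrow> 'k\<close> supported in \<open>X\<close>.  A variety is given by \<open>X\<close> together with a
  locally closed set \<open>V\<close> of points.  Since the field is infinite, polynomials in the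
  coordinates \<open>X\<close> may be identified with polynomial functions.
\<close>

definition affine_space :: "'x set \<Rightarrow> ('x \<Rightarrow> 'k::zero) set" where
  "affine_space X = {v. \<forall>a. a \<notin> X \<longrightarrow> v a = 0}"

inductive_set poly_fun :: "'x set \<Rightarrow> (('x \<Rightarrow> 'k::comm_ring_1) \<Rightarrow> 'k) set" for X :: "'x set" where
  const: "(\<lambda>v. a) \<in> poly_fun X"
| coord: "a \<in> X \<Longrightarrow> (\<lambda>v. v a) \<in> poly_fun X"
| add: "f \<in> poly_fun X \<Longrightarrow> g \<in> poly_fun X \<Longrightarrow> (\<lambda>v. f v + g v) \<in> poly_fun X"
| mult: "f \<in> poly_fun X \<Longrightarrow> g \<in> poly_fun X \<Longrightarrow> (\<lambda>v. f v * g v) \<in> poly_fun X"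

definition zero_locus :: "'x set \<Rightarrow> (('x \<Rightarrow> 'k::comm_ring_1) \<Rightarrow> 'k) set \<Rightarrow> ('x \<Rightarrow> 'k) set" where
  "zero_locus X F = {v \<in> affine_space X. \<forall>f\<in>F. f v = 0}"

definition zariski :: "'x set \<Rightarrow> ('x \<Rightarrow> 'k::idom) topology" where
  "zariski X = topology (\<lambda>U. \<exists>F \<subseteq> poly_fun X. U = affine_space X - zero_locus X F)"

lemma openin_zariski:
  "openin (zariski X) U \<longleftrightarrow>
     (\<exists>F \<subseteq> poly_fun X. U = affine_space X - zero_locus X (F :: (('x \<Rightarrow> 'k::idom) \<Rightarrow> 'k) set))"
proof -
  let ?L = "\<lambda>U. \<exists>F \<subseteq> poly_fun X.
    U = affine_space X - zero_locus X (F :: (('x \<Rightarrow> 'k) \<Rightarrow> 'k) set)"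
  have "istopology ?L"
    unfolding istopology_def
  proof (intro conjI allI impI)
    fix S T assume "?L S" "?L T"
    then obtain F G where FG: "F \<subseteq> poly_fun X" "G \<subseteq> poly_fun X"
      and S: "S = affine_space X - zero_locus X F" and T: "T = affine_space X - zero_locus X G"
      by auto
    let ?P = "{\<lambda>v. f v * g v | f g. f \<in> F \<and> g \<in> G}"
    have "?P \<subseteq> poly_fun X" using FG by (auto intro: poly_fun.mult)
    moreover have "S \<inter> T = affine_space X - zero_locus X ?P"
    proof (rule Set.set_eqI)
      fix v
      have "v \<in> S \<inter> T \<longleftrightarrow> v \<in> affine_space X \<and> (\<exists>f\<in>F. \<exists>g\<in>G. f v * g v \<noteq> 0)"
        unfolding S T zero_locus_def by auto
      also have "\<dots> \<longleftrightarrow> v \<in> affine_space X - zero_locus X ?P"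
        unfolding zero_locus_def by fastforce
      finally show "v \<in> S \<inter> T \<longleftrightarrow> v \<in> affine_space X - zero_locus X ?P" .
    qed
    ultimately show "?L (S \<inter> T)" by blast
  next
    fix \<K> assume "\<forall>K\<in>\<K>. ?L K"
    then obtain F where F: "\<And>K. K \<in> \<K> \<Longrightarrow> F K \<subseteq> poly_fun X"
      "\<And>K. K \<in> \<K> \<Longrightarrow> K = affine_space X - zero_locus X (F K)"
      by metis
    have "(\<Union>K\<in>\<K>. F K) \<subseteq> poly_fun X" using F(1) by blast
    moreover have "\<Union>\<K> = affine_space X - zero_locus X (\<Union>K\<in>\<K>. F K)"
    proof (rule Set.set_eqI)
      fix v
      have "v \<in> \<Union>\<K> \<longleftrightarrow> (\<exists>K\<in>\<K>. v \<in> affine_space X - zero_locus X (F K))"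
        using F(2) by blast
      then show "v \<in> \<Union>\<K> \<longleftrightarrow> v \<in> affine_space X - zero_locus X (\<Union>K\<in>\<K>. F K)"
        unfolding zero_locus_def by auto
    qed
    ultimately show "?L (\<Union>\<K>)" by blast
  qed
  then show ?thesis
    unfolding zariski_def by (simp add: topology_inverse')
qed

definition var_top :: "'x set \<Rightarrow> ('x \<Rightarrow> 'k::idom) set \<Rightarrow> ('x \<Rightarrow> 'k) topology" where
  "var_top X V = subtopology (zariski X) V"

definition quasi_affine :: "'x set \<Rightarrow> ('x \<Rightarrow> 'k::idom) set \<Rightarrow> bool" where
  "quasi_affine X V \<longleftrightarrow> finite X \<and>
     (\<exists>A U. closedin (zariski X) A \<and> openin (zariski X) U \<and> V = A \<inter> U)"

definition irreducible_space :: "'a topology \<Rightarrow> bool" where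
  "irreducible_space T \<longleftrightarrow> topspace T \<noteq> {} \<and>
     (\<forall>A B. closedin T A \<and> closedin T B \<and> A \<union> B = topspace T
        \<longrightarrow> A = topspace T \<or> B = topspace T)"

definition krull_dim :: "'a topology \<Rightarrow> enat" where
  "krull_dim T = Sup {enat k | k. \<exists>Z :: nat \<Rightarrow> 'a set.
     (\<forall>i\<le>k. closedin T (Z i) \<and> irreducible_space (subtopology T (Z i))) \<and>
     (\<forall>i<k. Z i \<subset> Z (Suc i))}"

definition local_dim :: "'a topology \<Rightarrow> 'a \<Rightarrow> enat" where
  "local_dim T x = Inf {krull_dim (subtopology T U) | U. openin T U \<and> x \<in> U}"

text \<open>
  The differential at \<open>x\<close> of a polynomial function \<open>f\<close> in direction \<open>w\<close> is the linear
  coefficient of the one-variable polynomial \<open>t \<mapsto> f (x + t w)\<close>.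
\<close>

definition differential_zero ::
  "(('x \<Rightarrow> 'k::field) \<Rightarrow> 'k) \<Rightarrow> ('x \<Rightarrow> 'k) \<Rightarrow> ('x \<Rightarrow> 'k) \<Rightarrow> bool" where
  "differential_zero f x w \<longleftrightarrow>
     (\<exists>p :: 'k poly. (\<forall>t. poly p t = f (\<lambda>a. x a + t * w a)) \<and> coeff p 1 = 0)"

definition tangent_space ::
  "'x set \<Rightarrow> ('x \<Rightarrow> 'k::field) set \<Rightarrow> ('x \<Rightarrow> 'k) \<Rightarrow> ('x \<Rightarrow> 'k) set" where
  "tangent_space X V x = {w \<in> affine_space X.
     \<forall>f \<in> poly_fun X. (\<forall>v\<in>V. f v = 0) \<longrightarrow> differential_zero f x w}"

definition fun_scale :: "'k::times \<Rightarrow> ('x \<Rightarrow> 'k) \<Rightarrow> 'x \<Rightarrow> 'k" where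
  "fun_scale a v = (\<lambda>i. a * v i)"

lemma vector_space_fun_scale: "vector_space (fun_scale :: 'k::field \<Rightarrow> ('x \<Rightarrow> 'k) \<Rightarrow> 'x \<Rightarrow> 'k)"
  by unfold_locales (auto simp: fun_scale_def fun_eq_iff algebra_simps)

definition smooth_variety :: "'x set \<Rightarrow> ('x \<Rightarrow> 'k::field) set \<Rightarrow> bool" where
  "smooth_variety X V \<longleftrightarrow> quasi_affine X V \<and>
     (\<forall>x\<in>V. enat (vector_space.dim fun_scale (tangent_space X V x)) = local_dim (var_top X V) x)"

definition regular_fun :: "'x set \<Rightarrow> ('x \<Rightarrow> 'k::field) set \<Rightarrow> (('x \<Rightarrow> 'k) \<Rightarrow> 'k) \<Rightarrow> bool" where
  "regular_fun X V f \<longleftrightarrow> (\<forall>x\<in>V. \<exists>U. openin (var_top X V) U \<and> x \<in> U \<and>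
     (\<exists>p\<in>poly_fun X. \<exists>q\<in>poly_fun X. \<forall>y\<in>U. q y \<noteq> 0 \<and> f y = p y / q y))"

definition regular_map ::
  "'x set \<Rightarrow> ('x \<Rightarrow> 'k::field) set \<Rightarrow> 'y set \<Rightarrow> ('y \<Rightarrow> 'k) set \<Rightarrow> (('x \<Rightarrow> 'k) \<Rightarrow> 'y \<Rightarrow> 'k) \<Rightarrow> bool" where
  "regular_map X V Y W \<phi> \<longleftrightarrow> \<phi> \<in> V \<rightarrow> W \<and> (\<forall>b\<in>Y. regular_fun X V (\<lambda>x. \<phi> x b))"

definition variety_iso ::
  "'x set \<Rightarrow> ('x \<Rightarrow> 'k::field) set \<Rightarrow> 'y set \<Rightarrow> ('y \<Rightarrow> 'k) set \<Rightarrow> (('x \<Rightarrow> 'k) \<Rightarrow> 'y \<Rightarrow> 'k) \<Rightarrow> bool" where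
  "variety_iso X V Y W \<phi> \<longleftrightarrow> regular_map X V Y W \<phi> \<and>
     (\<exists>\<psi>. regular_map Y W X V \<psi> \<and> (\<forall>x\<in>V. \<psi> (\<phi> x) = x) \<and> (\<forall>y\<in>W. \<phi> (\<psi> y) = y))"

text \<open>The product \<open>V \<times> W\<close>, with coordinate set \<open>X <+> Y\<close>; its points are pairs \<open>case_sum v w\<close>.\<close>

definition var_prod :: "('x \<Rightarrow> 'k) set \<Rightarrow> ('y \<Rightarrow> 'k) set \<Rightarrow> ('x + 'y \<Rightarrow> 'k) set" where
  "var_prod V W = {case_sum v w | v w. v \<in> V \<and> w \<in> W}"

text \<open>
  A vector bundle \<open>\<pi> : E \<rightarrow> B\<close> of rank \<open>e\<close>, with the linear structure of the fibres given by
  \<open>fadd\<close> and \<open>fscl\<close>.  Around each point of \<open>B\<close> there is an isomorphism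
  \<open>x \<mapsto> (\<pi> x, \<tau> x)\<close> from the part of \<open>E\<close> over an open set \<open>U\<close> onto \<open>U \<times> K^e\<close> that is linear on
  every fibre.  The vector space axioms for the fibres are not listed separately, because they
  follow from the bijections \<open>\<tau>\<close> of the fibres with \<open>K^e\<close>, which respect the operations.
\<close>

definition vector_bundle ::
  "'x set \<Rightarrow> ('x \<Rightarrow> 'k::field) set \<Rightarrow> 'y set \<Rightarrow> ('y \<Rightarrow> 'k) set \<Rightarrow> (('x \<Rightarrow> 'k) \<Rightarrow> 'y \<Rightarrow> 'k) \<Rightarrow>
   (('x \<Rightarrow> 'k) \<Rightarrow> ('x \<Rightarrow> 'k) \<Rightarrow> 'x \<Rightarrow> 'k) \<Rightarrow> ('k \<Rightarrow> ('x \<Rightarrow> 'k) \<Rightarrow> 'x \<Rightarrow> 'k) \<Rightarrow> nat \<Rightarrow> bool" where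
  "vector_bundle X E Y B \<pi> fadd fscl e \<longleftrightarrow>
     quasi_affine X E \<and> quasi_affine Y B \<and> regular_map X E Y B \<pi> \<and>
     (\<forall>x\<in>E. \<forall>x'\<in>E. \<pi> x = \<pi> x' \<longrightarrow> fadd x x' \<in> E \<and> \<pi> (fadd x x') = \<pi> x) \<and>
     (\<forall>a. \<forall>x\<in>E. fscl a x \<in> E \<and> \<pi> (fscl a x) = \<pi> x) \<and>
     (\<forall>b\<in>B. \<exists>U \<tau>. openin (var_top Y B) U \<and> b \<in> U \<and>
        variety_iso X {x \<in> E. \<pi> x \<in> U} (Y <+> {..<e}) (var_prod U (affine_space {..<e}))
          (\<lambda>x. case_sum (\<pi> x) (\<tau> x)) \<and>
        (\<forall>x\<in>E. \<forall>x'\<in>E. \<pi> x \<in> U \<and> \<pi> x = \<pi> x' \<longrightarrow> \<tau> (fadd x x') = \<tau> x + \<tau> x') \<and>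
        (\<forall>a. \<forall>x\<in>E. \<pi> x \<in> U \<longrightarrow> \<tau> (fscl a x) = fun_scale a (\<tau> x)))"


section \<open>The algebra \<open>H(C, D, \<Omega>)\<close> and its representation varieties\<close>

text \<open>The symmetrizer \<open>D = diag(c\<^sub>1, \<dots>, c\<^sub>n)\<close> is given by the function \<open>c\<close>.\<close>

definition cartan_matrix :: "nat \<Rightarrow> (nat \<Rightarrow> nat \<Rightarrow> int) \<Rightarrow> bool" where
  "cartan_matrix n C \<longleftrightarrow> (\<forall>i\<in>{1..n}. C i i = 2) \<and>
     (\<forall>i\<in>{1..n}. \<forall>j\<in>{1..n}. i \<noteq> j \<longrightarrow> C i j \<le> 0)"

definition symmetrizer :: "nat \<Rightarrow> (nat \<Rightarrow> nat \<Rightarrow> int) \<Rightarrow> (nat \<Rightarrow> nat) \<Rightarrow> bool" where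
  "symmetrizer n C c \<longleftrightarrow> (\<forall>i\<in>{1..n}. c i > 0) \<and>
     (\<forall>i\<in>{1..n}. \<forall>j\<in>{1..n}. int (c i) * C i j = int (c j) * C j i)"

definition orientation :: "nat \<Rightarrow> (nat \<Rightarrow> nat \<Rightarrow> int) \<Rightarrow> (nat \<times> nat) set \<Rightarrow> bool" where
  "orientation n C \<Omega> \<longleftrightarrow> \<Omega> \<subseteq> {1..n} \<times> {1..n} \<and>
     (\<forall>i\<in>{1..n}. \<forall>j\<in>{1..n}. {(i, j), (j, i)} \<inter> \<Omega> \<noteq> {} \<longleftrightarrow> C i j < 0) \<and>
     acyclic \<Omega>"

definition gg :: "(nat \<Rightarrow> nat \<Rightarrow> int) \<Rightarrow> nat \<Rightarrow> nat \<Rightarrow> nat" where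
  "gg C i j = nat \<bar>gcd (C i j) (C j i)\<bar>"

definition ff :: "(nat \<Rightarrow> nat \<Rightarrow> int) \<Rightarrow> nat \<Rightarrow> nat \<Rightarrow> nat" where
  "ff C i j = nat \<bar>C i j\<bar> div gg C i j"

text \<open>\<open>Eps i\<close> is the loop at \<open>i\<close>; \<open>Alpha i j g\<close> is the arrow \<open>\<alpha>\<^sub>i\<^sub>j\<^sup>(\<^sup>g\<^sup>) : j \<rightarrow> i\<close>.\<close>

datatype arrow = Eps nat | Alpha nat nat nat

fun source :: "arrow \<Rightarrow> nat" where
  "source (Eps i) = i"
| "source (Alpha i j g) = j"

fun target :: "arrow \<Rightarrow> nat" where
  "target (Eps i) = i"
| "target (Alpha i j g) = i"

definition arrows :: "nat \<Rightarrow> (nat \<Rightarrow> nat \<Rightarrow> int) \<Rightarrow> (nat \<times> nat) set \<Rightarrow> arrow set" where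
  "arrows n C \<Omega> = Eps ` {1..n} \<union> {Alpha i j g | i j g. (i, j) \<in> \<Omega> \<and> g \<in> {1..gg C i j}}"

text \<open>
  A representation of the quiver with dimension vector \<open>d\<close> is a point of the affine space whose
  coordinates are the matrix entries: \<open>(a, p, q)\<close> is the entry in row \<open>p\<close>, column \<open>q\<close> of the
  matrix of the arrow \<open>a\<close>.
\<close>

type_synonym rep_coord = "arrow \<times> nat \<times> nat"

definition entries :: "(nat \<Rightarrow> nat) \<Rightarrow> arrow set \<Rightarrow> rep_coord set" where
  "entries d A = {(a, p, q). a \<in> A \<and> p < d (target a) \<and> q < d (source a)}"

definition rep_coords ::
  "nat \<Rightarrow> (nat \<Rightarrow> nat \<Rightarrow> int) \<Rightarrow> (nat \<times> nat) set \<Rightarrow> (nat \<Rightarrow> nat) \<Rightarrow> rep_coord set" where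
  "rep_coords n C \<Omega> d = entries d (arrows n C \<Omega>)"

definition loop_coords :: "nat \<Rightarrow> (nat \<Rightarrow> nat) \<Rightarrow> rep_coord set" where
  "loop_coords n d = entries d (Eps ` {1..n})"

definition arrow_mat :: "(nat \<Rightarrow> nat) \<Rightarrow> (rep_coord \<Rightarrow> 'k) \<Rightarrow> arrow \<Rightarrow> 'k mat" where
  "arrow_mat d M a = mat (d (target a)) (d (source a)) (\<lambda>(p, q). M (a, p, q))"

text \<open>
  Representations of \<open>H = KQ/I\<close> are the representations of \<open>Q\<close> satisfying the relations that
  generate the ideal \<open>I\<close>.
\<close>

definition rep_H ::
  "nat \<Rightarrow> (nat \<Rightarrow> nat \<Rightarrow> int) \<Rightarrow> (nat \<Rightarrow> nat) \<Rightarrow> (nat \<times> nat) set \<Rightarrow> (nat \<Rightarrow> nat) \<Rightarrow>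
   (rep_coord \<Rightarrow> 'k::field) set" where
  "rep_H n C c \<Omega> d = {M \<in> affine_space (rep_coords n C \<Omega> d).
     (\<forall>i\<in>{1..n}. arrow_mat d M (Eps i) ^\<^sub>m c i = 0\<^sub>m (d i) (d i)) \<and>
     (\<forall>(i, j)\<in>\<Omega>. \<forall>g\<in>{1..gg C i j}.
        arrow_mat d M (Eps i) ^\<^sub>m ff C j i * arrow_mat d M (Alpha i j g) =
        arrow_mat d M (Alpha i j g) * arrow_mat d M (Eps j) ^\<^sub>m ff C i j)}"

text \<open>
  Let \<open>x\<close> act on \<open>K^m\<close> by the matrix \<open>N\<close> with \<open>N^c = 0\<close>.  This module over \<open>K[x]/(x^c)\<close> is free
  of rank \<open>r\<close> iff it has a basis \<open>b\<^sub>0, \<dots>, b\<^sub>r\<^sub>-\<^sub>1\<close>: every vector is uniquely of the form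
  \<open>\<Sum>\<^sub>k h\<^sub>k b\<^sub>k\<close>, where \<open>h\<^sub>k = \<Sum>\<^sub>l h (k, l) x^l\<close> with \<open>l < c\<close>.
\<close>

definition free_of_rank :: "nat \<Rightarrow> nat \<Rightarrow> 'k::field mat \<Rightarrow> nat \<Rightarrow> bool" where
  "free_of_rank c m N r \<longleftrightarrow> (\<exists>b :: nat \<Rightarrow> 'k vec. (\<forall>k<r. b k \<in> carrier_vec m) \<and>
     (\<forall>v\<in>carrier_vec m. \<exists>!h. h \<in> ({..<r} \<times> {..<c}) \<rightarrow>\<^sub>E (UNIV :: 'k set) \<and>
        (\<forall>p<m. v $ p = (\<Sum>k<r. \<Sum>l<c. h (k, l) * ((N ^\<^sub>m l) *\<^sub>v b k) $ p))))"

definition rep_lf ::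
  "nat \<Rightarrow> (nat \<Rightarrow> nat \<Rightarrow> int) \<Rightarrow> (nat \<Rightarrow> nat) \<Rightarrow> (nat \<times> nat) set \<Rightarrow> (nat \<Rightarrow> nat) \<Rightarrow>
   (rep_coord \<Rightarrow> 'k::field) set" where
  "rep_lf n C c \<Omega> r = (let d = (\<lambda>i. c i * r i) in
     {M \<in> rep_H n C c \<Omega> d.
        \<forall>i\<in>{1..n}. free_of_rank (c i) (d i) (arrow_mat d M (Eps i)) (r i)})"

definition GL :: "nat \<Rightarrow> 'k::field mat monoid" where
  "GL m = units_of (ring_mat TYPE('k) m ())"

definition G_grp :: "nat \<Rightarrow> (nat \<Rightarrow> nat) \<Rightarrow> (nat \<Rightarrow> 'k::field mat) monoid" where
  "G_grp n d = product_group {1..n} (\<lambda>i. GL (d i))"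

definition G_act ::
  "nat \<Rightarrow> (nat \<Rightarrow> nat \<Rightarrow> int) \<Rightarrow> (nat \<times> nat) set \<Rightarrow> (nat \<Rightarrow> nat) \<Rightarrow>
   (nat \<Rightarrow> 'k::field mat) \<Rightarrow> (rep_coord \<Rightarrow> 'k) \<Rightarrow> rep_coord \<Rightarrow> 'k" where
  "G_act n C \<Omega> d g M = (\<lambda>(a, p, q).
     if (a, p, q) \<in> rep_coords n C \<Omega> d
     then (g (target a) * arrow_mat d M a * inv\<^bsub>GL (d (source a))\<^esub> (g (source a))) $$ (p, q)
     else 0)"

text \<open>The group \<open>G\<^sub>d\<close> as a variety, with the matrix entries \<open>(i, p, q)\<close> as coordinates.\<close>

definition G_coords :: "nat \<Rightarrow> (nat \<Rightarrow> nat) \<Rightarrow> (nat \<times> nat \<times> nat) set" where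
  "G_coords n d = {(i, p, q). i \<in> {1..n} \<and> p < d i \<and> q < d i}"

definition G_var :: "nat \<Rightarrow> (nat \<Rightarrow> nat) \<Rightarrow> (nat \<times> nat \<times> nat \<Rightarrow> 'k::field) set" where
  "G_var n d = {x \<in> affine_space (G_coords n d).
     \<forall>i\<in>{1..n}. mat (d i) (d i) (\<lambda>(p, q). x (i, p, q)) \<in> carrier (GL (d i))}"

text \<open>
  The matrix of multiplication by \<open>x\<close> on the free module \<open>(K[x]/(x^c))^r\<close>; the basis vector
  \<open>x^l e\<^sub>k\<close> (with \<open>l < c\<close>, \<open>k < r\<close>) has index \<open>k * c + l\<close>.
\<close>

definition free_mat :: "nat \<Rightarrow> nat \<Rightarrow> 'k::field mat" where
  "free_mat c r = mat (c * r) (c * r) (\<lambda>(p, q). if p = q + 1 \<and> p mod c \<noteq> 0 then 1 else 0)"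

definition orbit_free :: "nat \<Rightarrow> (nat \<Rightarrow> nat) \<Rightarrow> (nat \<Rightarrow> nat) \<Rightarrow> (rep_coord \<Rightarrow> 'k::field) set" where
  "orbit_free n c r = (let d = (\<lambda>i. c i * r i) in
     {x \<in> affine_space (loop_coords n d).
        \<forall>i\<in>{1..n}. arrow_mat d x (Eps i) \<in>
          orbit (GL (d i)) (\<lambda>g A. g * A * inv\<^bsub>GL (d i)\<^esub> g) (free_mat (c i) (r i))})"

definition pi_bar :: "nat \<Rightarrow> (nat \<Rightarrow> nat) \<Rightarrow> (rep_coord \<Rightarrow> 'k::field) \<Rightarrow> rep_coord \<Rightarrow> 'k" where
  "pi_bar n d M = (\<lambda>z. if z \<in> loop_coords n d then M z else 0)"

text \<open>
  The linear structure on a fibre of \<open>pi_bar\<close>: the matrices of the \<open>\<alpha>\<close> arrows are added and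
  scaled, those of the loops are kept.
\<close>

definition fibre_add ::
  "nat \<Rightarrow> (nat \<Rightarrow> nat) \<Rightarrow> (rep_coord \<Rightarrow> 'k::field) \<Rightarrow> (rep_coord \<Rightarrow> 'k) \<Rightarrow> rep_coord \<Rightarrow> 'k" where
  "fibre_add n d M M' = (\<lambda>z. if z \<in> loop_coords n d then M z else M z + M' z)"

definition fibre_scale ::
  "nat \<Rightarrow> (nat \<Rightarrow> nat) \<Rightarrow> 'k::field \<Rightarrow> (rep_coord \<Rightarrow> 'k) \<Rightarrow> rep_coord \<Rightarrow> 'k" where
  "fibre_scale n d a M = (\<lambda>z. if z \<in> loop_coords n d then M z else a * M z)"

definition q_H ::
  "nat \<Rightarrow> (nat \<Rightarrow> nat \<Rightarrow> int) \<Rightarrow> (nat \<Rightarrow> nat) \<Rightarrow> (nat \<times> nat) set \<Rightarrow> (nat \<Rightarrow> nat) \<Rightarrow> int" where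
  "q_H n C c \<Omega> r = (\<Sum>i=1..n. int (c i) * (int (r i))\<^sup>2) +
     (\<Sum>(i, j)\<in>\<Omega>. int (c i) * C i j * int (r j) * int (r i))"

end

theory Submission
  imports Defs "Jordan_Normal_Form.Determinant"
begin

text \<open>
  Let \<open>N\<close> be a matrix with \<open>N^c = 0\<close> and \<open>H\<close> a fixed matrix.  The last row of each block of \<open>c\<close> rows
  of \<open>H\<close>, multiplied by \<open>N^(c-1), \<dots>, N, 1\<close>, gives a matrix \<open>h\<close> with \<open>h N = N\<^sub>0 h\<close>, where \<open>N\<^sub>0\<close> is the
  standard nilpotent matrix of the free module.  Where \<open>h\<close> is invertible, the module is free, and
  the rows of \<open>h\<close> that are not prescribed by \<open>H\<close> are free coordinates for \<open>N = h\<^sup>-\<^sup>1 N\<^sub>0 h\<close>.  Conversely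
  a free module lies in such a set for a suitable \<open>H\<close>.  In the basis given by \<open>h\<close>, a matrix satisfying
  the relation for \<open>\<alpha>\<^sub>i\<^sub>j\<close> is a homomorphism out of a free module over \<open>K[\<epsilon>\<^sub>j^f\<^sub>i\<^sub>j]\<close>, hence determined by
  arbitrary images of the generators.  So the locally free representations form an open set
  with an atlas of open subsets of one affine space, compatible with the projection to the loops;
  this gives the bundle, smoothness and the dimension.  All charts are restrictions of a single
  surjective rational map from an open subset of an affine space, whence irreducibility.

  The dimension of affine space is bounded by attaching to a chain of irreducible closed sets a family of
  algebraically independent polynomials and counting monomials.  The same count yields (ii): as
  scalars act trivially, an orbit is a finite union of rational images of sets of dimension
  \<open>dim G\<^sub>d - 1\<close>, so each orbit meets a chart of dimension \<open>dim G\<^sub>d - q\<^sub>H(r) \<ge> dim G\<^sub>d\<close> in a set contained in a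
  hypersurface.
\<close>

section \<open>Polynomial and rational functions\<close>

text \<open>A free module has many adapted bases: the invertible h with h N = N_0 h form a coset of
  the centralizer of N_0, which has dimension c r^2. Prescribing the last rows of the r blocks, each
  of length c r, uses up exactly this freedom, because an intertwiner is determined by these rows.
  The c (c - 1) r^2 entries that remain give the dimension of the orbit.

  The symmetrizer enters through one number: c_i f_ij = c_j f_ji with coprime f_ij and f_ji yields k
  with c_i = k f_ji and c_j = k f_ij. Hence both ends of an arrow are modules over the same ring
  K[y]/(y^k), over which M_j is free of rank f_ij r_j. The g_ij arrows contribute g_ij d_i f_ij r_j
  = c_i |c_ij| r_i r_j coordinates.

  Differentials are formal, since the characteristic is arbitrary: functions along curves are
  compared with quotients of polynomials in one variable.\<close>

lemma infinite_UNIV_alg_closed: "infinite (UNIV :: 'k::alg_closed_field set)"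
proof
  assume fin: "finite (UNIV :: 'k set)"
  \<comment> \<open>\<open>p\<close> vanishes on the whole finite field, so \<open>p + 1\<close> is
    a nonconstant polynomial without a root.\<close>
  define p :: "'k poly" where "p = (\<Prod>a\<in>UNIV. [:- a, 1:])"
  have p0: "poly p x = 0" for x
    unfolding p_def poly_prod using fin by (auto intro!: prod_zero)
  have "degree p = card (UNIV :: 'k set)"
    unfolding p_def by (subst degree_prod_eq_sum_degree) auto
  with fin have "degree p > 0" by (simp add: finite_UNIV_card_ge_0)
  then have "degree (p + 1) > 0" by (simp add: degree_add_eq_left)
  then obtain x where "poly (p + 1) x = 0" using alg_closed_imp_poly_has_root by blast
  then show False by (simp add: p0)
qed

lemma poly_fun_eqI:
  fixes p q :: "'k::alg_closed_field poly"
  assumes "\<And>t. poly p t = poly q t"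
  shows "p = q"
proof (rule ccontr)
  assume "p \<noteq> q"
  then have "finite {t. poly (p - q) t = 0}" by (intro poly_roots_finite) simp
  with assms infinite_UNIV_alg_closed[where 'k='k] show False by simp
qed

text \<open>The additional factor X makes the condition on t part of the nonvanishing of a single
  polynomial.\<close>

lemma poly_nonzero_exists:
  fixes p :: "'k::alg_closed_field poly"
  assumes "p \<noteq> 0"
  shows "\<exists>t. t \<noteq> 0 \<and> poly p t \<noteq> 0"
proof -
  have "p * [:0, 1:] \<noteq> 0" using assms by simp
  then obtain t where "poly (p * [:0, 1:]) t \<noteq> 0" using poly_fun_eqI[of "p * [:0, 1:]" 0] by auto
  then show ?thesis by auto
qed

lemma poly_fun_uminus: "f \<in> poly_fun X \<Longrightarrow> (\<lambda>v. - f v) \<in> poly_fun X"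
  using poly_fun.mult[OF poly_fun.const[of "-1"], of f X] by simp

lemma poly_fun_diff: "f \<in> poly_fun X \<Longrightarrow> g \<in> poly_fun X \<Longrightarrow> (\<lambda>v. f v - g v) \<in> poly_fun X"
  using poly_fun.add[OF _ poly_fun_uminus, of f X g] by simp

lemma poly_fun_sum:
  "(\<And>i. i \<in> I \<Longrightarrow> f i \<in> poly_fun X) \<Longrightarrow> (\<lambda>v. \<Sum>i\<in>I. f i v) \<in> poly_fun X"
  by (induction I rule: infinite_finite_induct) (auto intro: poly_fun.intros)

lemma poly_fun_prod:
  "(\<And>i. i \<in> I \<Longrightarrow> f i \<in> poly_fun X) \<Longrightarrow> (\<lambda>v. \<Prod>i\<in>I. f i v) \<in> poly_fun X"
  by (induction I rule: infinite_finite_induct) (auto intro: poly_fun.intros)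

lemma poly_fun_power: "f \<in> poly_fun X \<Longrightarrow> (\<lambda>v. f v ^ m) \<in> poly_fun X"
  by (induction m) (auto intro: poly_fun.intros)

lemma poly_fun_mono: "f \<in> poly_fun X \<Longrightarrow> X \<subseteq> Y \<Longrightarrow> f \<in> poly_fun Y"
  by (induction rule: poly_fun.induct) (auto intro: poly_fun.intros)

lemma poly_fun_comp:
  assumes "f \<in> poly_fun X" and "\<And>a. a \<in> X \<Longrightarrow> (\<lambda>w. \<phi> w a) \<in> poly_fun Y"
  shows "(\<lambda>w. f (\<phi> w)) \<in> poly_fun Y"
  using assms(1) by induction (auto intro: poly_fun.intros assms(2))

lemma poly_fun_cong_on: "f \<in> poly_fun S \<Longrightarrow> (\<And>a. a \<in> S \<Longrightarrow> v a = w a) \<Longrightarrow> f v = f w"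
  by (induction rule: poly_fun.induct) simp_all

lemma poly_fun_curve:
  fixes f :: "('x \<Rightarrow> 'k::alg_closed_field) \<Rightarrow> 'k"
  assumes "f \<in> poly_fun X"
  shows "\<exists>p. \<forall>t. poly p t = f (\<lambda>a. x a + t * w a)"
  using assms
proof induction
  case (const a)
  show ?case by (rule exI[of _ "[:a:]"]) simp
next
  case (coord a)
  show ?case by (rule exI[of _ "[:x a, w a:]"]) simp
next
  case (add f g)
  then show ?case by (metis poly_add)
next
  case (mult f g)
  then show ?case by (metis poly_mult)
qed

definition line :: "('x \<Rightarrow> 'k::ring) \<Rightarrow> ('x \<Rightarrow> 'k) \<Rightarrow> 'k \<Rightarrow> 'x \<Rightarrow> 'k" where
  "line a b t = (\<lambda>z. a z + t * (b z - a z))"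

text \<open>Restricted to the line through a and b, both functions become nonzero polynomials in one
  variable, and so does their product. This is how nonempty open sets of affine space are shown to
  meet.\<close>

lemma line_nonzero:
  fixes f g :: "('x \<Rightarrow> 'k::alg_closed_field) \<Rightarrow> 'k"
  assumes f: "f \<in> poly_fun X" "f a \<noteq> 0" and g: "g \<in> poly_fun X" "g b \<noteq> 0"
  shows "\<exists>t. f (line a b t) \<noteq> 0 \<and> g (line a b t) \<noteq> 0"
proof -
  obtain p where p: "\<And>t. poly p t = f (line a b t)"
    using poly_fun_curve[OF f(1)] unfolding line_def by metis
  obtain q where q: "\<And>t. poly q t = g (line a b t)"
    using poly_fun_curve[OF g(1)] unfolding line_def by metis
  have "poly p 0 \<noteq> 0" "poly q 1 \<noteq> 0" unfolding p q using f g by (auto simp: line_def)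
  then have "p * q \<noteq> 0" by auto
  then obtain t where "poly (p * q) t \<noteq> 0" using poly_nonzero_exists by blast
  then show ?thesis by (auto simp: p q)
qed

lemma affine_space_0 [simp]: "0 \<in> affine_space X" "(\<lambda>_. 0) \<in> affine_space X"
  by (auto simp: affine_space_def)

lemma affine_spaceD: "v \<in> affine_space X \<Longrightarrow> a \<notin> X \<Longrightarrow> v a = 0"
  by (simp add: affine_space_def)

lemma line_affine_space: "a \<in> affine_space X \<Longrightarrow> b \<in> affine_space X \<Longrightarrow> line a b t \<in> affine_space X"
  by (auto simp: affine_space_def line_def)

text \<open>A point off the next hypersurface and a point off the earlier ones are joined by a line,
  some point of which avoids them all. In this form affine space is not a finite union of proper
  hypersurfaces.\<close>

lemma poly_fun_prod_nonzero:
  fixes F :: "'i \<Rightarrow> ('x \<Rightarrow> 'k::alg_closed_field) \<Rightarrow> 'k"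
  assumes "finite I" "\<And>i. i \<in> I \<Longrightarrow> F i \<in> poly_fun S" "\<And>i. i \<in> I \<Longrightarrow> \<exists>v\<in>affine_space S. F i v \<noteq> 0"
  shows "\<exists>v\<in>affine_space S. (\<Prod>i\<in>I. F i v) \<noteq> 0"
  using assms
proof (induction I)
  case empty
  show ?case by (rule bexI[of _ 0]) simp_all
next
  case (insert i I)
  then obtain a b where a: "a \<in> affine_space S" "F i a \<noteq> 0"
    and b: "b \<in> affine_space S" "(\<Prod>i\<in>I. F i b) \<noteq> 0" by (metis insertCI)
  have "F i \<in> poly_fun S" using insert.prems by blast
  moreover have "(\<lambda>v. \<Prod>i\<in>I. F i v) \<in> poly_fun S" using insert.prems by (intro poly_fun_prod) blast
  ultimately obtain t where "F i (line a b t) \<noteq> 0" "(\<Prod>i\<in>I. F i (line a b t)) \<noteq> 0"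
    using line_nonzero[of "F i" S a "\<lambda>v. \<Prod>i\<in>I. F i v" b] a(2) b(2) by blast
  then show ?case
    using insert.hyps line_affine_space[OF a(1) b(1)] by (intro bexI[of _ "line a b t"]) simp_all
qed

subsection \<open>Zariski topology\<close>

text \<open>Openness is tested at each point by one basic open set, so that later proofs only have
  to exhibit one polynomial.\<close>

lemma openin_zariski_iff:
  "openin (zariski X) U \<longleftrightarrow> U \<subseteq> affine_space X \<and>
     (\<forall>x\<in>U. \<exists>f\<in>poly_fun X. f x \<noteq> (0 :: 'k::idom) \<and> {v \<in> affine_space X. f v \<noteq> 0} \<subseteq> U)"
proof
  assume "openin (zariski X) U"
  then obtain F where F: "F \<subseteq> poly_fun X" "U = affine_space X - zero_locus X F"
    unfolding openin_zariski by blast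
  show "U \<subseteq> affine_space X \<and>
     (\<forall>x\<in>U. \<exists>f\<in>poly_fun X. f x \<noteq> 0 \<and> {v \<in> affine_space X. f v \<noteq> 0} \<subseteq> U)"
  proof (intro conjI ballI)
    fix x assume "x \<in> U"
    then obtain f where "f \<in> F" "f x \<noteq> 0" by (auto simp: F zero_locus_def)
    then show "\<exists>f\<in>poly_fun X. f x \<noteq> 0 \<and> {v \<in> affine_space X. f v \<noteq> 0} \<subseteq> U"
      using F(1) by (intro bexI[of _ f]) (auto simp: F(2) zero_locus_def)
  qed (auto simp: F)
next
  assume r: "U \<subseteq> affine_space X \<and>
     (\<forall>x\<in>U. \<exists>f\<in>poly_fun X. f x \<noteq> 0 \<and> {v \<in> affine_space X. f v \<noteq> 0} \<subseteq> U)"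
  define F where "F = {f \<in> poly_fun X. {v \<in> affine_space X. f v \<noteq> 0} \<subseteq> U}"
  have "F \<subseteq> poly_fun X" by (auto simp: F_def)
  moreover have "U = affine_space X - zero_locus X F"
  proof (intro equalityI subsetI)
    fix x assume "x \<in> U"
    with r obtain f where "f \<in> F" "f x \<noteq> 0" unfolding F_def by blast
    with r \<open>x \<in> U\<close> show "x \<in> affine_space X - zero_locus X F" by (auto simp: zero_locus_def)
  next
    fix x assume "x \<in> affine_space X - zero_locus X F"
    then obtain f where "f \<in> F" "f x \<noteq> 0" "x \<in> affine_space X" by (auto simp: zero_locus_def)
    then show "x \<in> U" by (auto simp: F_def)
  qed
  ultimately show "openin (zariski X) U" unfolding openin_zariski by blast
qed

lemma topspace_zariski [simp]: "topspace (zariski X :: ('x \<Rightarrow> 'k::idom) topology) = affine_space X"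
proof -
  have "openin (zariski X) (affine_space X :: ('x \<Rightarrow> 'k) set)"
    unfolding openin_zariski_iff by (auto intro!: bexI[of _ "\<lambda>_. 1"] poly_fun.const)
  then have "affine_space X \<subseteq> topspace (zariski X :: ('x \<Rightarrow> 'k) topology)" by (rule openin_subset)
  moreover have "topspace (zariski X :: ('x \<Rightarrow> 'k) topology) \<subseteq> affine_space X"
    using openin_topspace[of "zariski X :: ('x \<Rightarrow> 'k) topology"] unfolding openin_zariski_iff by blast
  ultimately show ?thesis by blast
qed

lemma openin_zariski_nonzero:
  "f \<in> poly_fun X \<Longrightarrow> openin (zariski X) {v \<in> affine_space X. f v \<noteq> (0::'k::idom)}"
  unfolding openin_zariski_iff by auto

lemma topspace_var_top:
  "V \<subseteq> affine_space X \<Longrightarrow> topspace (var_top X V) = (V :: ('x \<Rightarrow> 'k::idom) set)"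
  by (auto simp: var_top_def)

lemma openin_var_top:
  assumes V: "V \<subseteq> affine_space X"
  shows "openin (var_top X V) U \<longleftrightarrow> U \<subseteq> V \<and>
     (\<forall>x\<in>U. \<exists>f\<in>poly_fun X. f x \<noteq> (0 :: 'k::idom) \<and> {v \<in> V. f v \<noteq> 0} \<subseteq> U)"
proof
  assume "openin (var_top X V) U"
  then obtain T where "openin (zariski X) T" "U = T \<inter> V"
    unfolding var_top_def openin_subtopology by auto
  show "U \<subseteq> V \<and> (\<forall>x\<in>U. \<exists>f\<in>poly_fun X. f x \<noteq> (0 :: 'k) \<and> {v \<in> V. f v \<noteq> 0} \<subseteq> U)"
  proof (intro conjI ballI)
    fix x assume "x \<in> U"
    then obtain f where f: "f \<in> poly_fun X" "f x \<noteq> 0" "{v \<in> affine_space X. f v \<noteq> 0} \<subseteq> T"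
      using \<open>openin (zariski X) T\<close> \<open>U = T \<inter> V\<close> unfolding openin_zariski_iff by auto
    then show "\<exists>f\<in>poly_fun X. f x \<noteq> (0 :: 'k) \<and> {v \<in> V. f v \<noteq> 0} \<subseteq> U"
      using V \<open>U = T \<inter> V\<close> by (intro bexI[of _ f]) auto
  qed (use \<open>U = T \<inter> V\<close> in auto)
next
  assume r: "U \<subseteq> V \<and> (\<forall>x\<in>U. \<exists>f\<in>poly_fun X. f x \<noteq> (0 :: 'k::idom) \<and> {v \<in> V. f v \<noteq> 0} \<subseteq> U)"
  then have "\<forall>x\<in>U. \<exists>f. f \<in> poly_fun X \<and> f x \<noteq> 0 \<and> {v \<in> V. f v \<noteq> 0} \<subseteq> U" by blast
  then obtain f where "\<forall>x\<in>U. f x \<in> poly_fun X \<and> f x x \<noteq> 0 \<and> {v \<in> V. f x v \<noteq> 0} \<subseteq> U"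
    by (rule bchoice[THEN exE])
  then have f: "\<And>x. x \<in> U \<Longrightarrow> f x \<in> poly_fun X" "\<And>x. x \<in> U \<Longrightarrow> f x x \<noteq> 0"
    "\<And>x. x \<in> U \<Longrightarrow> {v \<in> V. f x v \<noteq> 0} \<subseteq> U" by auto
  have "openin (zariski X) (\<Union>x\<in>U. {v \<in> affine_space X. f x v \<noteq> 0})"
    by (intro openin_Union) (auto intro: openin_zariski_nonzero f)
  moreover have "U = (\<Union>x\<in>U. {v \<in> affine_space X. f x v \<noteq> 0}) \<inter> V"
    using r f(2,3) V by blast
  ultimately show "openin (var_top X V) U"
    unfolding var_top_def openin_subtopology by blast
qed

lemma closedin_var_top:
  assumes V: "V \<subseteq> affine_space X"
  shows "closedin (var_top X V) Z \<longleftrightarrow> Z \<subseteq> V \<and>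
     (\<forall>x\<in>V - Z. \<exists>f\<in>poly_fun X. f x \<noteq> (0 :: 'k::idom) \<and> (\<forall>v\<in>Z. f v = 0))"
proof (cases "Z \<subseteq> V")
  case True
  have "{v \<in> V. f v \<noteq> 0} \<subseteq> V - Z \<longleftrightarrow> (\<forall>v\<in>Z. f v = 0)" for f :: "('a \<Rightarrow> 'k) \<Rightarrow> 'k"
    using True by auto
  with True show ?thesis
    unfolding closedin_def topspace_var_top[OF V] openin_var_top[OF V] by simp
next
  case False
  then show ?thesis by (auto dest!: closedin_subset simp: topspace_var_top[OF V])
qed

lemma subtopology_var_top:
  "subtopology (var_top X V) W = (var_top X (V \<inter> W) :: ('x \<Rightarrow> 'k::idom) topology)"
  unfolding var_top_def by (simp add: subtopology_subtopology)

lemma closedin_zariski_zeros: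
  fixes F :: "(('x \<Rightarrow> 'k::idom) \<Rightarrow> 'k) set"
  assumes "F \<subseteq> poly_fun X"
  shows "closedin (zariski X) {v \<in> affine_space X. \<forall>f\<in>F. f v = 0}"
proof -
  have "topspace (zariski X) - {v \<in> affine_space X. \<forall>f\<in>F. f v = 0} = affine_space X - zero_locus X F"
    by (auto simp: zero_locus_def)
  with assms show ?thesis
    unfolding closedin_def by (auto simp: openin_zariski)
qed

text \<open>If proper closed sets A and B covered the space, the line between a point outside A and
  a point outside B would contain a point of O' outside both. Closure under lines instead of
  linearity admits the translates of coordinate subspaces that form the chain in
  \<open>krull_dim_open_affine_ge\<close>.\<close>

lemma irreducible_flat:
  fixes L O' :: "('x \<Rightarrow> 'k::alg_closed_field) set"
  assumes L: "L \<subseteq> affine_space X" "\<And>a b t. a \<in> L \<Longrightarrow> b \<in> L \<Longrightarrow> line a b t \<in> L"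
    and O: "openin (zariski X) O'" and ne: "L \<inter> O' \<noteq> {}"
  shows "irreducible_space (var_top X (L \<inter> O'))"
proof -
  have sub: "L \<inter> O' \<subseteq> affine_space X" using L by auto
  show ?thesis unfolding irreducible_space_def topspace_var_top[OF sub]
  proof (intro conjI allI impI)
    show "L \<inter> O' \<noteq> {}" by fact
    fix A B
    assume AB: "closedin (var_top X (L \<inter> O')) A \<and> closedin (var_top X (L \<inter> O')) B \<and> A \<union> B = L \<inter> O'"
    show "A = L \<inter> O' \<or> B = L \<inter> O'"
    proof (rule ccontr)
      assume "\<not> ?thesis"
      then obtain a b where a: "a \<in> L" "a \<in> O'" "a \<notin> A" and b: "b \<in> L" "b \<in> O'" "b \<notin> B"
        using AB by blast
      obtain f where f: "f \<in> poly_fun X" "f a \<noteq> 0" "\<forall>v\<in>A. f v = 0"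
        using AB a unfolding closedin_var_top[OF sub] by blast
      obtain g where g: "g \<in> poly_fun X" "g b \<noteq> 0" "\<forall>v\<in>B. g v = 0"
        using AB b unfolding closedin_var_top[OF sub] by blast
      obtain p where p: "p \<in> poly_fun X" "p a \<noteq> 0" "{v \<in> affine_space X. p v \<noteq> 0} \<subseteq> O'"
        using O a unfolding openin_zariski_iff by blast
      obtain t where t: "f (line a b t) * p (line a b t) \<noteq> 0" "g (line a b t) \<noteq> 0"
        using line_nonzero[OF poly_fun.mult[OF f(1) p(1)] _ g(1,2), of a] f p by auto
      have "line a b t \<in> L" using L a b by auto
      moreover have "line a b t \<in> O'" using p(3) t L a b line_affine_space[of a X b t] by auto
      ultimately have "line a b t \<in> A \<union> B" using AB by blast
      then show False using t f g by auto
    qed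
  qed
qed

subsection \<open>Rational functions with a global denominator\<close>

text \<open>A single quotient serves on all of W, whereas \<open>regular_fun\<close> allows it to
  change locally. The maps of the charts and of the bundle are given by one formula each, in which
  only determinants are inverted, so the global version suffices and composes easily.\<close>

definition rat_on :: "'x set \<Rightarrow> ('x \<Rightarrow> 'k::field) set \<Rightarrow> (('x \<Rightarrow> 'k) \<Rightarrow> 'k) \<Rightarrow> bool" where
  "rat_on X W f \<longleftrightarrow> (\<exists>p\<in>poly_fun X. \<exists>q\<in>poly_fun X. \<forall>w\<in>W. q w \<noteq> 0 \<and> f w = p w / q w)"

lemma rat_onE:
  assumes "rat_on X W f"
  obtains p q where "p \<in> poly_fun X" "q \<in> poly_fun X" "\<And>w. w \<in> W \<Longrightarrow> q w \<noteq> 0"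
    "\<And>w. w \<in> W \<Longrightarrow> f w = p w / q w"
  using assms unfolding rat_on_def by blast

lemma rat_on_poly: "f \<in> poly_fun X \<Longrightarrow> rat_on X W f"
  unfolding rat_on_def by (rule bexI[of _ f], rule bexI[of _ "\<lambda>_. 1"]) (auto intro: poly_fun.const)

lemma rat_on_const [intro]: "rat_on X W (\<lambda>v. a)"
  by (rule rat_on_poly) (rule poly_fun.const)

lemma rat_on_coord: "a \<in> X \<Longrightarrow> rat_on X W (\<lambda>v. v a)"
  by (rule rat_on_poly) (rule poly_fun.coord)

lemma rat_on_cong: "rat_on X W f \<Longrightarrow> (\<And>w. w \<in> W \<Longrightarrow> f w = g w) \<Longrightarrow> rat_on X W g"
  unfolding rat_on_def by simp

lemma rat_on_affine_space_coord: "W \<subseteq> affine_space Y \<Longrightarrow> rat_on Y W (\<lambda>s. s z)"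
proof (cases "z \<in> Y")
  case False
  assume "W \<subseteq> affine_space Y"
  with False have "w z = 0" if "w \<in> W" for w using that by (auto simp: affine_space_def)
  then show ?thesis by (intro rat_on_cong[OF rat_on_const[of Y W 0]]) simp
qed (simp add: rat_on_coord)

lemma rat_on_subset: "rat_on X W f \<Longrightarrow> W' \<subseteq> W \<Longrightarrow> rat_on X W' f"
  unfolding rat_on_def by blast

lemma rat_on_mult:
  assumes "rat_on X W f" "rat_on X W g"
  shows "rat_on X W (\<lambda>v. f v * g v)"
proof -
  from assms(1) obtain p q where f: "p \<in> poly_fun X" "q \<in> poly_fun X"
    "\<And>w. w \<in> W \<Longrightarrow> q w \<noteq> 0" "\<And>w. w \<in> W \<Longrightarrow> f w = p w / q w" by (rule rat_onE) blast
  from assms(2) obtain p' q' where g: "p' \<in> poly_fun X" "q' \<in> poly_fun X"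
    "\<And>w. w \<in> W \<Longrightarrow> q' w \<noteq> 0" "\<And>w. w \<in> W \<Longrightarrow> g w = p' w / q' w" by (rule rat_onE) blast
  show ?thesis unfolding rat_on_def
    by (rule bexI[of _ "\<lambda>v. p v * p' v"], rule bexI[of _ "\<lambda>v. q v * q' v"])
      (auto simp: f g intro: poly_fun.intros f g)
qed

lemma rat_on_add:
  assumes "rat_on X W f" "rat_on X W g"
  shows "rat_on X W (\<lambda>v. f v + g v)"
proof -
  from assms(1) obtain p q where f: "p \<in> poly_fun X" "q \<in> poly_fun X"
    "\<And>w. w \<in> W \<Longrightarrow> q w \<noteq> 0" "\<And>w. w \<in> W \<Longrightarrow> f w = p w / q w" by (rule rat_onE) blast
  from assms(2) obtain p' q' where g: "p' \<in> poly_fun X" "q' \<in> poly_fun X"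
    "\<And>w. w \<in> W \<Longrightarrow> q' w \<noteq> 0" "\<And>w. w \<in> W \<Longrightarrow> g w = p' w / q' w" by (rule rat_onE) blast
  show ?thesis unfolding rat_on_def
    by (rule bexI[of _ "\<lambda>v. p v * q' v + p' v * q v"], rule bexI[of _ "\<lambda>v. q v * q' v"])
      (auto simp: f g field_simps intro!: poly_fun.intros f g)
qed

lemma rat_on_inverse:
  assumes "rat_on X W f" "\<And>w. w \<in> W \<Longrightarrow> f w \<noteq> 0"
  shows "rat_on X W (\<lambda>v. inverse (f v))"
proof -
  from assms(1) obtain p q where f: "p \<in> poly_fun X" "q \<in> poly_fun X"
    "\<And>w. w \<in> W \<Longrightarrow> q w \<noteq> 0" "\<And>w. w \<in> W \<Longrightarrow> f w = p w / q w" by (rule rat_onE) blast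
  show ?thesis unfolding rat_on_def
    by (rule bexI[of _ q], rule bexI[of _ p]) (use f assms(2) in \<open>force+\<close>)
qed

lemma rat_on_divide:
  "rat_on X W f \<Longrightarrow> rat_on X W g \<Longrightarrow> (\<And>w. w \<in> W \<Longrightarrow> g w \<noteq> 0) \<Longrightarrow> rat_on X W (\<lambda>v. f v / g v)"
  unfolding divide_inverse by (intro rat_on_mult rat_on_inverse)

lemma rat_on_uminus: "rat_on X W f \<Longrightarrow> rat_on X W (\<lambda>v. - f v)"
  using rat_on_mult[OF rat_on_const[of X W "-1"], of f] by simp

lemma rat_on_diff: "rat_on X W f \<Longrightarrow> rat_on X W g \<Longrightarrow> rat_on X W (\<lambda>v. f v - g v)"
  using rat_on_add[OF _ rat_on_uminus, of X W f g] by simp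

lemma rat_on_sum:
  "(\<And>i. i \<in> I \<Longrightarrow> rat_on X W (f i)) \<Longrightarrow> rat_on X W (\<lambda>v. \<Sum>i\<in>I. f i v)"
  by (induction I rule: infinite_finite_induct) (auto intro: rat_on_add)

lemma rat_on_prod:
  "(\<And>i. i \<in> I \<Longrightarrow> rat_on X W (f i)) \<Longrightarrow> rat_on X W (\<lambda>v. \<Prod>i\<in>I. f i v)"
  by (induction I rule: infinite_finite_induct) (auto intro: rat_on_mult)

lemma rat_on_comp:
  assumes f: "rat_on X W f" and \<phi>: "\<And>a. a \<in> X \<Longrightarrow> rat_on Y W' (\<lambda>v. \<phi> v a)" and W: "\<phi> \<in> W' \<rightarrow> W"
  shows "rat_on Y W' (\<lambda>v. f (\<phi> v))"
proof -
  have *: "rat_on Y W' (\<lambda>v. p (\<phi> v))" if "p \<in> poly_fun X" for p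
    using that by induction (auto intro: rat_on_add rat_on_mult \<phi>)
  from f obtain p q where f: "p \<in> poly_fun X" "q \<in> poly_fun X"
    "\<And>w. w \<in> W \<Longrightarrow> q w \<noteq> 0" "\<And>w. w \<in> W \<Longrightarrow> f w = p w / q w" by (rule rat_onE) blast
  have "rat_on Y W' (\<lambda>v. p (\<phi> v) / q (\<phi> v))"
    using W by (intro rat_on_divide * f) auto
  moreover have "p (\<phi> w) / q (\<phi> w) = f (\<phi> w)" if "w \<in> W'" for w
    using f(4)[of "\<phi> w"] W that by (auto simp: Pi_iff)
  ultimately show ?thesis by (rule rat_on_cong)
qed

lemma rat_on_regular_fun:
  assumes "V \<subseteq> affine_space X" "rat_on X V f"
  shows "regular_fun X V f"
  unfolding regular_fun_def
proof
  fix x assume x: "x \<in> V"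
  have "openin (var_top X V) V" using assms(1) by (metis openin_topspace topspace_var_top)
  with x assms(2) show "\<exists>U. openin (var_top X V) U \<and> x \<in> U \<and>
     (\<exists>p\<in>poly_fun X. \<exists>q\<in>poly_fun X. \<forall>y\<in>U. q y \<noteq> 0 \<and> f y = p y / q y)"
    unfolding rat_on_def by blast
qed

lemma rat_on_regular_map:
  assumes "V \<subseteq> affine_space X" "\<phi> \<in> V \<rightarrow> W" "\<And>b. b \<in> Y \<Longrightarrow> rat_on X V (\<lambda>x. \<phi> x b)"
  shows "regular_map X V Y W \<phi>"
  unfolding regular_map_def using assms rat_on_regular_fun by blast

text \<open>If f cuts out a basic open set of W, the numerator of f after \<phi> cuts out its
  preimage.\<close>

lemma rat_on_continuous_map:
  assumes V: "V \<subseteq> affine_space X" and W: "W \<subseteq> affine_space Y" and \<phi>: "\<phi> \<in> V \<rightarrow> W"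
    and r: "\<And>b. b \<in> Y \<Longrightarrow> rat_on X V (\<lambda>x. \<phi> x b)"
  shows "continuous_map (var_top X V) (var_top Y W) \<phi>"
  unfolding continuous_map_def topspace_var_top[OF V] topspace_var_top[OF W]
proof (intro conjI allI impI \<phi>)
  fix U assume U: "openin (var_top Y W) U"
  show "openin (var_top X V) {x \<in> V. \<phi> x \<in> U}"
    unfolding openin_var_top[OF V]
  proof (intro conjI ballI)
    fix x assume x: "x \<in> {x \<in> V. \<phi> x \<in> U}"
    then obtain f where f: "f \<in> poly_fun Y" "f (\<phi> x) \<noteq> 0" "{v \<in> W. f v \<noteq> 0} \<subseteq> U"
      using U unfolding openin_var_top[OF W] by blast
    have "rat_on X V (\<lambda>v. f (\<phi> v))"
      by (rule rat_on_comp[OF rat_on_poly[OF f(1), of UNIV] r]) auto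
    then obtain p q where p: "p \<in> poly_fun X" "q \<in> poly_fun X"
      "\<And>w. w \<in> V \<Longrightarrow> q w \<noteq> 0" "\<And>w. w \<in> V \<Longrightarrow> f (\<phi> w) = p w / q w" by (rule rat_onE) blast
    show "\<exists>f\<in>poly_fun X. f x \<noteq> 0 \<and> {v \<in> V. f v \<noteq> 0} \<subseteq> {x \<in> V. \<phi> x \<in> U}"
    proof (rule bexI[OF _ p(1)], intro conjI subsetI)
      show "p x \<noteq> 0" using f(2) p(4)[of x] x by auto
      fix v assume v: "v \<in> {v \<in> V. p v \<noteq> 0}"
      then have "f (\<phi> v) \<noteq> 0" using p by auto
      then show "v \<in> {x \<in> V. \<phi> x \<in> U}" using v f(3) \<phi> by auto
    qed
  qed auto
qed

lemma rat_on_openin: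
  assumes "V \<subseteq> affine_space X" "rat_on X V f"
  shows "\<exists>p\<in>poly_fun X. {v \<in> V. f v \<noteq> 0} = {v \<in> V. p v \<noteq> 0}"
proof -
  from assms(2) obtain p q where "p \<in> poly_fun X" "q \<in> poly_fun X"
    "\<And>w. w \<in> V \<Longrightarrow> q w \<noteq> 0" "\<And>w. w \<in> V \<Longrightarrow> f w = p w / q w" by (rule rat_onE) blast
  then show ?thesis by (intro bexI[of _ p]) auto
qed

lemma rat_on_closedin_zariski:
  assumes "\<And>i. i \<in> I \<Longrightarrow> rat_on X (affine_space X) (f i)"
  shows "closedin (zariski X) {v \<in> affine_space X. \<forall>i\<in>I. f i v = 0}"
proof -
  have "\<exists>p. p \<in> poly_fun X \<and> (\<forall>v\<in>affine_space X. f i v = 0 \<longleftrightarrow> p v = 0)" if "i \<in> I" for i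
    using assms[OF that] by (rule rat_onE) (metis divide_eq_0_iff)
  then obtain p where p: "\<And>i. i \<in> I \<Longrightarrow> p i \<in> poly_fun X"
    "\<And>i v. i \<in> I \<Longrightarrow> v \<in> affine_space X \<Longrightarrow> f i v = 0 \<longleftrightarrow> p i v = 0" by metis
  have "closedin (zariski X) {v \<in> affine_space X. \<forall>g\<in>p ` I. g v = 0}"
    by (rule closedin_zariski_zeros) (use p in auto)
  also have "{v \<in> affine_space X. \<forall>g\<in>p ` I. g v = 0} = {v \<in> affine_space X. \<forall>i\<in>I. f i v = 0}"
    using p by auto
  finally show ?thesis .
qed

section \<open>Krull dimension\<close>

lemma irreducible_subtopology_iff:
  assumes "Z \<subseteq> topspace T"
  shows "irreducible_space (subtopology T Z) \<longleftrightarrow> Z \<noteq> {} \<and>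
    (\<forall>A B. closedin T A \<longrightarrow> closedin T B \<longrightarrow> Z \<subseteq> A \<union> B \<longrightarrow> Z \<subseteq> A \<or> Z \<subseteq> B)"
proof -
  have top: "topspace (subtopology T Z) = Z" using assms by auto
  show ?thesis
  proof (intro iffI conjI allI impI)
    assume i: "irreducible_space (subtopology T Z)"
    then show "Z \<noteq> {}" unfolding irreducible_space_def top by blast
    fix A B assume AB: "closedin T A" "closedin T B" "Z \<subseteq> A \<union> B"
    have "closedin (subtopology T Z) (A \<inter> Z)" "closedin (subtopology T Z) (B \<inter> Z)"
      using AB by (auto simp: closedin_subtopology)
    moreover have "A \<inter> Z \<union> B \<inter> Z = Z" using AB by auto
    ultimately have "A \<inter> Z = Z \<or> B \<inter> Z = Z"
      using i unfolding irreducible_space_def top by blast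
    then show "Z \<subseteq> A \<or> Z \<subseteq> B" by blast
  next
    assume r: "Z \<noteq> {} \<and>
      (\<forall>A B. closedin T A \<longrightarrow> closedin T B \<longrightarrow> Z \<subseteq> A \<union> B \<longrightarrow> Z \<subseteq> A \<or> Z \<subseteq> B)"
    show "irreducible_space (subtopology T Z)"
      unfolding irreducible_space_def top
    proof (intro conjI allI impI)
      show "Z \<noteq> {}" using r by blast
      fix A B assume AB: "closedin (subtopology T Z) A \<and> closedin (subtopology T Z) B \<and> A \<union> B = Z"
      then obtain A' B' where A': "closedin T A'" "A = A' \<inter> Z" and B': "closedin T B'" "B = B' \<inter> Z"
        by (auto simp: closedin_subtopology)
      then have "Z \<subseteq> A' \<union> B'" using AB by blast
      then have "Z \<subseteq> A' \<or> Z \<subseteq> B'" using r A'(1) B'(1) by blast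
      then show "A = Z \<or> B = Z" using A' B' by blast
    qed
  qed
qed

text \<open>Irreducibility of the subspace Z, expressed by closed sets of the ambient space; in this
  form it passes to images, closures and open parts without nested subtopologies.\<close>

definition irred_in :: "'a topology \<Rightarrow> 'a set \<Rightarrow> bool" where
  "irred_in T Z \<longleftrightarrow> Z \<subseteq> topspace T \<and> Z \<noteq> {} \<and>
    (\<forall>A B. closedin T A \<longrightarrow> closedin T B \<longrightarrow> Z \<subseteq> A \<union> B \<longrightarrow> Z \<subseteq> A \<or> Z \<subseteq> B)"

definition irred_chain :: "'a topology \<Rightarrow> nat \<Rightarrow> (nat \<Rightarrow> 'a set) \<Rightarrow> bool" where
  "irred_chain T k Z \<longleftrightarrow> (\<forall>i\<le>k. closedin T (Z i) \<and> irred_in T (Z i)) \<and> (\<forall>i<k. Z i \<subset> Z (Suc i))"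

lemma irred_inI: "irreducible_space (subtopology T Z) \<Longrightarrow> Z \<subseteq> topspace T \<Longrightarrow> irred_in T Z"
  unfolding irred_in_def by (metis irreducible_subtopology_iff)

lemma irred_inD: "irred_in T Z \<Longrightarrow> irreducible_space (subtopology T Z)"
  unfolding irred_in_def by (metis irreducible_subtopology_iff)

lemma krull_dim_chain: "krull_dim T = Sup {enat k | k. \<exists>Z. irred_chain T k Z}"
proof -
  have "(\<forall>i\<le>k. closedin T (Z i) \<and> irreducible_space (subtopology T (Z i))) \<and> (\<forall>i<k. Z i \<subset> Z (Suc i))
    \<longleftrightarrow> irred_chain T k Z" for k and Z :: "nat \<Rightarrow> 'a set"
    unfolding irred_chain_def using irred_inI irred_inD closedin_subset by metis
  then show ?thesis unfolding krull_dim_def by simp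
qed

lemma irred_chain_le_krull_dim: "irred_chain T k Z \<Longrightarrow> enat k \<le> krull_dim T"
  unfolding krull_dim_chain by (rule Sup_upper) blast

lemma krull_dim_leI: "(\<And>k Z. irred_chain T k Z \<Longrightarrow> enat k \<le> m) \<Longrightarrow> krull_dim T \<le> m"
  unfolding krull_dim_chain by (rule Sup_least) blast

lemma irred_in_subtopology:
  "U \<subseteq> topspace T \<Longrightarrow> irred_in (subtopology T U) Z \<longleftrightarrow> Z \<subseteq> U \<and> irred_in T Z"
proof -
  assume U: "U \<subseteq> topspace T"
  have *: "irred_in S Z \<longleftrightarrow> Z \<subseteq> topspace S \<and> irreducible_space (subtopology S Z)" for S :: "'a topology"
    using irred_inI irred_inD irred_in_def by metis
  have "subtopology (subtopology T U) Z = subtopology T Z" if "Z \<subseteq> U"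
    using that by (simp add: subtopology_subtopology inf.absorb2)
  then show ?thesis using U unfolding * by auto
qed

lemma irred_in_closure_of: "irred_in T Z \<Longrightarrow> irred_in T (T closure_of Z)"
  unfolding irred_in_def
  by (metis closure_of_eq_empty closure_of_minimal closure_of_subset closure_of_subset_topspace
      order_trans)

lemma irred_in_Int_open:
  assumes Z: "irred_in T Z" and U: "openin T U" and ne: "Z \<inter> U \<noteq> {}"
  shows "irred_in T (Z \<inter> U)"
  unfolding irred_in_def
proof (intro conjI allI impI)
  show "Z \<inter> U \<subseteq> topspace T" using Z by (auto simp: irred_in_def)
  fix A B assume AB: "closedin T A" "closedin T B" "Z \<inter> U \<subseteq> A \<union> B"
  \<comment> \<open>The complement of U is added to B, so that a cover of the part of Z in U becomes
    a cover of all of Z.\<close>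
  let ?C = "topspace T - U"
  have C: "closedin T (B \<union> ?C)" using AB U by auto
  have "Z \<subseteq> A \<union> (B \<union> ?C)" using AB Z unfolding irred_in_def by blast
  then have "Z \<subseteq> A \<or> Z \<subseteq> B \<union> ?C" using Z AB(1) C unfolding irred_in_def by blast
  then show "Z \<inter> U \<subseteq> A \<or> Z \<inter> U \<subseteq> B" by blast
qed (fact ne)

text \<open>Closures in T turn a chain of U into a chain of T; they stay distinct because
  intersecting them with U gives the old sets back.\<close>

lemma krull_dim_openin_le:
  assumes U: "openin T U"
  shows "krull_dim (subtopology T U) \<le> krull_dim T"
proof (rule krull_dim_leI)
  fix k Z assume Z: "irred_chain (subtopology T U) k Z"
  have Ut: "U \<subseteq> topspace T" using U by (rule openin_subset)
  define Y where "Y i = T closure_of (Z i)" for i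
  have YU: "Y i \<inter> U = Z i" if "i \<le> k" for i
  proof -
    have "closedin (subtopology T U) (Z i)" using Z that by (auto simp: irred_chain_def)
    then obtain C where C: "closedin T C" "Z i = C \<inter> U" by (auto simp: closedin_subtopology)
    have "Y i \<subseteq> C" unfolding Y_def by (rule closure_of_minimal) (use C in auto)
    moreover have "Z i \<subseteq> Y i" unfolding Y_def by (rule closure_of_subset) (use C Ut in auto)
    ultimately show ?thesis using C by auto
  qed
  have "irred_chain T k Y"
    unfolding irred_chain_def
  proof (intro conjI allI impI)
    fix i assume i: "i \<le> k"
    show "closedin T (Y i)" by (simp add: Y_def)
    have "irred_in T (Z i)"
      using Z i Ut by (auto simp: irred_chain_def irred_in_subtopology)
    then show "irred_in T (Y i)" unfolding Y_def by (rule irred_in_closure_of)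
  next
    fix i assume i: "i < k"
    then have "Z i \<subset> Z (Suc i)" using Z by (auto simp: irred_chain_def)
    moreover from this have "Y i \<subseteq> Y (Suc i)" unfolding Y_def by (intro closure_of_mono) auto
    ultimately show "Y i \<subset> Y (Suc i)" using YU[of i] YU[of "Suc i"] i by auto
  qed
  then show "enat k \<le> krull_dim T" by (rule irred_chain_le_krull_dim)
qed

text \<open>All members of a chain contain the points of the smallest one. An open set U around such
  a point meets every member, and if two consecutive traces on U agreed, the larger irreducible
  member would be covered by the smaller one and the complement of U.\<close>

lemma krull_dim_cover_le:
  assumes cov: "\<And>x. x \<in> topspace T \<Longrightarrow> \<exists>U. openin T U \<and> x \<in> U \<and> krull_dim (subtopology T U) \<le> m"
  shows "krull_dim T \<le> m"
proof (rule krull_dim_leI)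
  fix k Z assume Z: "irred_chain T k Z"
  then have "irred_in T (Z 0)" by (auto simp: irred_chain_def)
  then obtain x where x: "x \<in> Z 0" "x \<in> topspace T" unfolding irred_in_def by blast
  with cov obtain U where U: "openin T U" "x \<in> U" "krull_dim (subtopology T U) \<le> m" by blast
  have Ut: "U \<subseteq> topspace T" using U(1) by (rule openin_subset)
  have xZ: "x \<in> Z i" if "i \<le> k" for i
    using that
  proof (induction i)
    case 0 show ?case by (fact x(1))
  next
    case (Suc i)
    then have "Z i \<subset> Z (Suc i)" using Z by (auto simp: irred_chain_def)
    then show ?case using Suc by auto
  qed
  have "irred_chain (subtopology T U) k (\<lambda>i. Z i \<inter> U)"
    unfolding irred_chain_def
  proof (intro conjI allI impI)
    fix i assume i: "i \<le> k"
    show "closedin (subtopology T U) (Z i \<inter> U)"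
      using Z i by (auto simp: irred_chain_def closedin_subtopology)
    have "irred_in T (Z i \<inter> U)"
      by (rule irred_in_Int_open) (use Z i U(1) xZ[OF i] U(2) in \<open>auto simp: irred_chain_def\<close>)
    then show "irred_in (subtopology T U) (Z i \<inter> U)" using Ut by (simp add: irred_in_subtopology)
  next
    fix i assume i: "i < k"
    have s: "Z i \<subset> Z (Suc i)" "closedin T (Z i)" "irred_in T (Z (Suc i))"
      using Z i by (auto simp: irred_chain_def)
    have "Z i \<inter> U \<noteq> Z (Suc i) \<inter> U"
    proof
      assume e: "Z i \<inter> U = Z (Suc i) \<inter> U"
      have "closedin T (topspace T - U)" using U(1) by auto
      moreover have "Z (Suc i) \<subseteq> Z i \<union> (topspace T - U)"
        using e s(3) unfolding irred_in_def by blast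
      ultimately have "Z (Suc i) \<subseteq> Z i \<or> Z (Suc i) \<subseteq> topspace T - U"
        using s(2,3) unfolding irred_in_def by blast
      then show False using s(1) xZ[of "Suc i"] i U(2) by auto
    qed
    then show "Z i \<inter> U \<subset> Z (Suc i) \<inter> U" using s by blast
  qed
  then show "enat k \<le> m" using U(3) irred_chain_le_krull_dim order_trans by blast
qed

lemma irred_in_continuous_image:
  assumes f: "continuous_map T T' f" and Z: "irred_in T Z"
  shows "irred_in T' (f ` Z)"
  unfolding irred_in_def
proof (intro conjI allI impI)
  show "f ` Z \<subseteq> topspace T'" using f Z by (auto simp: irred_in_def continuous_map_def)
  show "f ` Z \<noteq> {}" using Z by (auto simp: irred_in_def)
  fix A B assume AB: "closedin T' A" "closedin T' B" "f ` Z \<subseteq> A \<union> B"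
  let ?A = "{x \<in> topspace T. f x \<in> A}" and ?B = "{x \<in> topspace T. f x \<in> B}"
  have "closedin T ?A" "closedin T ?B"
    using closedin_continuous_map_preimage[OF f] AB by auto
  moreover have "Z \<subseteq> ?A \<union> ?B" using AB Z by (auto simp: irred_in_def)
  ultimately have "Z \<subseteq> ?A \<or> Z \<subseteq> ?B" using Z unfolding irred_in_def by blast
  then show "f ` Z \<subseteq> A \<or> f ` Z \<subseteq> B" by blast
qed

lemma irreducible_space_continuous_image:
  assumes f: "continuous_map T T' f" and T: "irreducible_space T" and on: "f ` topspace T = topspace T'"
  shows "irreducible_space T'"
proof -
  have "irred_in T (topspace T)" using T by (intro irred_inI) auto
  then have "irred_in T' (f ` topspace T)" by (rule irred_in_continuous_image[OF f])
  then have "irreducible_space (subtopology T' (topspace T'))" unfolding on by (rule irred_inD)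
  then show ?thesis by simp
qed

lemma krull_dim_homeomorphic_maps_le:
  assumes "homeomorphic_maps T T' f g"
  shows "krull_dim T \<le> krull_dim T'"
proof (rule krull_dim_leI)
  fix k Z assume Z: "irred_chain T k Z"
  have f: "continuous_map T T' f" and g: "continuous_map T' T g"
    and gf: "\<And>x. x \<in> topspace T \<Longrightarrow> g (f x) = x" and fg: "\<And>y. y \<in> topspace T' \<Longrightarrow> f (g y) = y"
    using assms by (auto simp: homeomorphic_maps_def)
  have Zt: "Z i \<subseteq> topspace T" if "i \<le> k" for i
    using Z that by (auto simp: irred_chain_def irred_in_def)
  have im: "f ` Z i = {y \<in> topspace T'. g y \<in> Z i}" if "i \<le> k" for i
  proof (intro equalityI subsetI)
    fix y assume "y \<in> f ` Z i"
    then obtain x where "x \<in> Z i" "y = f x" by blast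
    with Zt[OF that] gf[of x] f show "y \<in> {y \<in> topspace T'. g y \<in> Z i}"
      by (auto simp: continuous_map_def)
  next
    fix y assume "y \<in> {y \<in> topspace T'. g y \<in> Z i}"
    then show "y \<in> f ` Z i" using fg[of y] by (metis (mono_tags, lifting) imageI mem_Collect_eq)
  qed
  have "irred_chain T' k (\<lambda>i. f ` Z i)"
    unfolding irred_chain_def
  proof (intro conjI allI impI)
    fix i assume i: "i \<le> k"
    have "closedin T (Z i)" using Z i by (auto simp: irred_chain_def)
    then show "closedin T' (f ` Z i)"
      unfolding im[OF i] by (rule closedin_continuous_map_preimage[OF g])
    show "irred_in T' (f ` Z i)"
      by (rule irred_in_continuous_image[OF f]) (use Z i in \<open>auto simp: irred_chain_def\<close>)
  next
    fix i assume i: "i < k"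
    then have s: "Z i \<subset> Z (Suc i)" using Z by (auto simp: irred_chain_def)
    then obtain x where x: "x \<in> Z (Suc i)" "x \<notin> Z i" by blast
    have "f x \<notin> f ` Z i"
    proof
      assume "f x \<in> f ` Z i"
      then obtain y where "y \<in> Z i" "f x = f y" by blast
      then show False using gf[of x] gf[of y] x Zt[of i] Zt[of "Suc i"] i by force
    qed
    then show "f ` Z i \<subset> f ` Z (Suc i)" using s x by blast
  qed
  then show "enat k \<le> krull_dim T'" by (rule irred_chain_le_krull_dim)
qed

lemma krull_dim_homeomorphic_maps:
  assumes "homeomorphic_maps T T' f g"
  shows "krull_dim T = krull_dim T'"
  using krull_dim_homeomorphic_maps_le[OF assms] assms homeomorphic_maps_sym
    krull_dim_homeomorphic_maps_le by (metis order_antisym)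

subsection \<open>Algebraic relations\<close>

text \<open>The bound e applies to each exponent separately. The count is then a power of e + 1, and
  bounds add up under multiplication.\<close>

definition monomials :: "'x set \<Rightarrow> nat \<Rightarrow> (('x \<Rightarrow> 'k::field) \<Rightarrow> 'k) set" where
  "monomials Y e = (\<lambda>a v. \<Prod>i\<in>Y. v i ^ a i) ` (Y \<rightarrow>\<^sub>E {..e})"

interpretation fs: vector_space "fun_scale :: 'k::field \<Rightarrow> ('x \<Rightarrow> 'k) \<Rightarrow> 'x \<Rightarrow> 'k"
  by (rule vector_space_fun_scale)

lemma finite_monomials: "finite Y \<Longrightarrow> finite (monomials Y e)"
  unfolding monomials_def by (intro finite_imageI finite_PiE) auto

lemma card_monomials_le: "finite Y \<Longrightarrow> card (monomials Y e) \<le> (e + 1) ^ card Y"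
  unfolding monomials_def
  by (rule order_trans[OF card_image_le]) (auto simp: card_PiE finite_PiE)

lemma monomials_mono: "e \<le> e' \<Longrightarrow> monomials Y e \<subseteq> monomials Y e'"
  unfolding monomials_def by (intro image_mono PiE_mono) auto

lemma monomials_mult:
  assumes "f \<in> monomials Y e" "g \<in> monomials Y e'"
  shows "(\<lambda>v. f v * g v) \<in> monomials Y (e + e')"
proof -
  from assms obtain a b where a: "a \<in> Y \<rightarrow>\<^sub>E {..e}" "f = (\<lambda>v. \<Prod>i\<in>Y. v i ^ a i)"
    and b: "b \<in> Y \<rightarrow>\<^sub>E {..e'}" "g = (\<lambda>v. \<Prod>i\<in>Y. v i ^ b i)"
    unfolding monomials_def by blast
  let ?c = "restrict (\<lambda>i. a i + b i) Y"
  have "?c \<in> Y \<rightarrow>\<^sub>E {..e + e'}" using a b by (fastforce simp: PiE_iff intro: add_mono)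
  moreover have "(\<lambda>v. f v * g v) = (\<lambda>v. \<Prod>i\<in>Y. v i ^ ?c i)"
    unfolding a b by (simp add: fun_eq_iff power_add flip: prod.distrib)
  ultimately show ?thesis unfolding monomials_def by (intro image_eqI[of _ _ ?c])
qed

lemma span_monomials_mult:
  fixes f g :: "('x \<Rightarrow> 'k::field) \<Rightarrow> 'k"
  assumes f: "f \<in> fs.span (monomials Y e)" and g: "g \<in> fs.span (monomials Y e')"
  shows "(\<lambda>v. f v * g v) \<in> fs.span (monomials Y (e + e'))"
proof -
  have *: "(\<lambda>v. m v * g v) \<in> fs.span (monomials Y (e + e'))" if m: "m \<in> monomials Y e" for m
    using g
  proof (induction rule: fs.span_induct_alt)
    case base
    have "(\<lambda>v. m v * (0::('x \<Rightarrow> 'k) \<Rightarrow> 'k) v) = 0" by (simp add: fun_eq_iff)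
    then show ?case using fs.span_zero by metis
  next
    case (step c x y)
    have "(\<lambda>v. m v * (fun_scale c x + y) v) = fun_scale c (\<lambda>v. m v * x v) + (\<lambda>v. m v * y v)"
      by (simp add: fun_eq_iff fun_scale_def algebra_simps)
    also have "\<dots> \<in> fs.span (monomials Y (e + e'))"
      by (intro fs.span_add fs.span_scale step(2) fs.span_base monomials_mult[OF m step(1)])
    finally show ?case .
  qed
  show ?thesis using f
  proof (induction rule: fs.span_induct_alt)
    case base
    have "(\<lambda>v. (0::('x \<Rightarrow> 'k) \<Rightarrow> 'k) v * g v) = 0" by (simp add: fun_eq_iff)
    then show ?case using fs.span_zero by metis
  next
    case (step c x y)
    have "(\<lambda>v. (fun_scale c x + y) v * g v) = fun_scale c (\<lambda>v. x v * g v) + (\<lambda>v. y v * g v)"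
      by (simp add: fun_eq_iff fun_scale_def algebra_simps)
    also have "\<dots> \<in> fs.span (monomials Y (e + e'))"
      by (intro fs.span_add fs.span_scale step(2) *[OF step(1)])
    finally show ?case .
  qed
qed

lemma one_in_span_monomials: "(\<lambda>v. 1) \<in> fs.span (monomials Y e)"
proof (rule fs.span_base)
  show "(\<lambda>v. 1) \<in> monomials Y e" unfolding monomials_def
    by (rule image_eqI[of _ _ "restrict (\<lambda>_. 0) Y"]) auto
qed

lemma span_monomials_power:
  assumes "f \<in> fs.span (monomials Y e)"
  shows "(\<lambda>v. f v ^ m) \<in> fs.span (monomials Y (m * e))"
proof (induction m)
  case 0 show ?case using one_in_span_monomials by simp
next
  case (Suc m) then show ?case using span_monomials_mult[OF assms Suc] by simp
qed

lemma span_monomials_prod: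
  assumes "finite I" "\<And>i. i \<in> I \<Longrightarrow> f i \<in> fs.span (monomials Y e)"
  shows "(\<lambda>v. \<Prod>i\<in>I. f i v) \<in> fs.span (monomials Y (card I * e))"
  using assms
proof (induction I)
  case empty show ?case using one_in_span_monomials by simp
next
  case (insert i I)
  then show ?case using span_monomials_mult[of "f i" Y e "\<lambda>v. \<Prod>i\<in>I. f i v" "card I * e"] by simp
qed

lemma poly_fun_span_monomials:
  fixes f :: "('a \<Rightarrow> 'b::field) \<Rightarrow> 'b"
  assumes "finite Y" "f \<in> poly_fun Y"
  shows "\<exists>e. f \<in> fs.span (monomials Y e)"
  using assms(2)
proof induction
  case (const a)
  have "(\<lambda>v. a) = fun_scale a (\<lambda>v. 1)" by (simp add: fun_eq_iff fun_scale_def)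
  then show ?case using one_in_span_monomials fs.span_scale by metis
next
  case (coord a)
  have "(\<lambda>v :: 'a \<Rightarrow> 'b. v a) \<in> monomials Y 1"
    unfolding monomials_def
  proof (rule image_eqI)
    show "restrict (\<lambda>i. if i = a then 1 else 0) Y \<in> Y \<rightarrow>\<^sub>E {..1::nat}" by auto
    show "(\<lambda>v :: 'a \<Rightarrow> 'b. v a) = (\<lambda>v. \<Prod>i\<in>Y. v i ^ restrict (\<lambda>i. if i = a then 1 else 0) Y i)"
    proof
      fix v :: "'a \<Rightarrow> 'b"
      have "v a = (\<Prod>i\<in>Y. if i = a then v i else 1)" using coord assms(1) by simp
      also have "\<dots> = (\<Prod>i\<in>Y. v i ^ restrict (\<lambda>i. if i = a then 1 else 0) Y i)"
        by (intro prod.cong) auto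
      finally show "v a = (\<Prod>i\<in>Y. v i ^ restrict (\<lambda>i. if i = a then 1 else 0) Y i)" .
    qed
  qed
  then show ?case using fs.span_base by blast
next
  case (add f g)
  then obtain e e' where "f \<in> fs.span (monomials Y e)" "g \<in> fs.span (monomials Y e')" by blast
  then have "f \<in> fs.span (monomials Y (max e e'))" "g \<in> fs.span (monomials Y (max e e'))"
    using fs.span_mono[OF monomials_mono] by (meson max.cobounded1 max.cobounded2 subsetD)+
  then have "f + g \<in> fs.span (monomials Y (max e e'))" by (rule fs.span_add)
  then show ?case by (auto simp: plus_fun_def)
next
  case (mult f g)
  then show ?case using span_monomials_mult by blast
qed

lemma poly_fun_span_monomials_uniform:
  fixes f :: "'i \<Rightarrow> ('a \<Rightarrow> 'b::field) \<Rightarrow> 'b"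
  assumes "finite Y" "finite I" "\<And>i. i \<in> I \<Longrightarrow> f i \<in> poly_fun Y"
  shows "\<exists>e. \<forall>i\<in>I. f i \<in> fs.span (monomials Y e)"
  using assms(2,3)
proof (induction I)
  case (insert i I)
  then obtain e e' where e: "\<forall>j\<in>I. f j \<in> fs.span (monomials Y e)" "f i \<in> fs.span (monomials Y e')"
    using poly_fun_span_monomials[OF assms(1)] by (metis insertCI)
  have "fs.span (monomials Y e) \<subseteq> (fs.span (monomials Y (max e e')) :: (('a \<Rightarrow> 'b) \<Rightarrow> 'b) set)"
    "fs.span (monomials Y e') \<subseteq> (fs.span (monomials Y (max e e')) :: (('a \<Rightarrow> 'b) \<Rightarrow> 'b) set)"
    by (intro fs.span_mono monomials_mono; simp)+
  with e have "\<forall>j\<in>insert i I. f j \<in> fs.span (monomials Y (max e e'))" by blast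
  then show ?case by blast
qed simp

lemma sum_fun_apply: "(\<Sum>i\<in>I. f i) x = (\<Sum>i\<in>I. f i x)"
  by (induction I rule: infinite_finite_induct) auto

text \<open>Dependence of a set would overlook repetitions in the family m; two equal members give a
  relation with coefficients 1 and -1.\<close>

lemma family_dependent:
  fixes m :: "nat \<Rightarrow> 'x \<Rightarrow> 'k::field"
  assumes "finite B" "card B < N" "\<And>k. k < N \<Longrightarrow> m k \<in> fs.span B"
  shows "\<exists>l. (\<exists>k<N. l k \<noteq> 0) \<and> (\<forall>v. (\<Sum>k<N. l k * m k v) = 0)"
proof (cases "inj_on m {..<N}")
  case True
  have "fs.dependent (m ` {..<N})"
  proof (rule ccontr)
    assume "fs.independent (m ` {..<N})"
    then have "card (m ` {..<N}) \<le> card B"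
      using fs.independent_span_bound[of B "m ` {..<N}"] assms by auto
    then show False using card_image[OF True] assms(2) by simp
  qed
  then obtain u where u: "\<exists>v\<in>m ` {..<N}. u v \<noteq> 0" "(\<Sum>v\<in>m ` {..<N}. fun_scale (u v) v) = 0"
    by (subst (asm) fs.dependent_finite) auto
  have "(\<Sum>k<N. u (m k) * m k v) = 0" for v
  proof -
    have "(\<Sum>k<N. fun_scale (u (m k)) (m k)) = 0"
      using u(2) by (simp add: sum.reindex[OF True])
    from fun_cong[OF this, of v] show ?thesis by (simp add: fun_scale_def sum_fun_apply)
  qed
  with u(1) show ?thesis by (intro exI[of _ "\<lambda>k. u (m k)"]) auto
next
  case False
  then obtain a b where ab: "a < N" "b < N" "a \<noteq> b" "m a = m b" by (auto simp: inj_on_def)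
  define l where "l k = (if k = a then 1 else if k = b then - 1 else 0 :: 'k)" for k
  have "(\<Sum>k<N. l k * m k v) = 0" for v
  proof -
    have "(\<Sum>k<N. l k * m k v) = (\<Sum>k<N. if k = a then m a v else 0) + (\<Sum>k<N. if k = b then - m b v else 0)"
      unfolding sum.distrib[symmetric] using ab by (intro sum.cong) (auto simp: l_def)
    then show ?thesis using ab by simp
  qed
  moreover have "l a \<noteq> 0" by (simp add: l_def)
  ultimately show ?thesis using ab by blast
qed

text \<open>An exponent vector with entries below t is coded by the number k whose digits in base t
  are its entries; the identity makes the substitution of \<open>z ^ (t ^ i)\<close> send the
  monomial to \<open>z ^ k\<close>.\<close>

lemma sum_digits: "(\<Sum>i<s. t ^ i * (k div t ^ i mod t)) = k mod t ^ s" for t k :: nat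
  by (induction s) (simp_all add: mod_mult2_eq mult.commute[of t])

text \<open>
  Counting: the \<open>t^|S|\<close> monomials in the \<open>p j / q\<close> with exponents \<open>< t\<close> have, after
  multiplication by a power of \<open>q\<close>, degree \<open>O(t)\<close> in the \<open>|Y| < |S|\<close> variables \<open>Y\<close>, so they become
  dependent for large \<open>t\<close>.  The resulting relation is not the zero function, as is seen
  by substituting the powers \<open>z^(t^i)\<close> of a single variable.
\<close>

lemma algebraic_relation:
  fixes p :: "'b \<Rightarrow> ('a \<Rightarrow> 'k::alg_closed_field) \<Rightarrow> 'k"
  assumes Y: "finite Y" and S: "finite S" and card: "card Y < card S"
    and p: "\<And>j. j \<in> S \<Longrightarrow> p j \<in> poly_fun Y" and q: "q \<in> poly_fun Y"
  shows "\<exists>F\<in>poly_fun S. (\<exists>v\<in>affine_space S. F v \<noteq> 0) \<and> (\<forall>w. q w \<noteq> 0 \<longrightarrow> F (\<lambda>j. p j w / q w) = 0)"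
proof -
  obtain D1 where D1: "\<forall>j\<in>S. p j \<in> fs.span (monomials Y D1)"
    using poly_fun_span_monomials_uniform[OF Y S, of p] p by blast
  obtain D2 where D2: "q \<in> fs.span (monomials Y D2)" using poly_fun_span_monomials[OF Y q] by blast
  define D where "D = max D1 D2"
  have D: "\<And>j. j \<in> S \<Longrightarrow> p j \<in> fs.span (monomials Y D)" "q \<in> fs.span (monomials Y D)"
    using D1 D2 fs.span_mono[OF monomials_mono, of _ D Y] unfolding D_def
    by (meson max.cobounded1 max.cobounded2 subsetD)+
  define s where "s = card S"
  \<comment> \<open>Since t exceeds the constant (s D + 1)^|Y|, the at most (s t D + 1)^|Y|
    monomials in the variables Y are fewer than t^(|Y| + 1), hence fewer than t^s.\<close>
  define t where "t = (s * D + 1) ^ card Y + 1"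
  obtain idx where idx: "bij_betw idx S {..<s}"
    unfolding s_def using ex_bij_betw_finite_nat[OF S] by (auto simp: atLeast0LessThan)
  define dig where "dig j k = k div t ^ idx j mod t" for j k
  have t: "t > 0" by (simp add: t_def)
  have dig_t: "dig j k < t" for j k using t by (simp add: dig_def)
  \<comment> \<open>Every factor is homogenized to total degree t in p j and q, so that all
    monomials acquire the same denominator q^(t s).\<close>
  define m where "m k = (\<lambda>w. \<Prod>j\<in>S. q w ^ (t - dig j k) * p j w ^ dig j k)" for k
  have m: "m k \<in> fs.span (monomials Y (s * (t * D)))" for k
    unfolding m_def s_def
  proof (rule span_monomials_prod[OF S])
    fix j assume j: "j \<in> S"
    have "(\<lambda>w. q w ^ (t - dig j k) * p j w ^ dig j k) \<in>
        fs.span (monomials Y ((t - dig j k) * D + dig j k * D))"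
      by (intro span_monomials_mult span_monomials_power D j)
    also have "(t - dig j k) * D + dig j k * D = t * D"
      using dig_t[of j k] by (simp add: add_mult_distrib[symmetric])
    finally show "(\<lambda>w. q w ^ (t - dig j k) * p j w ^ dig j k) \<in> fs.span (monomials Y (t * D))" .
  qed
  have "card (monomials Y (s * (t * D)) :: (('a \<Rightarrow> 'k) \<Rightarrow> 'k) set) \<le> (s * (t * D) + 1) ^ card Y"
    by (rule card_monomials_le[OF Y])
  also have "\<dots> \<le> ((s * D + 1) * t) ^ card Y"
    by (intro power_mono) (use t in \<open>auto simp: algebra_simps\<close>)
  also have "\<dots> = (s * D + 1) ^ card Y * t ^ card Y" by (rule power_mult_distrib)
  also have "\<dots> < t * t ^ card Y" using t by (intro mult_strict_right_mono) (auto simp: t_def)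
  also have "\<dots> = t ^ Suc (card Y)" by simp
  also have "\<dots> \<le> t ^ s" using card t by (intro power_increasing) (auto simp: s_def)
  finally obtain l where l: "\<exists>k<t ^ s. l k \<noteq> 0" "\<And>w. (\<Sum>k<t ^ s. l k * m k w) = 0"
    using family_dependent[OF finite_monomials[OF Y], of "s * (t * D)" "t ^ s" m] m by blast
  define F where "F v = (\<Sum>k<t ^ s. l k * (\<Prod>j\<in>S. v j ^ dig j k))" for v :: "'b \<Rightarrow> 'k"
  show ?thesis
  proof (rule bexI[of _ F], intro conjI allI impI)
    show "F \<in> poly_fun S"
      unfolding F_def
      by (intro poly_fun_sum poly_fun.mult poly_fun.const poly_fun_prod poly_fun_power poly_fun.coord)
    fix w assume qw: "q w \<noteq> 0"
    have "m k w = q w ^ (t * s) * (\<Prod>j\<in>S. (p j w / q w) ^ dig j k)" for k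
    proof -
      have "m k w = (\<Prod>j\<in>S. q w ^ t * (p j w / q w) ^ dig j k)"
        unfolding m_def
      proof (rule prod.cong)
        fix j
        have "q w ^ t = q w ^ (t - dig j k) * q w ^ dig j k"
          using dig_t[of j k] by (simp flip: power_add)
        then show "q w ^ (t - dig j k) * p j w ^ dig j k = q w ^ t * (p j w / q w) ^ dig j k"
          using qw by (simp add: power_divide)
      qed simp
      then show ?thesis by (simp add: prod.distrib s_def power_mult)
    qed
    then have "q w ^ (t * s) * F (\<lambda>j. p j w / q w) = (\<Sum>k<t ^ s. l k * m k w)"
      unfolding F_def sum_distrib_left by (intro sum.cong) (auto simp: algebra_simps)
    then show "F (\<lambda>j. p j w / q w) = 0" using l(2)[of w] qw by simp
  next
    define P where "P = (\<Sum>k<t ^ s. monom (l k) k)"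
    have "coeff P k = (if k < t ^ s then l k else 0)" for k
      unfolding P_def coeff_sum by (simp add: sum.delta)
    then have "P \<noteq> 0" using l(1) by (metis coeff_0)
    then obtain z where z: "poly P z \<noteq> 0" using poly_nonzero_exists by blast
    define v where "v j = (if j \<in> S then z ^ (t ^ idx j) else 0)" for j
    have "F v = poly P z"
      unfolding F_def P_def poly_sum poly_monom
    proof (rule sum.cong)
      fix k assume k: "k \<in> {..<t ^ s}"
      have "(\<Prod>j\<in>S. v j ^ dig j k) = (\<Prod>j\<in>S. z ^ (t ^ idx j * (k div t ^ idx j mod t)))"
        by (intro prod.cong) (auto simp: v_def dig_def power_mult)
      also have "\<dots> = (\<Prod>i<s. z ^ (t ^ i * (k div t ^ i mod t)))"
        by (rule prod.reindex_bij_betw[OF idx])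
      also have "\<dots> = z ^ (\<Sum>i<s. t ^ i * (k div t ^ i mod t))" by (simp add: power_sum)
      also have "\<dots> = z ^ k" using k by (simp add: sum_digits)
      finally show "l k * (\<Prod>j\<in>S. v j ^ dig j k) = l k * z ^ k" by simp
    qed simp
    moreover have "v \<in> affine_space S" by (simp add: affine_space_def v_def)
    ultimately show "\<exists>v\<in>affine_space S. F v \<noteq> 0" using z by metis
  qed
qed

text \<open>Setting the coordinate a0 to its constant value 1 removes one variable, so equality of
  the two cardinalities already leaves fewer variables than functions.\<close>

lemma rational_relation:
  fixes \<theta> :: "('a \<Rightarrow> 'k::alg_closed_field) \<Rightarrow> 'b \<Rightarrow> 'k"
  assumes G: "finite G" "a0 \<in> G" and S: "finite S" and card: "card G \<le> card S"
    and one: "\<And>x. x \<in> \<Gamma> \<Longrightarrow> x a0 = 1" and r: "\<And>b. b \<in> S \<Longrightarrow> rat_on G \<Gamma> (\<lambda>x. \<theta> x b)"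
  shows "\<exists>F\<in>poly_fun S. (\<exists>v\<in>affine_space S. F v \<noteq> 0) \<and> (\<forall>x\<in>\<Gamma>. F (\<theta> x) = 0)"
proof -
  have "\<forall>b\<in>S. \<exists>pq. fst pq \<in> poly_fun G \<and> snd pq \<in> poly_fun G \<and>
      (\<forall>x\<in>\<Gamma>. snd pq x \<noteq> 0 \<and> \<theta> x b = fst pq x / snd pq x)"
    using r unfolding rat_on_def by (metis fst_conv snd_conv)
  then obtain pq where pq: "\<forall>b\<in>S. fst (pq b) \<in> poly_fun G \<and> snd (pq b) \<in> poly_fun G \<and>
      (\<forall>x\<in>\<Gamma>. snd (pq b) x \<noteq> 0 \<and> \<theta> x b = fst (pq b) x / snd (pq b) x)"
    by (rule bchoice[THEN exE])
  define p q where "p b = fst (pq b)" and "q b = snd (pq b)" for b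
  have p: "p b \<in> poly_fun G" and q: "q b \<in> poly_fun G" and q0: "x \<in> \<Gamma> \<Longrightarrow> q b x \<noteq> 0"
    and \<theta>: "x \<in> \<Gamma> \<Longrightarrow> \<theta> x b = p b x / q b x" if "b \<in> S" for b x
    using pq that unfolding p_def q_def by blast+
  \<comment> \<open>The product Q of all denominators serves as common denominator; P b carries the
    denominators of the other functions.\<close>
  define P where "P b v = p b (v(a0 := 1)) * (\<Prod>b'\<in>S - {b}. q b' (v(a0 := 1)))" for b v
  define Q where "Q v = (\<Prod>b\<in>S. q b (v(a0 := 1)))" for v
  have sub: "(\<lambda>v. f (v(a0 := 1))) \<in> poly_fun (G - {a0})" if "f \<in> poly_fun G" for f :: "('a \<Rightarrow> 'k) \<Rightarrow> 'k"
  proof (rule poly_fun_comp[OF that])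
    fix a assume "a \<in> G"
    then show "(\<lambda>v. (v(a0 := 1)) a) \<in> poly_fun (G - {a0})"
      by (cases "a = a0") (auto intro: poly_fun.intros)
  qed
  have "P b \<in> poly_fun (G - {a0})" if "b \<in> S" for b
    unfolding P_def using that by (intro poly_fun.mult poly_fun_prod sub p q) auto
  moreover have "Q \<in> poly_fun (G - {a0})"
    unfolding Q_def by (intro poly_fun_prod sub q)
  moreover have "card (G - {a0}) < card S"
    using card_Diff1_less[OF G] card by simp
  ultimately obtain F where F: "F \<in> poly_fun S" "\<exists>v\<in>affine_space S. F v \<noteq> 0"
    "\<And>w. Q w \<noteq> 0 \<Longrightarrow> F (\<lambda>j. P j w / Q w) = 0"
    using algebraic_relation[of "G - {a0}" S P Q] G S by blast
  have "F (\<theta> x) = 0" if x: "x \<in> \<Gamma>" for x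
  proof -
    have x1: "x(a0 := 1) = x" using one[OF x] by auto
    have Qx: "Q x \<noteq> 0" unfolding Q_def x1 using S q0 x by simp
    have "P b x / Q x = \<theta> x b" if b: "b \<in> S" for b
    proof -
      have "Q x = q b x * (\<Prod>b'\<in>S - {b}. q b' x)" unfolding Q_def x1 by (rule prod.remove[OF S b])
      then show ?thesis using Qx \<theta>[OF b x] by (simp add: P_def x1)
    qed
    then have "F (\<lambda>j. P j x / Q x) = F (\<theta> x)" by (intro poly_fun_cong_on[OF F(1)])
    then show ?thesis using F(3)[OF Qx] by simp
  qed
  then show ?thesis using F(1,2) by blast
qed

text \<open>Polynomials in the variables X and a in the nested form g_0 + a (g_1 + a (...)) with all
  g_i free of a. This gives an induction on the degree in a without mentioning the degree.\<close>

inductive_set horner :: "'x set \<Rightarrow> 'x \<Rightarrow> (('x \<Rightarrow> 'k::comm_ring_1) \<Rightarrow> 'k) set" for X a where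
  base: "g \<in> poly_fun X \<Longrightarrow> g \<in> horner X a"
| step: "g \<in> poly_fun X \<Longrightarrow> h \<in> horner X a \<Longrightarrow> (\<lambda>v. g v + v a * h v) \<in> horner X a"

lemma horner_add_poly: "h \<in> horner X a \<Longrightarrow> g \<in> poly_fun X \<Longrightarrow> (\<lambda>v. g v + h v) \<in> horner X a"
proof (induction rule: horner.induct)
  case (base f) then show ?case by (intro horner.base poly_fun.add)
next
  case (step f h)
  then have "(\<lambda>v. (g v + f v) + v a * h v) \<in> horner X a" by (intro horner.step poly_fun.add)
  then show ?case by (simp add: add.assoc)
qed

lemma horner_add: "h \<in> horner X a \<Longrightarrow> h' \<in> horner X a \<Longrightarrow> (\<lambda>v. h v + h' v) \<in> horner X a"
proof (induction arbitrary: h' rule: horner.induct)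
  case (base f) then show ?case by (simp add: horner_add_poly)
next
  case (step f h)
  from step.prems show ?case
  proof cases
    case base
    have "(\<lambda>v. h' v + (f v + v a * h v)) \<in> horner X a"
      using horner_add_poly[OF horner.step[OF step.hyps] base] .
    then show ?thesis by (simp add: add.commute)
  next
    case (step f' k)
    have "(\<lambda>v. (f v + f' v) + v a * (h v + k v)) \<in> horner X a"
      by (intro horner.step poly_fun.add step.IH \<open>f \<in> poly_fun X\<close> step)
    then show ?thesis unfolding step by (simp add: algebra_simps)
  qed
qed

lemma horner_mult_poly: "h \<in> horner X a \<Longrightarrow> g \<in> poly_fun X \<Longrightarrow> (\<lambda>v. g v * h v) \<in> horner X a"
proof (induction rule: horner.induct)
  case (base f) then show ?case by (intro horner.base poly_fun.mult)
next
  case (step f h)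
  then have "(\<lambda>v. (g v * f v) + v a * (g v * h v)) \<in> horner X a" by (intro horner.step poly_fun.mult)
  then show ?case by (simp add: algebra_simps)
qed

lemma horner_mult: "h \<in> horner X a \<Longrightarrow> h' \<in> horner X a \<Longrightarrow> (\<lambda>v. h v * h' v) \<in> horner X a"
proof (induction rule: horner.induct)
  case (base f) then show ?case by (simp add: horner_mult_poly)
next
  case (step f h)
  have "(\<lambda>v. 0 + v a * (h v * h' v)) \<in> horner X a"
    by (intro horner.step poly_fun.const step)
  from horner_add[OF horner_mult_poly[OF step.prems step.hyps(1)] this]
  show ?case by (simp add: algebra_simps)
qed

lemma poly_fun_insert_horner: "f \<in> poly_fun (insert a X) \<Longrightarrow> f \<in> horner X a"
proof (induction rule: poly_fun.induct)
  case (const c) then show ?case by (intro horner.base poly_fun.const)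
next
  case (coord b)
  have "(\<lambda>v. 0 + v a * (1::'b)) \<in> horner X a" by (intro horner.intros poly_fun.const)
  then show ?case using coord by (cases "b = a") (auto intro: horner.base poly_fun.coord)
qed (simp_all add: horner_add horner_mult)

text \<open>
  If \<open>f\<^sub>i\<close> vanishes on \<open>Z\<^sub>i\<close> but not on \<open>Z\<^sub>i\<^sub>+\<^sub>1\<close>, then the \<open>f\<^sub>i\<close> are algebraically independent:
  in a relation, written as \<open>g + f\<^sub>i h\<close>, the part \<open>g\<close> vanishes on \<open>Z\<^sub>i\<close>, and \<open>f\<^sub>i\<close> can be
  cancelled on the irreducible set \<open>Z\<^sub>i\<^sub>+\<^sub>1\<close>.
\<close>

lemma chain_algebraically_independent:
  fixes f :: "nat \<Rightarrow> ('x \<Rightarrow> 'k::field) \<Rightarrow> 'k"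
  assumes ne: "\<And>i. i \<le> k \<Longrightarrow> Z i \<noteq> {}" and mono: "\<And>i. i < k \<Longrightarrow> Z i \<subseteq> Z (Suc i)"
    and f0: "\<And>i z. i < k \<Longrightarrow> z \<in> Z i \<Longrightarrow> f i z = 0"
    and cancel: "\<And>i h. i < k \<Longrightarrow> h \<in> poly_fun {..<Suc i} \<Longrightarrow>
      \<forall>z\<in>Z (Suc i). f i z * h (\<lambda>j. f j z) = 0 \<Longrightarrow> \<forall>z\<in>Z (Suc i). h (\<lambda>j. f j z) = 0"
    and F: "F \<in> poly_fun {..<k}" "\<forall>z\<in>Z k. F (\<lambda>j. f j z) = 0"
  shows "F v = 0"
proof -
  have "i \<le> k \<Longrightarrow> F \<in> poly_fun {..<i} \<Longrightarrow> \<forall>z\<in>Z i. F (\<lambda>j. f j z) = 0 \<Longrightarrow> F v = 0" for i F v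
  proof (induction i arbitrary: F v)
    case 0
    then obtain z where "z \<in> Z 0" using ne by blast
    then show ?case using 0 poly_fun_cong_on[of F "{}" v "\<lambda>j. f j z"] by simp
  next
    case (Suc i)
    then have "F \<in> horner {..<i} i" using poly_fun_insert_horner[of F i "{..<i}"] by (simp add: lessThan_Suc)
    then show ?case using Suc.prems(3)
    proof (induction arbitrary: v rule: horner.induct)
      case (base g)
      then show ?case using Suc.IH[of g v] Suc.prems(1) mono[of i] by auto
    next
      case (step g h)
      \<comment> \<open>Two nested inductions are at work: the outer one, on the number of
        variables, disposes of g, and the inner one, on the degree in the last variable, of
        h.\<close>
      have "g w = 0" for w
      proof (rule Suc.IH[OF _ step.hyps(1)])
        show "\<forall>z\<in>Z i. g (\<lambda>j. f j z) = 0"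
        proof
          fix z assume z: "z \<in> Z i"
          then have "z \<in> Z (Suc i)" using mono[of i] Suc.prems(1) by auto
          then have "g (\<lambda>j. f j z) + f i z * h (\<lambda>j. f j z) = 0" using step.prems by auto
          then show "g (\<lambda>j. f j z) = 0" using f0[of i z] z Suc.prems(1) by simp
        qed
      qed (use Suc.prems in simp)
      moreover have "h w = 0" for w
      proof (rule step.IH)
        have "\<forall>z\<in>Z (Suc i). f i z * h (\<lambda>j. f j z) = 0"
          using step.prems calculation by simp
        moreover have "h \<in> poly_fun {..<Suc i}" using step.hyps(2)
        proof (induction rule: horner.induct)
          case (base g) then show ?case by (rule poly_fun_mono) auto
        next
          case (step g h)
          then show ?case by (intro poly_fun.intros) (auto elim: poly_fun_mono)
        qed
        ultimately show "\<forall>z\<in>Z (Suc i). h (\<lambda>j. f j z) = 0"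
          using cancel[of i h] Suc.prems(1) by simp
      qed
      ultimately show ?case by simp
    qed
  qed
  then show ?thesis using F by blast
qed

text \<open>A longer chain would produce more than |X| algebraically independent polynomials in the
  variables X, against \<open>algebraic_relation\<close> with denominator 1.\<close>

lemma krull_dim_var_top_le:
  fixes V :: "('x \<Rightarrow> 'k::alg_closed_field) set"
  assumes X: "finite X" and V: "V \<subseteq> affine_space X"
  shows "krull_dim (var_top X V) \<le> enat (card X)"
proof (rule krull_dim_leI)
  fix k Z assume Z: "irred_chain (var_top X V) k Z"
  let ?T = "var_top X V"
  have ZV: "Z i \<subseteq> V" if "i \<le> k" for i
    using Z that unfolding irred_chain_def irred_in_def topspace_var_top[OF V] by blast
  have "\<exists>f. f \<in> poly_fun X \<and> (\<forall>z\<in>Z i. f z = 0) \<and> (\<exists>z\<in>Z (Suc i). f z \<noteq> 0)" if i: "i < k" for i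
  proof -
    have "Z i \<subset> Z (Suc i)" using Z i by (auto simp: irred_chain_def)
    then obtain x where x: "x \<in> Z (Suc i)" "x \<notin> Z i" by blast
    have "closedin ?T (Z i)" using Z i by (auto simp: irred_chain_def)
    moreover have "x \<in> V - Z i" using x ZV[of "Suc i"] i by auto
    ultimately show ?thesis using x(1) unfolding closedin_var_top[OF V] by blast
  qed
  then obtain f where f: "\<And>i. i < k \<Longrightarrow> f i \<in> poly_fun X"
    "\<And>i z. i < k \<Longrightarrow> z \<in> Z i \<Longrightarrow> f i z = 0" "\<And>i. i < k \<Longrightarrow> \<exists>z\<in>Z (Suc i). f i z \<noteq> 0"
    by metis
  have zeros: "closedin ?T {v \<in> V. g v = 0}" if "g \<in> poly_fun X" for g
    using that unfolding closedin_var_top[OF V] by auto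
  show "enat k \<le> enat (card X)"
  proof (rule ccontr)
    assume "\<not> ?thesis"
    then have "card X < card {..<k}" by simp
    then obtain F where F: "F \<in> poly_fun {..<k}" "\<exists>v\<in>affine_space {..<k}. F v \<noteq> 0"
      "\<And>w. F (\<lambda>j. f j w) = 0"
      using algebraic_relation[OF X finite_lessThan, of k f "\<lambda>_. 1"] f(1) poly_fun.const[of 1 X]
      by auto
    have "F v = 0" for v
    proof (rule chain_algebraically_independent[where k=k and Z=Z and f=f and F=F])
      fix i h assume i: "i < k" and h: "h \<in> poly_fun {..<Suc i}"
        and fh: "\<forall>z\<in>Z (Suc i). f i z * h (\<lambda>j. f j z) = 0"
      let ?h = "\<lambda>z. h (\<lambda>j. f j z)"
      have "?h \<in> poly_fun X" using f(1) i by (intro poly_fun_comp[OF h]) auto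
      then have c: "closedin ?T {v \<in> V. f i v = 0}" "closedin ?T {v \<in> V. ?h v = 0}"
        using zeros f(1)[OF i] by auto
      have sub: "Z (Suc i) \<subseteq> {v \<in> V. f i v = 0} \<union> {v \<in> V. ?h v = 0}"
        using fh ZV[of "Suc i"] i by auto
      have irr: "irred_in ?T (Z (Suc i))" using Z i by (auto simp: irred_chain_def)
      have "Z (Suc i) \<subseteq> {v \<in> V. f i v = 0} \<or> Z (Suc i) \<subseteq> {v \<in> V. ?h v = 0}"
        using irr c sub unfolding irred_in_def by blast
      then show "\<forall>z\<in>Z (Suc i). ?h z = 0" using f(3)[OF i] by blast
    next
      show "F \<in> poly_fun {..<k}" by (fact F(1))
      show "\<forall>z\<in>Z k. F (\<lambda>j. f j z) = 0" using F(3) by blast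
      show "Z i \<noteq> {}" if "i \<le> k" for i using Z that by (auto simp: irred_chain_def irred_in_def)
      show "Z i \<subseteq> Z (Suc i)" if "i < k" for i using Z that by (auto simp: irred_chain_def)
      show "f i z = 0" if "i < k" "z \<in> Z i" for i z using f(2) that by blast
    qed
    then show False using F(2) by blast
  qed
qed

lemma krull_dim_open_affine_ge:
  fixes O' :: "('x \<Rightarrow> 'k::alg_closed_field) set"
  assumes X: "finite X" and O: "openin (zariski X) O'" and ne: "O' \<noteq> {}"
  shows "enat (card X) \<le> krull_dim (var_top X O')"
proof -
  have OX: "O' \<subseteq> affine_space X" using O unfolding openin_zariski_iff by blast
  obtain y where y: "y \<in> O'" using ne by blast
  with O obtain p where p: "p \<in> poly_fun X" "p y \<noteq> 0" "{v \<in> affine_space X. p v \<noteq> 0} \<subseteq> O'"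
    unfolding openin_zariski_iff by blast
  define N where "N = card X"
  obtain e where e: "bij_betw e {..<N} X"
    unfolding N_def using ex_bij_betw_nat_finite[OF X] by (auto simp: atLeast0LessThan)
  \<comment> \<open>The affine subspaces through y in which only the first i coordinates may
    vary.\<close>
  define L where "L i = {v \<in> affine_space X. \<forall>a. a \<notin> e ` {..<i} \<longrightarrow> v a = y a}" for i
  define Z where "Z i = L i \<inter> O'" for i
  have yZ: "y \<in> Z i" for i using y OX by (auto simp: Z_def L_def)
  have "irred_chain (var_top X O') N Z"
    unfolding irred_chain_def
  proof (intro conjI allI impI)
    fix i
    show "closedin (var_top X O') (Z i)"
      unfolding closedin_var_top[OF OX]
    proof (intro conjI ballI)
      fix v assume v: "v \<in> O' - Z i"
      then obtain a where a: "a \<notin> e ` {..<i}" "v a \<noteq> y a" using OX by (auto simp: Z_def L_def)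
      have "v \<in> affine_space X" "y \<in> affine_space X" using v y OX by auto
      then have "a \<in> X" using a(2) by (metis (mono_tags, lifting) affine_space_def mem_Collect_eq)
      then have "(\<lambda>v. v a - y a) \<in> poly_fun X" by (intro poly_fun_diff poly_fun.intros)
      then show "\<exists>f\<in>poly_fun X. f v \<noteq> 0 \<and> (\<forall>v\<in>Z i. f v = 0)"
        using a by (intro bexI[of _ "\<lambda>v. v a - y a"]) (auto simp: Z_def L_def)
    qed (auto simp: Z_def)
    have "irreducible_space (var_top X (Z i))"
      unfolding Z_def
    proof (rule irreducible_flat[OF _ _ O])
      show "L i \<inter> O' \<noteq> {}" using yZ[of i] by (auto simp: Z_def)
      fix a b t assume ab: "a \<in> L i" "b \<in> L i"
      then have "line a b t \<in> affine_space X" by (intro line_affine_space) (auto simp: L_def)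
      moreover have "line a b t z = y z" if "z \<notin> e ` {..<i}" for z
        using ab that by (simp add: L_def line_def)
      ultimately show "line a b t \<in> L i" by (simp add: L_def)
    qed (auto simp: L_def)
    moreover have "O' \<inter> Z i = Z i" by (auto simp: Z_def)
    ultimately have "irreducible_space (subtopology (var_top X O') (Z i))"
      by (simp add: subtopology_var_top)
    then show "irred_in (var_top X O') (Z i)"
      by (rule irred_inI) (auto simp: topspace_var_top[OF OX] Z_def)
  next
    fix i assume i: "i < N"
    \<comment> \<open>A nonzero step from y along the coordinate e i that stays inside O' shows that
      the inclusion is strict. It exists because p restricts to a nonzero polynomial in the length
      of the step.\<close>
    define w where "w = (\<lambda>a. if a = e i then 1 else 0 :: 'k)"
    obtain P where P: "\<And>t. poly P t = p (\<lambda>a. y a + t * w a)" using poly_fun_curve[OF p(1)] by metis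
    have "poly P 0 \<noteq> 0" unfolding P using p(2) by simp
    then have "P \<noteq> 0" by auto
    then obtain t where t: "t \<noteq> 0" "poly P t \<noteq> 0" using poly_nonzero_exists by blast
    define v where "v = (\<lambda>a. y a + t * w a)"
    have ei: "e i \<in> X" using e i by (auto simp: bij_betw_def)
    have vX: "v \<in> affine_space X" using y OX ei by (auto simp: v_def w_def affine_space_def)
    have vO: "v \<in> O'" using p(3) vX t(2) by (auto simp: P v_def)
    have "v \<in> L (Suc i)" using vX by (auto simp: L_def v_def w_def lessThan_Suc)
    moreover have "e i \<notin> e ` {..<i}"
      using e i unfolding bij_betw_def inj_on_def by force
    then have "v \<notin> L i" using t(1) by (auto simp: L_def v_def w_def)
    moreover have "L i \<subseteq> L (Suc i)" by (auto simp: L_def lessThan_Suc)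
    ultimately show "Z i \<subset> Z (Suc i)" using vO by (auto simp: Z_def)
  qed
  then show ?thesis unfolding N_def by (rule irred_chain_le_krull_dim)
qed

lemma krull_dim_open_affine:
  fixes O' :: "('x \<Rightarrow> 'k::alg_closed_field) set"
  assumes "finite X" "openin (zariski X) O'" "O' \<noteq> {}"
  shows "krull_dim (var_top X O') = enat (card X)"
proof (rule order_antisym)
  have "O' \<subseteq> affine_space X" using assms(2) unfolding openin_zariski_iff by blast
  then show "krull_dim (var_top X O') \<le> enat (card X)" by (rule krull_dim_var_top_le[OF assms(1)])
qed (rule krull_dim_open_affine_ge[OF assms])

section \<open>Local charts\<close>

definition affine_chart ::
  "'x set \<Rightarrow> ('x \<Rightarrow> 'k::field) set \<Rightarrow> ('x \<Rightarrow> 'k) set \<Rightarrow> 'y set \<Rightarrow> ('y \<Rightarrow> 'k) set \<Rightarrow>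
   (('x \<Rightarrow> 'k) \<Rightarrow> 'y \<Rightarrow> 'k) \<Rightarrow> (('y \<Rightarrow> 'k) \<Rightarrow> 'x \<Rightarrow> 'k) \<Rightarrow> bool" where
  "affine_chart X V V' S W \<phi> \<psi> \<longleftrightarrow> finite S \<and> V \<subseteq> affine_space X \<and>
     openin (var_top X V) V' \<and> openin (zariski S) W \<and> \<phi> \<in> V' \<rightarrow> W \<and> \<psi> \<in> W \<rightarrow> V' \<and>
     (\<forall>v\<in>V'. \<psi> (\<phi> v) = v) \<and> (\<forall>w\<in>W. \<phi> (\<psi> w) = w) \<and>
     (\<forall>b\<in>S. rat_on X V' (\<lambda>v. \<phi> v b)) \<and> (\<forall>a\<in>X. rat_on S W (\<lambda>w. \<psi> w a))"

lemma openin_zariski_subset: "openin (zariski X) W \<Longrightarrow> W \<subseteq> affine_space X"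
  unfolding openin_zariski_iff by blast

lemma affine_chart_homeomorphic_maps:
  assumes "affine_chart X V V' S W \<phi> \<psi>"
  shows "homeomorphic_maps (subtopology (var_top X V) V') (var_top S W) \<phi> \<psi>"
proof -
  have V: "V \<subseteq> affine_space X" and "openin (var_top X V) V'" and W: "W \<subseteq> affine_space S"
    using assms openin_zariski_subset by (auto simp: affine_chart_def)
  then have V': "V' \<subseteq> V" unfolding openin_var_top[OF V] by blast
  then have eq: "subtopology (var_top X V) V' = var_top X V'"
    by (simp add: subtopology_var_top inf.absorb2)
  have V'X: "V' \<subseteq> affine_space X" using V V' by blast
  show ?thesis
    unfolding homeomorphic_maps_def eq topspace_var_top[OF V'X] topspace_var_top[OF W]
  proof (intro conjI)
    show "continuous_map (var_top X V') (var_top S W) \<phi>"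
      by (rule rat_on_continuous_map[OF V'X W]) (use assms in \<open>auto simp: affine_chart_def\<close>)
    show "continuous_map (var_top S W) (var_top X V') \<psi>"
      by (rule rat_on_continuous_map[OF W V'X]) (use assms in \<open>auto simp: affine_chart_def\<close>)
  qed (use assms in \<open>auto simp: affine_chart_def\<close>)
qed

lemma affine_chart_krull_dim:
  fixes V :: "('x \<Rightarrow> 'k::alg_closed_field) set"
  assumes "affine_chart X V V' S W \<phi> \<psi>" "V' \<noteq> {}"
  shows "krull_dim (subtopology (var_top X V) V') = enat (card S)"
proof -
  have "W \<noteq> {}" using assms by (auto simp: affine_chart_def)
  then have "krull_dim (var_top S W) = enat (card S)"
    using assms by (intro krull_dim_open_affine) (auto simp: affine_chart_def)
  with krull_dim_homeomorphic_maps[OF affine_chart_homeomorphic_maps[OF assms(1)]] show ?thesis by simp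
qed

lemma affine_chart_restrict:
  fixes V :: "('x \<Rightarrow> 'k::alg_closed_field) set"
  assumes c: "affine_chart X V V' S W \<phi> \<psi>" and U: "openin (var_top X V) U"
  shows "affine_chart X V (V' \<inter> U) S {w \<in> W. \<psi> w \<in> U} \<phi> \<psi>"
proof -
  have W: "openin (zariski S) W" and V: "V \<subseteq> affine_space X" and V': "openin (var_top X V) V'"
    using c by (auto simp: affine_chart_def)
  have WS: "W \<subseteq> affine_space S" by (rule openin_zariski_subset[OF W])
  have cont: "continuous_map (var_top S W) (var_top X V) \<psi>"
    by (rule rat_on_continuous_map[OF WS V])
      (use c openin_subset[OF V'] topspace_var_top[OF V] in \<open>auto simp: affine_chart_def\<close>)
  have "openin (var_top S W) {w \<in> topspace (var_top S W). \<psi> w \<in> U}"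
    by (rule openin_continuous_map_preimage[OF cont U])
  then have "openin (var_top S W) {w \<in> W. \<psi> w \<in> U}" by (simp add: topspace_var_top[OF WS])
  then have "openin (zariski S) {w \<in> W. \<psi> w \<in> U}"
    unfolding var_top_def by (rule openin_trans_full[OF _ W])
  moreover have "openin (var_top X V) (V' \<inter> U)" using V' U by (rule openin_Int)
  ultimately show ?thesis
    using c unfolding affine_chart_def
    by (auto elim!: rat_on_subset)
qed

text \<open>The dimension is at most m because the charts cover V. It is at least m on every
  nonempty open set, since such a set contains a nonempty open part of a chart and open subsets have
  no larger dimension. As \<open>local_dim\<close> is an infimum over open sets, it needs this
  stronger lower bound.\<close>

lemma
  fixes V :: "('x \<Rightarrow> 'k::alg_closed_field) set" and m :: nat
  assumes V: "V \<subseteq> affine_space X"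
    and atlas: "\<And>x. x \<in> V \<Longrightarrow> \<exists>V' S W \<phi> \<psi>. x \<in> V' \<and>
      affine_chart X V V' (S :: 'y set) W \<phi> \<psi> \<and> card S = m"
  shows affine_atlas_local_dim: "x \<in> V \<Longrightarrow> local_dim (var_top X V) x = enat m"
    and affine_atlas_krull_dim: "V \<noteq> {} \<Longrightarrow> krull_dim (var_top X V) = enat m"
proof -
  let ?T = "var_top X V"
  have top: "topspace ?T = V" by (rule topspace_var_top[OF V])
  have le: "krull_dim ?T \<le> enat m"
  proof (rule krull_dim_cover_le)
    fix x assume "x \<in> topspace ?T"
    then have "x \<in> V" by (simp add: top)
    from atlas[OF this] obtain V' W \<phi> \<psi> and S :: "'y set" where "x \<in> V'"
      and c: "affine_chart X V V' S W \<phi> \<psi>" "card S = m"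
      by (elim exE conjE)
    moreover from this have "krull_dim (subtopology ?T V') = enat m"
      using affine_chart_krull_dim[OF c(1)] by auto
    ultimately show "\<exists>U. openin ?T U \<and> x \<in> U \<and> krull_dim (subtopology ?T U) \<le> enat m"
      by (intro exI[of _ V']) (auto simp: affine_chart_def)
  qed
  have ge: "enat m \<le> krull_dim (subtopology ?T U)" if U: "openin ?T U" "x \<in> U" for U x
  proof -
    have "x \<in> V" using that top openin_subset by blast
    from atlas[OF this] obtain V' W \<phi> \<psi> and S :: "'y set" where x: "x \<in> V'"
      and c: "affine_chart X V V' S W \<phi> \<psi>" "card S = m"
      by (elim exE conjE)
    have "enat m = krull_dim (subtopology ?T (V' \<inter> U))"
    proof -
      have "V' \<inter> U \<noteq> {}" using x U(2) by blast
      from affine_chart_krull_dim[OF affine_chart_restrict[OF c(1) U(1)] this] c(2) show ?thesis by simp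
    qed
    also have "\<dots> = krull_dim (subtopology (subtopology ?T U) (V' \<inter> U))"
      by (simp add: subtopology_subtopology Int_commute)
    also have "\<dots> \<le> krull_dim (subtopology ?T U)"
      by (rule krull_dim_openin_le)
        (use c U in \<open>auto simp: affine_chart_def openin_subtopology_Int\<close>)
    finally show ?thesis .
  qed
  show "krull_dim ?T = enat m" if "V \<noteq> {}"
  proof -
    obtain x where "x \<in> V" using \<open>V \<noteq> {}\<close> by blast
    then have "enat m \<le> krull_dim (subtopology ?T V)" using ge[of V x] top openin_topspace by metis
    moreover have "subtopology ?T V = ?T" using subtopology_topspace[of ?T] unfolding top .
    ultimately show ?thesis using le by simp
  qed
  show "local_dim ?T x = enat m" if x: "x \<in> V"
  proof (rule order_antisym)
    have "local_dim ?T x \<le> krull_dim (subtopology ?T (topspace ?T))"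
      unfolding local_dim_def by (rule Inf_lower) (use x top openin_topspace[of ?T] in blast)
    then show "local_dim ?T x \<le> enat m" using le by simp
    show "enat m \<le> local_dim ?T x"
      unfolding local_dim_def by (rule Inf_greatest) (use ge in auto)
  qed
qed

subsection \<open>Tangent spaces\<close>

text \<open>
  The derivative at \<open>0\<close> of a function that agrees with a rational function \<open>p / q\<close> outside the
  zeros of \<open>q\<close>; the value at \<open>0\<close> is required to be the right one, because \<open>q(0) \<noteq> 0\<close>.
\<close>

definition has_rat_deriv :: "('k::field \<Rightarrow> 'k) \<Rightarrow> 'k \<Rightarrow> bool" where
  "has_rat_deriv F b \<longleftrightarrow> (\<exists>p q. coeff q 0 \<noteq> 0 \<and> (\<forall>t. poly q t * F t = poly p t) \<and>
     coeff q 0 * b + coeff q 1 * F 0 = coeff p 1)"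

lemma coeff_mult_1: "coeff (p * q) 1 = coeff p 0 * coeff q 1 + coeff p 1 * coeff q 0"
  for p q :: "'k::comm_ring_1 poly"
  by (simp add: coeff_mult)

lemma has_rat_derivE:
  assumes "has_rat_deriv F b"
  obtains p q where "coeff q 0 \<noteq> 0" "\<And>t. poly q t * F t = poly p t"
    "coeff p 0 = coeff q 0 * F 0" "coeff p 1 = coeff q 0 * b + coeff q 1 * F 0"
proof -
  from assms obtain p q where *: "coeff q 0 \<noteq> 0" "\<And>t. poly q t * F t = poly p t"
    "coeff q 0 * b + coeff q 1 * F 0 = coeff p 1" unfolding has_rat_deriv_def by blast
  have "coeff p 0 = coeff q 0 * F 0" using *(2)[of 0] by (simp add: poly_0_coeff_0)
  with * that show ?thesis by metis
qed

lemma has_rat_derivI: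
  "coeff q 0 \<noteq> 0 \<Longrightarrow> (\<And>t. poly q t * F t = poly p t) \<Longrightarrow>
    coeff p 1 = coeff q 0 * b + coeff q 1 * F 0 \<Longrightarrow> has_rat_deriv F b"
  unfolding has_rat_deriv_def by metis

text \<open>The numerators multiplied by each other's denominators agree at all points, hence as
  polynomials over the infinite field; then their linear coefficients are compared.\<close>

lemma has_rat_deriv_unique:
  fixes F :: "'k::alg_closed_field \<Rightarrow> 'k"
  assumes "has_rat_deriv F b" "has_rat_deriv F b'"
  shows "b = b'"
proof -
  from assms(1) obtain p q where 1: "coeff q 0 \<noteq> 0" "\<And>t. poly q t * F t = poly p t"
    "coeff p 0 = coeff q 0 * F 0" "coeff p 1 = coeff q 0 * b + coeff q 1 * F 0" by (rule has_rat_derivE) blast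
  from assms(2) obtain p' q' where 2: "coeff q' 0 \<noteq> 0" "\<And>t. poly q' t * F t = poly p' t"
    "coeff p' 0 = coeff q' 0 * F 0" "coeff p' 1 = coeff q' 0 * b' + coeff q' 1 * F 0" by (rule has_rat_derivE) blast
  have "p * q' = p' * q"
    by (rule poly_fun_eqI) (simp add: 1(2)[symmetric] 2(2)[symmetric])
  then have "coeff (p * q') 1 = coeff (p' * q) 1" by simp
  then have "coeff q 0 * coeff q' 0 * b = coeff q 0 * coeff q' 0 * b'"
    unfolding coeff_mult_1 1(3,4) 2(3,4) by (simp add: algebra_simps)
  then show ?thesis using 1(1) 2(1) by simp
qed

lemma has_rat_deriv_const: "has_rat_deriv (\<lambda>t. a) 0"
  by (rule has_rat_derivI[of 1 _ "[:a:]"]) auto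

lemma has_rat_deriv_poly: "has_rat_deriv (poly p) (coeff p 1)"
  by (rule has_rat_derivI[of 1 _ p]) auto

lemma has_rat_deriv_linear: "has_rat_deriv (\<lambda>t. a + t * b) b"
proof -
  have "poly [:a, b:] = (\<lambda>t. a + t * b)" by (simp add: fun_eq_iff)
  with has_rat_deriv_poly[of "[:a, b:]"] show ?thesis by simp
qed

lemma has_rat_deriv_add:
  assumes "has_rat_deriv F b" "has_rat_deriv G b'"
  shows "has_rat_deriv (\<lambda>t. F t + G t) (b + b')"
proof -
  from assms(1) obtain p q where 1: "coeff q 0 \<noteq> 0" "\<And>t. poly q t * F t = poly p t"
    "coeff p 0 = coeff q 0 * F 0" "coeff p 1 = coeff q 0 * b + coeff q 1 * F 0" by (rule has_rat_derivE) blast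
  from assms(2) obtain p' q' where 2: "coeff q' 0 \<noteq> 0" "\<And>t. poly q' t * G t = poly p' t"
    "coeff p' 0 = coeff q' 0 * G 0" "coeff p' 1 = coeff q' 0 * b' + coeff q' 1 * G 0" by (rule has_rat_derivE) blast
  show ?thesis
  proof (rule has_rat_derivI[of "q * q'" _ "p * q' + p' * q"])
    show "coeff (q * q') 0 \<noteq> 0" using 1(1) 2(1) by (simp add: coeff_mult)
    show "coeff (p * q' + p' * q) 1 = coeff (q * q') 0 * (b + b') + coeff (q * q') 1 * (F 0 + G 0)"
      unfolding coeff_add coeff_mult_1 coeff_mult_0 1(3,4) 2(3,4) by (simp add: algebra_simps)
  qed (simp add: 1(2)[symmetric] 2(2)[symmetric] algebra_simps)
qed

lemma has_rat_deriv_mult: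
  assumes "has_rat_deriv F b" "has_rat_deriv G b'"
  shows "has_rat_deriv (\<lambda>t. F t * G t) (F 0 * b' + b * G 0)"
proof -
  from assms(1) obtain p q where 1: "coeff q 0 \<noteq> 0" "\<And>t. poly q t * F t = poly p t"
    "coeff p 0 = coeff q 0 * F 0" "coeff p 1 = coeff q 0 * b + coeff q 1 * F 0" by (rule has_rat_derivE) blast
  from assms(2) obtain p' q' where 2: "coeff q' 0 \<noteq> 0" "\<And>t. poly q' t * G t = poly p' t"
    "coeff p' 0 = coeff q' 0 * G 0" "coeff p' 1 = coeff q' 0 * b' + coeff q' 1 * G 0" by (rule has_rat_derivE) blast
  show ?thesis
  proof (rule has_rat_derivI[of "q * q'" _ "p * p'"])
    show "coeff (q * q') 0 \<noteq> 0" using 1(1) 2(1) by (simp add: coeff_mult)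
    show "coeff (p * p') 1 = coeff (q * q') 0 * (F 0 * b' + b * G 0) + coeff (q * q') 1 * (F 0 * G 0)"
      unfolding coeff_mult_1 coeff_mult_0 1(3,4) 2(3,4) by (simp add: algebra_simps)
  qed (simp add: 1(2)[symmetric] 2(2)[symmetric] algebra_simps)
qed

text \<open>Only the finitely many roots of r are exceptional, and multiplying numerator and
  denominator by r makes the defining equation hold there as well.\<close>

lemma has_rat_deriv_cong_ae:
  assumes F: "has_rat_deriv F b" and r: "poly r 0 \<noteq> 0" "\<And>t. poly r t \<noteq> 0 \<Longrightarrow> F t = G t"
  shows "has_rat_deriv G b"
proof -
  from F obtain p q where 1: "coeff q 0 \<noteq> 0" "\<And>t. poly q t * F t = poly p t"
    "coeff p 0 = coeff q 0 * F 0" "coeff p 1 = coeff q 0 * b + coeff q 1 * F 0" by (rule has_rat_derivE) blast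
  have 0: "G 0 = F 0" using r by simp
  show ?thesis
  proof (rule has_rat_derivI[of "r * q" _ "r * p"])
    show "coeff (r * q) 0 \<noteq> 0" using 1(1) r(1) by (simp add: coeff_mult poly_0_coeff_0)
    show "coeff (r * p) 1 = coeff (r * q) 0 * b + coeff (r * q) 1 * G 0"
      unfolding coeff_mult_1 coeff_mult_0 1(3,4) 0 by (simp add: algebra_simps)
    show "poly (r * q) t * G t = poly (r * p) t" for t
      using r(2)[of t] 1(2)[of t] by (cases "poly r t = 0") auto
  qed
qed

lemma has_rat_deriv_inverse:
  assumes "has_rat_deriv G b" and G0: "G 0 \<noteq> 0"
  shows "has_rat_deriv (\<lambda>t. inverse (G t)) (- b / (G 0)\<^sup>2)"
proof -
  from assms(1) obtain p q where 1: "coeff q 0 \<noteq> 0" "\<And>t. poly q t * G t = poly p t"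
    "coeff p 0 = coeff q 0 * G 0" "coeff p 1 = coeff q 0 * b + coeff q 1 * G 0" by (rule has_rat_derivE) blast
  show ?thesis
  \<comment> \<open>The natural fraction is q / p; the extra factor p q makes the equation true also
    where q or G vanishes.\<close>
  proof (rule has_rat_derivI[of "p * (p * q)" _ "q * (p * q)"])
    show "coeff (p * (p * q)) 0 \<noteq> 0" using 1(1,3) G0 by (simp add: coeff_mult)
    show "poly (p * (p * q)) t * inverse (G t) = poly (q * (p * q)) t" for t
      using 1(2)[of t] by (cases "poly q t = 0"; cases "G t = 0") (auto simp: field_simps)
    show "coeff (q * (p * q)) 1 =
        coeff (p * (p * q)) 0 * (- b / (G 0)\<^sup>2) + coeff (p * (p * q)) 1 * inverse (G 0)"
      unfolding coeff_mult_1 coeff_mult_0 1(3,4) using G0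
      by (simp add: field_simps power2_eq_square)
  qed
qed

text \<open>The chain rule along arbitrary curves is part of the definition. Lines alone would not
  do, because the image of a line under a chart is curved.\<close>

definition has_differential ::
  "'x set \<Rightarrow> (('x \<Rightarrow> 'k::field) \<Rightarrow> 'k) \<Rightarrow> ('x \<Rightarrow> 'k) \<Rightarrow> (('x \<Rightarrow> 'k) \<Rightarrow> 'k) \<Rightarrow> bool" where
  "has_differential X f x L \<longleftrightarrow> (\<forall>u v. L (\<lambda>a. u a + v a) = L u + L v) \<and>
     (\<forall>s u. L (\<lambda>a. s * u a) = s * L u) \<and>
     (\<forall>\<gamma> u. \<gamma> 0 = x \<longrightarrow> (\<forall>a\<in>X. has_rat_deriv (\<lambda>t. \<gamma> t a) (u a)) \<longrightarrow>
        has_rat_deriv (\<lambda>t. f (\<gamma> t)) (L u))"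

lemma has_differential_curve:
  "has_differential X f x L \<Longrightarrow> \<gamma> 0 = x \<Longrightarrow> (\<And>a. a \<in> X \<Longrightarrow> has_rat_deriv (\<lambda>t. \<gamma> t a) (u a)) \<Longrightarrow>
    has_rat_deriv (\<lambda>t. f (\<gamma> t)) (L u)"
  unfolding has_differential_def by blast

lemma has_differential_line:
  "has_differential X f x L \<Longrightarrow> has_rat_deriv (\<lambda>t. f (\<lambda>a. x a + t * u a)) (L u)"
  by (rule has_differential_curve[where \<gamma> = "\<lambda>t a. x a + t * u a"]) (auto simp: has_rat_deriv_linear)

lemma has_differential_add_mult:
  assumes "has_differential X f x L" "has_differential X g x L'"
  shows "has_differential X (\<lambda>v. f v + g v) x (\<lambda>u. L u + L' u)"
    and "has_differential X (\<lambda>v. f v * g v) x (\<lambda>u. f x * L' u + L u * g x)"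
proof -
  have lin: "L (\<lambda>a. u a + v a) = L u + L v" "L (\<lambda>a. s * u a) = s * L u"
    "L' (\<lambda>a. u a + v a) = L' u + L' v" "L' (\<lambda>a. s * u a) = s * L' u" for u v s
    using assms unfolding has_differential_def by blast+
  note c = has_differential_curve[OF assms(1)] has_differential_curve[OF assms(2)]
  show "has_differential X (\<lambda>v. f v + g v) x (\<lambda>u. L u + L' u)"
    unfolding has_differential_def
    by (intro conjI allI impI has_rat_deriv_add c) (auto simp: lin algebra_simps)
  show "has_differential X (\<lambda>v. f v * g v) x (\<lambda>u. f x * L' u + L u * g x)"
    unfolding has_differential_def
  proof (intro conjI allI impI)
    fix \<gamma> :: "'b \<Rightarrow> 'a \<Rightarrow> 'b" and u
    assume g0: "\<gamma> 0 = x" and d: "\<forall>a\<in>X. has_rat_deriv (\<lambda>t. \<gamma> t a) (u a)"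
    have "has_rat_deriv (\<lambda>t. f (\<gamma> t) * g (\<gamma> t)) (f (\<gamma> 0) * L' u + L u * g (\<gamma> 0))"
      by (intro has_rat_deriv_mult c g0) (use d in auto)
    then show "has_rat_deriv (\<lambda>t. f (\<gamma> t) * g (\<gamma> t)) (f x * L' u + L u * g x)" by (simp add: g0)
  qed (auto simp: lin algebra_simps)
qed

lemma has_differential_inverse:
  assumes "has_differential X f x L" "f x \<noteq> 0"
  shows "has_differential X (\<lambda>v. inverse (f v)) x (\<lambda>u. - L u / (f x)\<^sup>2)"
  unfolding has_differential_def
proof (intro conjI allI impI)
  have lin: "L (\<lambda>a. u a + v a) = L u + L v" "L (\<lambda>a. s * u a) = s * L u" for u v s
    using assms unfolding has_differential_def by blast+
  show "- L (\<lambda>a. u a + v a) / (f x)\<^sup>2 = - L u / (f x)\<^sup>2 + - L v / (f x)\<^sup>2" for u v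
    by (simp add: lin diff_divide_distrib add_divide_distrib)
  show "- L (\<lambda>a. s * u a) / (f x)\<^sup>2 = s * (- L u / (f x)\<^sup>2)" for s u
    by (simp add: lin)
  fix \<gamma> :: "'b \<Rightarrow> 'a \<Rightarrow> 'b" and u
  assume g0: "\<gamma> 0 = x" and d: "\<forall>a\<in>X. has_rat_deriv (\<lambda>t. \<gamma> t a) (u a)"
  have "has_rat_deriv (\<lambda>t. inverse (f (\<gamma> t))) (- L u / (f (\<gamma> 0))\<^sup>2)"
    by (intro has_rat_deriv_inverse has_differential_curve[where \<gamma> = \<gamma>, OF assms(1) g0])
      (use d assms g0 in auto)
  then show "has_rat_deriv (\<lambda>t. inverse (f (\<gamma> t))) (- L u / (f x)\<^sup>2)" by (simp add: g0)
qed

lemma has_differential_const: "has_differential X (\<lambda>v. a) x (\<lambda>u. 0)"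
  unfolding has_differential_def by (auto simp: has_rat_deriv_const)

lemma has_differential_coord: "a \<in> X \<Longrightarrow> has_differential X (\<lambda>v. v a) x (\<lambda>u. u a)"
  unfolding has_differential_def by auto

lemma poly_fun_has_differential: "f \<in> poly_fun X \<Longrightarrow> \<exists>L. has_differential X f x L"
proof (induction rule: poly_fun.induct)
  case (const a) show ?case by (rule exI) (rule has_differential_const)
next
  case (coord a) then show ?case by (intro exI) (rule has_differential_coord)
next
  case (add f g)
  then obtain L L' where "has_differential X f x L" "has_differential X g x L'" by blast
  then show ?case by (intro exI) (rule has_differential_add_mult(1))
next
  case (mult f g)
  then obtain L L' where "has_differential X f x L" "has_differential X g x L'" by blast
  then show ?case by (intro exI) (rule has_differential_add_mult(2))
qed

lemma quotient_has_differential: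
  assumes "p \<in> poly_fun X" "q \<in> poly_fun X" "q x \<noteq> 0"
  shows "\<exists>L. has_differential X (\<lambda>v. p v / q v) x L"
proof -
  obtain L where "has_differential X p x L" using poly_fun_has_differential[OF assms(1)] by blast
  moreover obtain L' where "has_differential X (\<lambda>v. inverse (q v)) x L'"
    using poly_fun_has_differential[OF assms(2), of x] has_differential_inverse[of X q x, OF _ assms(3)] by metis
  ultimately show ?thesis unfolding divide_inverse by (intro exI) (rule has_differential_add_mult(2))
qed

lemma has_differential_sum:
  assumes "has_differential X f x L" "finite I"
  shows "L (\<lambda>a. \<Sum>b\<in>I. s b * e b a) = (\<Sum>b\<in>I. s b * L (e b))"
proof -
  have lin: "L (\<lambda>a. u a + v a) = L u + L v" "L (\<lambda>a. s * u a) = s * L u" for u v s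
    using assms unfolding has_differential_def by blast+
  have "L (\<lambda>a. 0) = 0" using lin(2)[of 0] by simp
  with assms(2) show ?thesis by (induction I) (simp_all add: lin)
qed

text \<open>Over an infinite field the polynomial in the definition of
  \<open>differential_zero\<close> is unique, and its linear coefficient is L w.\<close>

lemma differential_zero_iff:
  fixes f :: "('x \<Rightarrow> 'k::alg_closed_field) \<Rightarrow> 'k"
  assumes "f \<in> poly_fun X" "has_differential X f x L"
  shows "differential_zero f x w \<longleftrightarrow> L w = 0"
proof -
  obtain p where p: "\<And>t. poly p t = f (\<lambda>a. x a + t * w a)" using poly_fun_curve[OF assms(1)] by metis
  have L: "has_rat_deriv (\<lambda>t. f (\<lambda>a. x a + t * w a)) (L w)"
    by (rule has_differential_line[OF assms(2)])
  have eq: "coeff p' 1 = L w" if "\<And>t. poly p' t = f (\<lambda>a. x a + t * w a)" for p'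
  proof (rule has_rat_deriv_unique[OF has_rat_deriv_poly])
    show "has_rat_deriv (poly p') (L w)" using L by (simp flip: that)
  qed
  show ?thesis unfolding differential_zero_def using eq p by metis
qed

text \<open>
  A chart \<open>\<phi>\<close> with inverse \<open>\<psi>\<close> is extended by quotients of polynomials to a neighbourhood in the
  ambient space.  The differential of \<open>\<psi>\<close> is then an isomorphism onto the tangent space:
  the equations \<open>\<psi> (\<phi> v) = v\<close>, with denominators cleared, vanish on \<open>V\<close>.
\<close>

lemma affine_chart_tangent_dim:
  fixes V :: "('x \<Rightarrow> 'k::alg_closed_field) set" and S :: "'y set"
  assumes c: "affine_chart X V V' S W \<phi> \<psi>" and x: "x \<in> V'"
  shows "fs.dim (tangent_space X V x) = card S"
proof -
  have S: "finite S" and V: "V \<subseteq> affine_space X" and V': "openin (var_top X V) V'"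
    and W: "openin (zariski S) W"
    and \<phi>: "\<And>v. v \<in> V' \<Longrightarrow> \<phi> v \<in> W" and \<psi>: "\<And>w. w \<in> W \<Longrightarrow> \<psi> w \<in> V'"
    and \<psi>\<phi>: "\<And>v. v \<in> V' \<Longrightarrow> \<psi> (\<phi> v) = v" and \<phi>\<psi>: "\<And>w. w \<in> W \<Longrightarrow> \<phi> (\<psi> w) = w"
    and r\<phi>: "\<And>b. b \<in> S \<Longrightarrow> rat_on X V' (\<lambda>v. \<phi> v b)"
    and r\<psi>: "\<And>a. a \<in> X \<Longrightarrow> rat_on S W (\<lambda>w. \<psi> w a)"
    using c by (auto simp: affine_chart_def)
  have V'V: "V' \<subseteq> V" using V' unfolding openin_var_top[OF V] by blast
  have WS: "W \<subseteq> affine_space S" by (rule openin_zariski_subset[OF W])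
  define y where "y = \<phi> x"
  have y: "y \<in> W" using \<phi> x by (simp add: y_def)
  obtain \<delta> where \<delta>: "\<delta> \<in> poly_fun S" "\<delta> y \<noteq> 0" "{v \<in> affine_space S. \<delta> v \<noteq> 0} \<subseteq> W"
    using W y unfolding openin_zariski_iff by blast
  obtain \<Delta> where \<Delta>: "\<Delta> \<in> poly_fun X" "\<Delta> x \<noteq> 0" "{v \<in> V. \<Delta> v \<noteq> 0} \<subseteq> V'"
    using V' x unfolding openin_var_top[OF V] by blast
  have "\<forall>b\<in>S. \<exists>pq. fst pq \<in> poly_fun X \<and> snd pq \<in> poly_fun X \<and>
      (\<forall>v\<in>V'. snd pq v \<noteq> 0 \<and> \<phi> v b = fst pq v / snd pq v)"
    using r\<phi> unfolding rat_on_def by (metis fst_conv snd_conv)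
  then obtain PQ where PQ: "\<forall>b\<in>S. fst (PQ b) \<in> poly_fun X \<and> snd (PQ b) \<in> poly_fun X \<and>
      (\<forall>v\<in>V'. snd (PQ b) v \<noteq> 0 \<and> \<phi> v b = fst (PQ b) v / snd (PQ b) v)"
    by (rule bchoice[THEN exE])
  define P Q where "P b = fst (PQ b)" and "Q b = snd (PQ b)" for b
  have P: "P b \<in> poly_fun X" and Q: "Q b \<in> poly_fun X" and Q0: "v \<in> V' \<Longrightarrow> Q b v \<noteq> 0"
    and PQ: "v \<in> V' \<Longrightarrow> \<phi> v b = P b v / Q b v" if "b \<in> S" for b v
    using PQ that unfolding P_def Q_def by blast+
  have "\<forall>a\<in>X. \<exists>pq. fst pq \<in> poly_fun S \<and> snd pq \<in> poly_fun S \<and>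
      (\<forall>v\<in>W. snd pq v \<noteq> 0 \<and> \<psi> v a = fst pq v / snd pq v)"
    using r\<psi> unfolding rat_on_def by (metis fst_conv snd_conv)
  then obtain NT where NT: "\<forall>a\<in>X. fst (NT a) \<in> poly_fun S \<and> snd (NT a) \<in> poly_fun S \<and>
      (\<forall>v\<in>W. snd (NT a) v \<noteq> 0 \<and> \<psi> v a = fst (NT a) v / snd (NT a) v)"
    by (rule bchoice[THEN exE])
  define N T where "N a = fst (NT a)" and "T a = snd (NT a)" for a
  have N: "N a \<in> poly_fun S" and T: "T a \<in> poly_fun S" and T0: "v \<in> W \<Longrightarrow> T a v \<noteq> 0"
    and NT: "v \<in> W \<Longrightarrow> \<psi> v a = N a v / T a v" if "a \<in> X" for a v
    using NT that unfolding N_def T_def by blast+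
  \<comment> \<open>The quotients make sense on all functions, with value 0 at indices outside S and
    X; on V' and W they agree with the maps of the chart.\<close>
  define \<phi>' where "\<phi>' v = (\<lambda>b. if b \<in> S then P b v / Q b v else 0)" for v
  define \<psi>' where "\<psi>' w = (\<lambda>a. if a \<in> X then N a w / T a w else 0)" for w
  have \<phi>': "\<phi>' v = \<phi> v" if "v \<in> V'" for v
    using PQ[OF _ that] \<phi>[OF that] WS by (auto simp: \<phi>'_def fun_eq_iff affine_space_def)
  have \<psi>': "\<psi>' w = \<psi> w" if "w \<in> W" for w
    using NT[OF _ that] \<psi>[OF that] V'V V by (auto simp: \<psi>'_def fun_eq_iff affine_space_def)
  have "\<forall>b\<in>S. \<exists>L. has_differential X (\<lambda>v. \<phi>' v b) x L"
    using quotient_has_differential[OF P Q Q0] x by (simp add: \<phi>'_def)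
  then obtain Lp where "\<forall>b\<in>S. has_differential X (\<lambda>v. \<phi>' v b) x (Lp b)" by (rule bchoice[THEN exE])
  then have Lp: "\<And>b. b \<in> S \<Longrightarrow> has_differential X (\<lambda>v. \<phi>' v b) x (Lp b)" by blast
  have "\<forall>a\<in>X. \<exists>L. has_differential S (\<lambda>w. \<psi>' w a) y L"
    using quotient_has_differential[OF N T T0] y by (simp add: \<psi>'_def)
  then obtain Lq where "\<forall>a\<in>X. has_differential S (\<lambda>w. \<psi>' w a) y (Lq a)" by (rule bchoice[THEN exE])
  then have Lq: "\<And>a. a \<in> X \<Longrightarrow> has_differential S (\<lambda>w. \<psi>' w a) y (Lq a)" by blast
  define d\<phi> where "d\<phi> w = (\<lambda>b. if b \<in> S then Lp b w else 0)" for w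
  define d\<psi> where "d\<psi> u = (\<lambda>a. if a \<in> X then Lq a u else 0)" for u
  have d\<psi>_sum: "d\<psi> (\<lambda>a. \<Sum>b\<in>I. s b * e b a) = (\<Sum>b\<in>I. fun_scale (s b) (d\<psi> (e b)))"
    if "finite I" for I :: "'y set" and s e
    using that has_differential_sum[OF Lq that]
    by (auto simp: d\<psi>_def fun_eq_iff sum_fun_apply fun_scale_def)
  have curve: "has_rat_deriv (\<lambda>t. \<psi>' (\<lambda>b. y b + t * u b) a) (d\<psi> u a)" if "a \<in> X" for u a
    using has_differential_line[OF Lq[OF that]] that by (simp add: d\<psi>_def)
  have curve0: "\<psi>' (\<lambda>b. y b + 0 * u b) = x" for u using \<psi>'[OF y] \<psi>\<phi>[OF x] by (simp add: y_def)
  \<comment> \<open>A line through y leaves the open set W at most at the roots of a polynomial r,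
    and 0 is not a root.\<close>
  have nz: "\<exists>r. poly r 0 \<noteq> 0 \<and> (\<forall>t. poly r t \<noteq> 0 \<longrightarrow> (\<lambda>b. y b + t * u b) \<in> W)"
    if u: "u \<in> affine_space S" for u
  proof -
    obtain r where r: "\<And>t. poly r t = \<delta> (\<lambda>b. y b + t * u b)" using poly_fun_curve[OF \<delta>(1)] by metis
    have "(\<lambda>b. y b + t * u b) \<in> affine_space S" for t
      using u y WS by (auto simp: affine_space_def)
    then show ?thesis using \<delta>(2,3) by (intro exI[of _ r]) (auto simp: r)
  qed
  \<comment> \<open>A function vanishing on V is zero along the image of a line through y, so its
    differential kills the velocity of that image.\<close>
  have in_tangent: "d\<psi> u \<in> tangent_space X V x" if u: "u \<in> affine_space S" for u
    unfolding tangent_space_def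
  proof (intro CollectI conjI ballI impI)
    show "d\<psi> u \<in> affine_space X" by (auto simp: d\<psi>_def affine_space_def)
    fix f :: "('x \<Rightarrow> 'k) \<Rightarrow> 'k" assume f: "f \<in> poly_fun X" "\<forall>v\<in>V. f v = 0"
    obtain L where L: "has_differential X f x L" using poly_fun_has_differential[OF f(1)] by blast
    obtain r where r: "poly r 0 \<noteq> 0" "\<And>t. poly r t \<noteq> 0 \<Longrightarrow> (\<lambda>b. y b + t * u b) \<in> W"
      using nz[OF u] by blast
    have "has_rat_deriv (\<lambda>t. f (\<psi>' (\<lambda>b. y b + t * u b))) (L (d\<psi> u))"
      by (rule has_differential_curve[OF L curve0 curve])
    then have "has_rat_deriv (\<lambda>t. 0) (L (d\<psi> u))"
      by (rule has_rat_deriv_cong_ae[OF _ r(1)]) (use r(2) f(2) \<psi>' \<psi> V'V in force)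
    then have "L (d\<psi> u) = 0" using has_rat_deriv_const has_rat_deriv_unique by blast
    then show "differential_zero f x (d\<psi> u)" using differential_zero_iff[OF f(1) L] by simp
  qed
  \<comment> \<open>The identity \<phi> (\<psi> (y + t u)) = y + t u, valid near t = 0, is
    differentiated.\<close>
  have left_inv: "d\<phi> (d\<psi> u) = u" if u: "u \<in> affine_space S" for u
  proof
    fix b
    show "d\<phi> (d\<psi> u) b = u b"
    proof (cases "b \<in> S")
      case True
      obtain r where r: "poly r 0 \<noteq> 0" "\<And>t. poly r t \<noteq> 0 \<Longrightarrow> (\<lambda>b. y b + t * u b) \<in> W"
        using nz[OF u] by blast
      have "has_rat_deriv (\<lambda>t. \<phi>' (\<psi>' (\<lambda>b. y b + t * u b)) b) (Lp b (d\<psi> u))"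
        by (rule has_differential_curve[OF Lp[OF True] curve0 curve])
      then have "has_rat_deriv (\<lambda>t. y b + t * u b) (Lp b (d\<psi> u))"
        by (rule has_rat_deriv_cong_ae[OF _ r(1)]) (use r(2) \<phi>' \<psi>' \<psi> \<phi>\<psi> in auto)
      from has_rat_deriv_unique[OF this has_rat_deriv_linear] show ?thesis using True by (simp add: d\<phi>_def)
    next
      case False
      then show ?thesis using u by (auto simp: d\<phi>_def affine_space_def)
    qed
  qed
  have right_inv: "d\<psi> (d\<phi> w) = w" if w: "w \<in> tangent_space X V x" for w
  proof
    fix a
    show "d\<psi> (d\<phi> w) a = w a"
    proof (cases "a \<in> X")
      case a: True
      \<comment> \<open>The other composition is the identity on V' only. Its defect E is rational
        on the ambient space and is turned into a polynomial that vanishes on V.\<close>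
      define E where "E v = \<psi>' (\<phi>' v) a - v a" for v
      define Q' where "Q' v = (\<Prod>b\<in>S. Q b v)" for v
      have Q': "Q' \<in> poly_fun X" unfolding Q'_def using Q by (intro poly_fun_prod)
      have Q'0: "Q' v \<noteq> 0 \<Longrightarrow> b \<in> S \<Longrightarrow> Q b v \<noteq> 0" for v b using S by (auto simp: Q'_def)
      have Q'x: "Q' x \<noteq> 0" using S Q0 x by (auto simp: Q'_def)
      have r: "rat_on X {v. Q' v \<noteq> 0} (\<lambda>v. \<phi>' v b)" if "b \<in> S" for b
        unfolding \<phi>'_def using that P Q Q'0 by (auto intro!: rat_on_divide intro: rat_on_poly)
      have "rat_on X {v. Q' v \<noteq> 0} (\<lambda>v. T a (\<phi>' v))"
        by (rule rat_on_comp[OF rat_on_poly[OF T[OF a], of UNIV] r]) auto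
      then obtain p1 q1 where p1: "p1 \<in> poly_fun X" "q1 \<in> poly_fun X"
        "\<And>v. Q' v \<noteq> 0 \<Longrightarrow> q1 v \<noteq> 0" "\<And>v. Q' v \<noteq> 0 \<Longrightarrow> T a (\<phi>' v) = p1 v / q1 v"
        by (rule rat_onE) blast
      \<comment> \<open>On D the denominators of \<phi>' and of the coordinate a of \<psi>' after
        \<phi>' are nonzero.\<close>
      define D where "D = {v. Q' v \<noteq> 0 \<and> p1 v \<noteq> 0}"
      have TD: "T a (\<phi>' v) \<noteq> 0" if "v \<in> D" for v using p1 that by (auto simp: D_def)
      have "T a (\<phi>' x) \<noteq> 0" using T0[OF a y] \<phi>'[OF x] by (simp add: y_def)
      then have p1x: "p1 x \<noteq> 0" using p1 Q'x by auto
      have "rat_on S {w. T a w \<noteq> 0} (\<lambda>w. \<psi>' w a)"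
        unfolding \<psi>'_def using a N T by (auto intro!: rat_on_divide intro: rat_on_poly)
      then have "rat_on X D (\<lambda>v. \<psi>' (\<phi>' v) a)"
        by (rule rat_on_comp) (use r TD in \<open>auto simp: D_def intro: rat_on_subset\<close>)
      then have "rat_on X D E"
        unfolding E_def using a by (intro rat_on_diff rat_on_coord)
      then obtain p q where pq: "p \<in> poly_fun X" "q \<in> poly_fun X"
        "\<And>v. v \<in> D \<Longrightarrow> q v \<noteq> 0" "\<And>v. v \<in> D \<Longrightarrow> E v = p v / q v"
        by (rule rat_onE) blast
      \<comment> \<open>The last three factors kill f outside D and where \<Delta> vanishes; on the
        rest of V the defect E is 0, and so is its numerator p. Hence f vanishes on V and its
        differential kills w.\<close>
      define f where "f v = p v * (Q' v * p1 v * \<Delta> v)" for v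
      have f: "f \<in> poly_fun X" unfolding f_def using pq p1 Q' \<Delta> by (intro poly_fun.mult)
      have E0: "E v = 0" if "v \<in> V'" for v using \<phi>'[OF that] \<psi>' \<phi>[OF that] \<psi>\<phi>[OF that] by (simp add: E_def)
      have "f v = 0" if v: "v \<in> V" for v
      proof (cases "v \<in> D \<and> \<Delta> v \<noteq> 0")
        case True
        then have "E v = 0" using E0 \<Delta>(3) v by blast
        then show ?thesis using pq(3,4)[of v] True by (simp add: f_def)
      next
        case False then show ?thesis by (auto simp: f_def D_def)
      qed
      then have "differential_zero f x w" using w f unfolding tangent_space_def by blast
      moreover obtain L where L: "has_differential X f x L" using poly_fun_has_differential[OF f] by blast
      ultimately have "L w = 0" using differential_zero_iff[OF f] by blast
      then have f0: "has_rat_deriv (\<lambda>t. f (\<lambda>a. x a + t * w a)) 0"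
        using has_differential_line[OF L, of w] by simp
      \<comment> \<open>Since f = E g, where E x = 0 and g x is nonzero, the product rule carries
        the vanishing of the differential over from f to E. For E this is the claim at the
        coordinate a.\<close>
      define g where "g v = q v * (Q' v * p1 v * \<Delta> v)" for v
      have "g \<in> poly_fun X" unfolding g_def using pq p1 Q' \<Delta> by (intro poly_fun.mult)
      then obtain L' where L': "has_differential X g x L'" using poly_fun_has_differential by blast
      have fE: "f v = E v * g v" for v
        using pq(3,4)[of v] by (cases "v \<in> D") (auto simp: f_def g_def D_def)
      have gx: "g x \<noteq> 0" using pq(3)[of x] Q'x p1x \<Delta>(2) by (auto simp: g_def D_def)
      have "has_rat_deriv (\<lambda>t. \<psi>' (\<phi>' (\<lambda>a. x a + t * w a)) a) (Lq a (d\<phi> w))"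
      proof (rule has_differential_curve[OF Lq[OF a]])
        show "\<phi>' (\<lambda>a. x a + 0 * w a) = y" using \<phi>'[OF x] by (simp add: y_def)
        show "has_rat_deriv (\<lambda>t. \<phi>' (\<lambda>a. x a + t * w a) b) (d\<phi> w b)" if "b \<in> S" for b
          using has_differential_line[OF Lp[OF that]] that by (simp add: d\<phi>_def)
      qed
      from has_rat_deriv_add[OF this has_rat_deriv_linear[of "- x a" "- w a"]]
      have "has_rat_deriv (\<lambda>t. E (\<lambda>a. x a + t * w a)) (Lq a (d\<phi> w) - w a)"
        by (simp add: E_def algebra_simps)
      from has_rat_deriv_mult[OF this has_differential_line[OF L', of w]]
      have "has_rat_deriv (\<lambda>t. f (\<lambda>a. x a + t * w a)) ((Lq a (d\<phi> w) - w a) * g x)"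
        using E0[OF x] by (simp add: fE)
      from has_rat_deriv_unique[OF this f0] gx show ?thesis using a by (simp add: d\<psi>_def)
    next
      case False
      then show ?thesis using w by (auto simp: d\<psi>_def tangent_space_def affine_space_def)
    qed
  qed
  \<comment> \<open>The images of the unit vectors under d\<psi> form a basis of the tangent
    space.\<close>
  define e :: "'y \<Rightarrow> 'y \<Rightarrow> 'k" where "e b = (\<lambda>a. if a = b then 1 else 0)" for b
  have eS: "e b \<in> affine_space S" if "b \<in> S" for b using that by (auto simp: e_def affine_space_def)
  have exp: "(\<lambda>a. \<Sum>b\<in>S. u b * e b a) = u" if "u \<in> affine_space S" for u
    using that S by (auto simp: fun_eq_iff e_def affine_space_def if_distrib cong: if_cong)
  have inj: "inj_on (\<lambda>b. d\<psi> (e b)) S"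
  proof (rule inj_onI)
    fix b b' assume "b \<in> S" "b' \<in> S" "d\<psi> (e b) = d\<psi> (e b')"
    then have "e b = e b'" using left_inv eS by metis
    then have "e b b = e b' b" by simp
    then show "b = b'" by (simp add: e_def split: if_splits)
  qed
  let ?B = "(\<lambda>b. d\<psi> (e b)) ` S"
  show ?thesis
  proof (rule fs.dim_unique)
    show "?B \<subseteq> tangent_space X V x" using in_tangent eS by auto
    show "card ?B = card S" by (rule card_image[OF inj])
    show "tangent_space X V x \<subseteq> fs.span ?B"
    proof
      fix w assume w: "w \<in> tangent_space X V x"
      have dS: "d\<phi> w \<in> affine_space S" by (auto simp: d\<phi>_def affine_space_def)
      have "w = d\<psi> (\<lambda>a. \<Sum>b\<in>S. d\<phi> w b * e b a)" using right_inv[OF w] exp[OF dS] by simp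
      also have "\<dots> \<in> fs.span ?B"
        unfolding d\<psi>_sum[OF S] by (intro fs.span_sum fs.span_scale fs.span_base imageI)
      finally show "w \<in> fs.span ?B" .
    qed
    show "fs.independent ?B"
    proof
      assume "fs.dependent ?B"
      then obtain s where s: "\<exists>v\<in>?B. s v \<noteq> 0" "(\<Sum>v\<in>?B. fun_scale (s v) v) = 0"
        using S by (subst (asm) fs.dependent_finite) auto
      define u where "u = (\<lambda>b. if b \<in> S then s (d\<psi> (e b)) else 0)"
      have u: "u \<in> affine_space S" by (auto simp: u_def affine_space_def)
      have "d\<psi> u = (\<Sum>b\<in>S. fun_scale (u b) (d\<psi> (e b)))"
        using d\<psi>_sum[OF S, of u e] exp[OF u] by simp
      also have "\<dots> = (\<Sum>v\<in>?B. fun_scale (s v) v)"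
        unfolding sum.reindex[OF inj] by (intro sum.cong) (auto simp: u_def)
      finally have "d\<psi> u = 0" using s(2) by simp
      moreover have "d\<psi> (\<lambda>a. 0) = 0"
        using d\<psi>_sum[of "{}"] by simp
      ultimately have "u = (\<lambda>a. 0)" using left_inv[OF u] left_inv[of "\<lambda>a. 0"] by simp
      then show False using s(1) by (auto simp: u_def fun_eq_iff split: if_splits)
    qed
  qed
qed

lemma affine_atlas_smooth:
  fixes V :: "('x \<Rightarrow> 'k::alg_closed_field) set" and m :: nat
  assumes V: "quasi_affine X V" "V \<subseteq> affine_space X"
    and atlas: "\<And>x. x \<in> V \<Longrightarrow> \<exists>V' S W \<phi> \<psi>. x \<in> V' \<and>
      affine_chart X V V' (S :: 'y set) W \<phi> \<psi> \<and> card S = m"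
  shows "smooth_variety X V"
  unfolding smooth_variety_def
proof (intro conjI ballI)
  fix x assume x: "x \<in> V"
  from atlas[OF this] obtain V' W \<phi> \<psi> and S :: "'y set" where "x \<in> V'"
    "affine_chart X V V' S W \<phi> \<psi>" "card S = m"
    by (elim exE conjE)
  then have "fs.dim (tangent_space X V x) = m" using affine_chart_tangent_dim by blast
  then show "enat (fs.dim (tangent_space X V x)) = local_dim (var_top X V) x"
    using affine_atlas_local_dim[OF V(2) atlas x] by simp
qed (fact V(1))

section \<open>Matrices of rational functions\<close>

lemma mat_mult_entry:
  "A \<in> carrier_mat n k \<Longrightarrow> B \<in> carrier_mat k m \<Longrightarrow> i < n \<Longrightarrow> j < m \<Longrightarrow>
    (A * B) $$ (i, j) = (\<Sum>l<k. A $$ (i, l) * B $$ (l, j))"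
  by (auto simp: scalar_prod_def atLeast0LessThan intro!: sum.cong)

lemma pow_mat_add:
  assumes A: "A \<in> carrier_mat n n"
  shows "A ^\<^sub>m (a + b) = A ^\<^sub>m a * A ^\<^sub>m b"
proof (induction b)
  case 0
  show ?case using right_mult_one_mat[OF pow_carrier_mat[OF A]] A by simp
next
  case (Suc b)
  then show ?case using assoc_mult_mat[OF pow_carrier_mat[OF A, of a] pow_carrier_mat[OF A, of b] A] by simp
qed

lemma pow_mat_mult: "A \<in> carrier_mat n n \<Longrightarrow> (A ^\<^sub>m a) ^\<^sub>m k = A ^\<^sub>m (a * k)"
  by (induction k) (simp_all add: pow_mat_add add.commute[of a])

lemma eq_mat_carrierI:
  "A \<in> carrier_mat n m \<Longrightarrow> B \<in> carrier_mat n m \<Longrightarrow>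
    (\<And>i j. i < n \<Longrightarrow> j < m \<Longrightarrow> A $$ (i, j) = B $$ (i, j)) \<Longrightarrow> A = B"
  by (rule eq_matI) auto

definition rat_mat ::
  "'x set \<Rightarrow> ('x \<Rightarrow> 'k::field) set \<Rightarrow> nat \<Rightarrow> nat \<Rightarrow> (('x \<Rightarrow> 'k) \<Rightarrow> 'k mat) \<Rightarrow> bool" where
  "rat_mat X W n m A \<longleftrightarrow> (\<forall>v\<in>W. A v \<in> carrier_mat n m) \<and>
     (\<forall>i<n. \<forall>j<m. rat_on X W (\<lambda>v. A v $$ (i, j)))"

lemma rat_matD: "rat_mat X W n m A \<Longrightarrow> i < n \<Longrightarrow> j < m \<Longrightarrow> rat_on X W (\<lambda>v. A v $$ (i, j))"
  unfolding rat_mat_def by blast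

lemma rat_mat_carrier: "rat_mat X W n m A \<Longrightarrow> v \<in> W \<Longrightarrow> A v \<in> carrier_mat n m"
  unfolding rat_mat_def by blast

lemma rat_mat_mat:
  "(\<And>i j. i < n \<Longrightarrow> j < m \<Longrightarrow> rat_on X W (\<lambda>v. f v (i, j))) \<Longrightarrow> rat_mat X W n m (\<lambda>v. mat n m (f v))"
  unfolding rat_mat_def by simp

lemma rat_mat_const: "A \<in> carrier_mat n m \<Longrightarrow> rat_mat X W n m (\<lambda>v. A)"
  unfolding rat_mat_def by auto

lemma rat_mat_cong: "rat_mat X W n m A \<Longrightarrow> (\<And>v. v \<in> W \<Longrightarrow> A v = B v) \<Longrightarrow> rat_mat X W n m B"
  unfolding rat_mat_def
proof (intro conjI ballI allI impI)
  assume A: "(\<forall>v\<in>W. A v \<in> carrier_mat n m) \<and> (\<forall>i<n. \<forall>j<m. rat_on X W (\<lambda>v. A v $$ (i, j)))"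
    and AB: "\<And>v. v \<in> W \<Longrightarrow> A v = B v"
  then show "B v \<in> carrier_mat n m" if "v \<in> W" for v using that by metis
  fix i j assume "i < n" "j < m"
  with A have "rat_on X W (\<lambda>v. A v $$ (i, j))" by blast
  then show "rat_on X W (\<lambda>v. B v $$ (i, j))" by (rule rat_on_cong) (simp add: AB)
qed

lemma rat_mat_mult:
  assumes A: "rat_mat X W n k A" and B: "rat_mat X W k m B"
  shows "rat_mat X W n m (\<lambda>v. A v * B v)"
  unfolding rat_mat_def
proof (intro conjI ballI allI impI)
  show "A v * B v \<in> carrier_mat n m" if "v \<in> W" for v
    using rat_mat_carrier[OF A that] rat_mat_carrier[OF B that] by simp
  fix i j assume ij: "i < n" "j < m"
  have "rat_on X W (\<lambda>v. \<Sum>l<k. A v $$ (i, l) * B v $$ (l, j))"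
    by (intro rat_on_sum rat_on_mult rat_matD[OF A] rat_matD[OF B]) (use ij in auto)
  then show "rat_on X W (\<lambda>v. (A v * B v) $$ (i, j))"
    by (rule rat_on_cong)
      (rule mat_mult_entry[symmetric, OF rat_mat_carrier[OF A] rat_mat_carrier[OF B] ij])
qed

lemma rat_on_mult_entry:
  assumes "rat_mat Y W a k A" "rat_mat Y W k b B" "p < a" "q < b"
  shows "rat_on Y W (\<lambda>v. (A v * B v) $$ (p, q))"
  using rat_matD[OF rat_mat_mult[OF assms(1,2)] assms(3,4)] .

lemma rat_mat_pow:
  assumes A: "rat_mat X W n n A"
  shows "rat_mat X W n n (\<lambda>v. A v ^\<^sub>m k)"
proof (induction k)
  case 0
  have "rat_mat X W n n (\<lambda>v. 1\<^sub>m n)" by (rule rat_mat_const) simp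
  then show ?case
    by (rule rat_mat_cong) (use rat_mat_carrier[OF A] in fastforce)
next
  case (Suc k)
  then show ?case using rat_mat_mult[OF Suc A] by simp
qed

lemma rat_on_det:
  assumes A: "rat_mat X W n n A"
  shows "rat_on X W (\<lambda>v. det (A v))"
proof -
  have "rat_on X W (\<lambda>v. \<Sum>p | p permutes {0..<n}. signof p * (\<Prod>i = 0..<n. A v $$ (i, p i)))"
  proof (intro rat_on_sum rat_on_mult rat_on_const rat_on_prod rat_matD[OF A])
    fix p i assume "p \<in> {p. p permutes {0..<n}}" "i \<in> {0..<n}"
    then show "i < n" "p i < n" using permutes_in_image[of p "{0..<n}" i] by auto
  qed
  then show ?thesis
    by (rule rat_on_cong) (simp add: det_def'[OF rat_mat_carrier[OF A]])
qed

text \<open>The adjugate formula shows that the entries are rational with denominator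
  \<open>det A\<close>; \<open>inv_GL\<close> identifies the result with the inverse in the
  group.\<close>

definition minv :: "'k::field mat \<Rightarrow> 'k mat" where
  "minv A = (1 / det A) \<cdot>\<^sub>m adj_mat A"

lemma minv:
  assumes A: "A \<in> carrier_mat n n" and d: "det A \<noteq> 0"
  shows minv_carrier: "minv A \<in> carrier_mat n n"
    and mult_minv: "A * minv A = 1\<^sub>m n" and minv_mult: "minv A * A = 1\<^sub>m n"
proof -
  show "minv A \<in> carrier_mat n n" using adj_mat(1)[OF A] by (simp add: minv_def)
  have "A * minv A = (1 / det A) \<cdot>\<^sub>m (A * adj_mat A)"
    unfolding minv_def using A adj_mat(1)[OF A] by (rule mult_smult_distrib)
  also have "\<dots> = 1\<^sub>m n" unfolding adj_mat(2)[OF A] using d by (intro eq_matI) auto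
  finally show "A * minv A = 1\<^sub>m n" .
  have "minv A * A = (1 / det A) \<cdot>\<^sub>m (adj_mat A * A)"
    unfolding minv_def using adj_mat(1)[OF A] A by (rule mult_smult_assoc_mat)
  also have "\<dots> = 1\<^sub>m n" unfolding adj_mat(3)[OF A] using d by (intro eq_matI) auto
  finally show "minv A * A = 1\<^sub>m n" .
qed

lemma det_minv:
  assumes A: "A \<in> carrier_mat n n" and d: "det A \<noteq> 0"
  shows "det (minv A) \<noteq> 0"
proof -
  have "det A * det (minv A) = 1"
    using mult_minv[OF assms] det_mult[OF A minv_carrier[OF assms]] by simp
  then show ?thesis by auto
qed

lemma minv_eqI:
  assumes A: "A \<in> carrier_mat n n" and B: "B \<in> carrier_mat n n" and BA: "B * A = 1\<^sub>m n"
  shows "minv A = (B :: 'k::field mat)"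
proof -
  have "det B * det A = 1" using det_mult[OF B A] BA by simp
  then have d: "det A \<noteq> 0" by auto
  note m = minv_carrier[OF A d]
  have "minv A = B * A * minv A" unfolding BA by (rule left_mult_one_mat[symmetric, OF m])
  also have "\<dots> = B * (A * minv A)" by (rule assoc_mult_mat[OF B A m])
  also have "\<dots> = B" unfolding mult_minv[OF A d] by (rule right_mult_one_mat[OF B])
  finally show ?thesis .
qed

lemma minv_smult:
  assumes A: "A \<in> carrier_mat n n" and d: "det A \<noteq> 0" and k: "k \<noteq> 0"
  shows "minv (k \<cdot>\<^sub>m A) = inverse k \<cdot>\<^sub>m (minv A :: 'k::field mat)"
proof (rule minv_eqI)
  note m = minv_carrier[OF A d]
  show "k \<cdot>\<^sub>m A \<in> carrier_mat n n" "inverse k \<cdot>\<^sub>m minv A \<in> carrier_mat n n" using A m by auto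
  have "inverse k \<cdot>\<^sub>m minv A * (k \<cdot>\<^sub>m A) = inverse k \<cdot>\<^sub>m (k \<cdot>\<^sub>m (minv A * A))"
    using A m by (simp add: mult_smult_assoc_mat[OF m smult_carrier_mat[OF A]] mult_smult_distrib[OF m A])
  also have "\<dots> = 1\<^sub>m n" unfolding minv_mult[OF A d] using k by (intro eq_matI) auto
  finally show "inverse k \<cdot>\<^sub>m minv A * (k \<cdot>\<^sub>m A) = 1\<^sub>m n" .
qed

text \<open>The scalar at the target cancels against its inverse at the source. Therefore
  multiplying all components of an element of G_d by one scalar does not change its action.\<close>

lemma conj_smult:
  assumes A: "A \<in> carrier_mat n n" "det A \<noteq> 0" and B: "B \<in> carrier_mat m m" and N: "N \<in> carrier_mat m n"
    and k: "k \<noteq> 0"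
  shows "(k \<cdot>\<^sub>m B) * N * minv (k \<cdot>\<^sub>m A) = B * N * (minv A :: 'k::field mat)"
proof -
  note m = minv_carrier[OF A]
  have BN: "B * N \<in> carrier_mat m n" by (rule mult_carrier_mat[OF B N])
  have "(k \<cdot>\<^sub>m B) * N * minv (k \<cdot>\<^sub>m A) = k \<cdot>\<^sub>m (B * N) * (inverse k \<cdot>\<^sub>m minv A)"
    unfolding minv_smult[OF A k] mult_smult_assoc_mat[OF B N] ..
  also have "\<dots> = k \<cdot>\<^sub>m (inverse k \<cdot>\<^sub>m (B * N * minv A))"
    unfolding mult_smult_assoc_mat[OF BN smult_carrier_mat[OF m]] mult_smult_distrib[OF BN m] ..
  also have "\<dots> = B * N * minv A" using k by (intro eq_matI) auto
  finally show ?thesis .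
qed

lemma rat_mat_minv:
  assumes A: "rat_mat X W n n A" and d: "\<And>v. v \<in> W \<Longrightarrow> det (A v) \<noteq> 0"
  shows "rat_mat X W n n (\<lambda>v. minv (A v))"
  unfolding rat_mat_def
proof (intro conjI ballI allI impI)
  show "minv (A v) \<in> carrier_mat n n" if "v \<in> W" for v
    using minv_carrier[OF rat_mat_carrier[OF A that] d[OF that]] .
  fix i j assume ij: "i < n" "j < n"
  have "rat_mat X W (n - 1) (n - 1) (\<lambda>v. mat_delete (A v) j i)"
    unfolding rat_mat_def
  proof (intro conjI ballI allI impI)
    show "mat_delete (A v) j i \<in> carrier_mat (n - 1) (n - 1)" if "v \<in> W" for v
      by (rule mat_delete_carrier[OF rat_mat_carrier[OF A that]])
    fix k l assume kl: "k < n - 1" "l < n - 1"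
    have "rat_on X W (\<lambda>v. A v $$ (if k < j then k else Suc k, if l < i then l else Suc l))"
      by (rule rat_matD[OF A]) (use kl in auto)
    then show "rat_on X W (\<lambda>v. mat_delete (A v) j i $$ (k, l))"
      by (rule rat_on_cong) (use rat_mat_carrier[OF A] kl in \<open>fastforce simp: mat_delete_def\<close>)
  qed
  then have "rat_on X W (\<lambda>v. 1 / det (A v) * ((- 1) ^ (j + i) * det (mat_delete (A v) j i)))"
    using rat_on_det[OF A] d
    by (intro rat_on_mult[OF rat_on_divide[OF rat_on_const] rat_on_mult[OF rat_on_const]])
      (auto intro: rat_on_det)
  then show "rat_on X W (\<lambda>v. minv (A v) $$ (i, j))"
  proof (rule rat_on_cong)
    fix v assume "v \<in> W"
    from rat_mat_carrier[OF A this] ij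
    show "1 / det (A v) * ((- 1) ^ (j + i) * det (mat_delete (A v) j i)) = minv (A v) $$ (i, j)"
      by (simp add: minv_def adj_mat_def cofactor_def)
  qed
qed

section \<open>The general linear group in terms of determinants\<close>

lemma carrier_GL: "carrier (GL m) = {A \<in> carrier_mat m m. det A \<noteq> (0 :: 'k::field)}"
proof -
  have "Units (ring_mat TYPE('k) m ()) = {A \<in> carrier_mat m m. det A \<noteq> 0}"
  proof (intro equalityI subsetI)
    fix A assume A: "A \<in> Units (ring_mat TYPE('k) m ())"
    then have "A \<in> carrier_mat m m" by (simp add: Units_def ring_mat_def)
    with unit_imp_det_non_zero[OF A] show "A \<in> {A \<in> carrier_mat m m. det A \<noteq> 0}" by simp
  next
    fix A :: "'k mat" assume "A \<in> {A \<in> carrier_mat m m. det A \<noteq> 0}"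
    then show "A \<in> Units (ring_mat TYPE('k) m ())" by (auto intro: det_non_zero_imp_unit)
  qed
  then show ?thesis unfolding GL_def units_of_carrier .
qed

lemma mult_GL: "x \<otimes>\<^bsub>GL m\<^esub> y = x * y" and one_GL: "\<one>\<^bsub>GL m\<^esub> = 1\<^sub>m m"
  by (simp_all add: GL_def units_of_def ring_mat_def)

lemma group_GL: "group (GL m :: 'k::field mat monoid)"
proof -
  interpret ring "ring_mat TYPE('k) m ()" by (rule ring_mat)
  show ?thesis unfolding GL_def by (rule units_group)
qed

lemma inv_GL:
  assumes "g \<in> carrier (GL m)"
  shows "inv\<^bsub>GL m\<^esub> g = minv (g :: 'k::field mat)"
proof -
  interpret group "GL m :: 'k mat monoid" by (rule group_GL)
  have g: "g \<in> carrier_mat m m" "det g \<noteq> 0" using assms by (auto simp: carrier_GL)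
  show ?thesis
  proof (rule inv_equality[OF _ assms])
    show "minv g \<otimes>\<^bsub>GL m\<^esub> g = \<one>\<^bsub>GL m\<^esub>" using minv_mult[OF g] by (simp add: mult_GL one_GL)
    show "minv g \<in> carrier (GL m)" using minv_carrier[OF g] det_minv[OF g] by (simp add: carrier_GL)
  qed
qed

section \<open>Free modules over truncated polynomial rings\<close>

lemma free_mat_carrier [simp]: "free_mat c r \<in> carrier_mat (c * r) (c * r)"
  by (simp add: free_mat_def)

text \<open>Multiplication by the standard matrix from the left moves the rows of a block down by
  one, multiplication from the right moves the columns to the left; the freed row or column becomes
  0.\<close>

lemma free_mat_mult_entry:
  assumes A: "A \<in> carrier_mat (c * r) m" and "p < c * r" "q < m"
  shows "(free_mat c r * A) $$ (p, q) = (if p mod c \<noteq> 0 then A $$ (p - 1, q) else (0 :: 'k::field))"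
proof -
  have "(free_mat c r * A) $$ (p, q) = (\<Sum>l<c * r. free_mat c r $$ (p, l) * A $$ (l, q))"
    by (rule mat_mult_entry[OF free_mat_carrier A assms(2,3)])
  also have "\<dots> = (\<Sum>l<c * r. if l = p - 1 then (if p mod c \<noteq> 0 then A $$ (p - 1, q) else 0) else 0)"
    using assms(2) by (intro sum.cong) (auto simp: free_mat_def)
  also have "\<dots> = (if p mod c \<noteq> 0 then A $$ (p - 1, q) else 0)"
    using assms(2) by (auto simp: sum.delta)
  finally show ?thesis .
qed

lemma mult_free_mat_entry:
  assumes A: "A \<in> carrier_mat m (c * r)" and "p < m" "q < c * r"
  shows "(A * free_mat c r) $$ (p, q) = (if q mod c + 1 < c then A $$ (p, q + 1) else (0 :: 'k::field))"
proof -
  have c: "c > 0" using assms(3) by (cases c) auto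
  have m: "Suc q mod c \<noteq> 0 \<longleftrightarrow> q mod c + 1 < c"
    using c mod_less_divisor[OF c, of q] by (auto simp: mod_Suc)
  have lt: "q + 1 < c * r" if "q mod c + 1 < c"
  proof -
    have "q + 1 \<noteq> c * r" using m that by auto
    then show ?thesis using assms(3) by simp
  qed
  have "(A * free_mat c r) $$ (p, q) = (\<Sum>l<c * r. A $$ (p, l) * free_mat c r $$ (l, q))"
    by (rule mat_mult_entry[OF A free_mat_carrier assms(2,3)])
  also have "\<dots> = (\<Sum>l<c * r. if l = q + 1 then (if q mod c + 1 < c then A $$ (p, q + 1) else 0) else 0)"
    using assms(3) m by (intro sum.cong) (auto simp: free_mat_def)
  also have "\<dots> = (if q mod c + 1 < c then A $$ (p, q + 1) else 0)"
    using lt by (simp add: sum.delta)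
  finally show ?thesis .
qed

lemma mult_free_mat_pow_entry:
  assumes A: "A \<in> carrier_mat m (c * r)" and "p < m" "q < c * r"
  shows "(A * free_mat c r ^\<^sub>m e) $$ (p, q) = (if q mod c + e < c then A $$ (p, q + e) else (0 :: 'k::field))"
  using assms(3)
proof (induction e arbitrary: q)
  case 0
  have "A * 1\<^sub>m (c * r) = A" using A by simp
  moreover have "q mod c < c" using 0 by (cases c) auto
  ultimately show ?case using A 0 by (simp add: free_mat_def)
next
  case (Suc e)
  have P: "A * free_mat c r ^\<^sub>m e \<in> carrier_mat m (c * r)" using A by (intro mult_carrier_mat pow_carrier_mat) auto
  have "A * free_mat c r ^\<^sub>m Suc e = A * free_mat c r ^\<^sub>m e * free_mat c r"
    using A by (simp add: assoc_mult_mat[OF A pow_carrier_mat[OF free_mat_carrier] free_mat_carrier])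
  then have "(A * free_mat c r ^\<^sub>m Suc e) $$ (p, q) =
      (if q mod c + 1 < c then (A * free_mat c r ^\<^sub>m e) $$ (p, q + 1) else 0)"
    using mult_free_mat_entry[OF P assms(2) Suc.prems] by simp
  also have "\<dots> = (if q mod c + Suc e < c then A $$ (p, q + Suc e) else 0)"
  proof (cases "q mod c + 1 < c")
    case True
    then have m: "(q + 1) mod c = q mod c + 1" by (simp add: mod_Suc)
    have "q + 1 \<noteq> c * r" using m by auto
    then have "q + 1 < c * r" using Suc.prems by simp
    with Suc.IH[OF this] True m show ?thesis by simp
  qed simp
  finally show ?case .
qed

text \<open>The row p of h N is the row p - 1 of h inside a block and 0 at its start, so e steps
  lead to the row p - e or out of the block.\<close>

lemma intertwine_pow_entry:
  assumes h: "h \<in> carrier_mat (c * r) (c * r)" and N: "N \<in> carrier_mat (c * r) (c * r)"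
    and hN: "h * N = free_mat c r * h" and "p < c * r" "q < c * r"
  shows "(h * N ^\<^sub>m e) $$ (p, q) = (if e \<le> p mod c then h $$ (p - e, q) else (0 :: 'k::field))"
  using assms(5)
proof (induction e arbitrary: q)
  case 0
  have "h * 1\<^sub>m (c * r) = h" using h by simp
  with N show ?case by simp
next
  case (Suc e)
  have P: "h * N ^\<^sub>m e \<in> carrier_mat (c * r) (c * r)" by (rule mult_carrier_mat[OF h pow_carrier_mat[OF N]])
  have "h * N ^\<^sub>m Suc e = h * N ^\<^sub>m e * N"
    by (simp add: assoc_mult_mat[OF h pow_carrier_mat[OF N] N])
  then have "(h * N ^\<^sub>m Suc e) $$ (p, q) = (\<Sum>l<c * r. (h * N ^\<^sub>m e) $$ (p, l) * N $$ (l, q))"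
    using mat_mult_entry[OF P N assms(4) Suc.prems] by simp
  also have "\<dots> = (\<Sum>l<c * r. (if e \<le> p mod c then h $$ (p - e, l) else 0) * N $$ (l, q))"
    by (intro sum.cong) (auto simp: Suc.IH)
  also have "\<dots> = (if e \<le> p mod c then (h * N) $$ (p - e, q) else 0)"
    using mat_mult_entry[OF h N _ Suc.prems, of "p - e"] assms(4) by simp
  also have "\<dots> = (if Suc e \<le> p mod c then h $$ (p - Suc e, q) else 0)"
  proof (cases "e \<le> p mod c")
    case True
    have "p mod c \<le> p" by simp
    then have "p - e = p div c * c + (p mod c - e)" using True by (metis Nat.add_diff_assoc div_mult_mod_eq)
    moreover have "c > 0" using assms(4) by (cases c) auto
    moreover have "p mod c - e < c" using \<open>c > 0\<close> by (meson le_less_trans diff_le_self mod_less_divisor)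
    ultimately have "(p - e) mod c = p mod c - e" by simp
    then show ?thesis
      unfolding hN using free_mat_mult_entry[OF h _ Suc.prems, of "p - e"] assms(4) True by auto
  qed simp
  finally show ?case .
qed

lemma intertwine_pow:
  assumes h: "h \<in> carrier_mat n m" and N: "N \<in> carrier_mat m m" and F: "F \<in> carrier_mat n n"
    and hN: "h * N = F * h"
  shows "h * N ^\<^sub>m e = F ^\<^sub>m e * (h :: 'k::field mat)"
proof (induction e)
  case 0
  then show ?case using h N F by simp
next
  case (Suc e)
  have Ne: "N ^\<^sub>m e \<in> carrier_mat m m" and Fe: "F ^\<^sub>m e \<in> carrier_mat n n" using N F by auto
  have "h * N ^\<^sub>m Suc e = h * N ^\<^sub>m e * N" using assoc_mult_mat[OF h Ne N] by simp
  also have "\<dots> = F ^\<^sub>m e * (h * N)" unfolding Suc using assoc_mult_mat[OF Fe h N] .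
  also have "\<dots> = F ^\<^sub>m e * F * h" unfolding hN using assoc_mult_mat[OF Fe F h] by simp
  finally show ?case by simp
qed

lemma intertwine_nilpotent:
  assumes h: "h \<in> carrier_mat (c * r) (c * r)" "det h \<noteq> 0" and N: "N \<in> carrier_mat (c * r) (c * r)"
    and hN: "h * N = free_mat c r * h"
  shows "N ^\<^sub>m c = (0\<^sub>m (c * r) (c * r) :: 'k::field mat)"
proof -
  have Nc: "N ^\<^sub>m c \<in> carrier_mat (c * r) (c * r)" using N by simp
  have "h * N ^\<^sub>m c = 0\<^sub>m (c * r) (c * r)"
  proof (rule eq_matI)
    fix p q assume "p < dim_row (0\<^sub>m (c * r) (c * r))" "q < dim_col (0\<^sub>m (c * r) (c * r))"
    then have pq: "p < c * r" "q < c * r" by auto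
    then have "c > 0" by (cases c) auto
    then have "p mod c < c" by simp
    then show "(h * N ^\<^sub>m c) $$ (p, q) = 0\<^sub>m (c * r) (c * r) $$ (p, q)"
      using intertwine_pow_entry[OF h(1) N hN pq, of c] pq by simp
  qed (use h Nc in auto)
  then have "minv h * h * N ^\<^sub>m c = minv h * 0\<^sub>m (c * r) (c * r)"
    using assoc_mult_mat[OF minv_carrier[OF h] h(1) Nc] by simp
  then show ?thesis
    unfolding minv_mult[OF h] left_mult_one_mat[OF Nc] right_mult_zero_mat[OF minv_carrier[OF h]] .
qed

text \<open>
  Row \<open>k c + l\<close> of \<open>hmat c m H N\<close> is row \<open>k c + (c - 1)\<close> of \<open>H N^(c - 1 - l)\<close>: the coordinates with
  respect to a basis on which \<open>N\<close> acts like \<open>free_mat\<close> are determined by their last ones.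
\<close>

definition hmat :: "nat \<Rightarrow> nat \<Rightarrow> 'k::field mat \<Rightarrow> 'k mat \<Rightarrow> 'k mat" where
  "hmat c m H N = mat m m (\<lambda>(p, q). (H * N ^\<^sub>m (c - 1 - p mod c)) $$ (p - p mod c + (c - 1), q))"

lemma block_last_less:
  assumes "p < c * r"
  shows "p - p mod c + (c - 1) < c * (r :: nat)"
proof -
  have c: "c > 0" using assms by (cases c) auto
  have "p div c < r" using assms by (simp add: less_mult_imp_div_less mult.commute)
  then have "c * (p div c + 1) \<le> c * r" by (intro mult_le_mono) auto
  moreover have "p - p mod c = c * (p div c)" by (simp add: minus_mod_eq_mult_div)
  ultimately show ?thesis using c by (simp add: algebra_simps)
qed

lemma hmat_carrier [simp]: "hmat c m H N \<in> carrier_mat m m"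
  by (simp add: hmat_def)

lemma hmat_entry: "p < m \<Longrightarrow> q < m \<Longrightarrow>
    hmat c m H N $$ (p, q) = (H * N ^\<^sub>m (c - 1 - p mod c)) $$ (p - p mod c + (c - 1), q)"
  by (simp add: hmat_def)

text \<open>The row p of h N is the last row of its block in H, multiplied by N^(c - p mod c).
  Inside a block this is the row p - 1 of h by definition; at the start of a block the exponent is
  c, and nilpotency gives 0.\<close>

lemma hmat_intertwine:
  assumes H: "H \<in> carrier_mat (c * r) (c * r)" and N: "N \<in> carrier_mat (c * r) (c * r)"
    and N0: "N ^\<^sub>m c = 0\<^sub>m (c * r) (c * r)"
  shows "hmat c (c * r) H N * N = free_mat c r * (hmat c (c * r) H N :: 'k::field mat)"
proof (rule eq_matI)
  let ?h = "hmat c (c * r) H N" and ?m = "c * r"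
  fix p q assume "p < dim_row (free_mat c r * ?h)" "q < dim_col (free_mat c r * ?h)"
  then have p: "p < ?m" and q: "q < ?m" by (auto simp: free_mat_def hmat_def)
  have c: "c > 0" using p by (cases c) auto
  let ?p = "p - p mod c + (c - 1)" and ?e = "c - 1 - p mod c"
  have p': "?p < ?m" by (rule block_last_less[OF p])
  have P: "H * N ^\<^sub>m ?e \<in> carrier_mat ?m ?m" by (rule mult_carrier_mat[OF H pow_carrier_mat[OF N]])
  have "(?h * N) $$ (p, q) = (\<Sum>l<?m. ?h $$ (p, l) * N $$ (l, q))"
    by (rule mat_mult_entry[OF _ N p q]) simp
  also have "\<dots> = (\<Sum>l<?m. (H * N ^\<^sub>m ?e) $$ (?p, l) * N $$ (l, q))"
    using p by (intro sum.cong) (auto simp: hmat_def)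
  also have "\<dots> = (H * N ^\<^sub>m ?e * N) $$ (?p, q)"
    by (rule mat_mult_entry[symmetric, OF P N p' q])
  also have "H * N ^\<^sub>m ?e * N = H * N ^\<^sub>m Suc ?e"
    using assoc_mult_mat[OF H pow_carrier_mat[OF N] N] by simp
  also have "Suc ?e = c - p mod c" using c mod_less_divisor[OF c, of p] by simp
  also have "(H * N ^\<^sub>m (c - p mod c)) $$ (?p, q) = (if p mod c \<noteq> 0 then ?h $$ (p - 1, q) else 0)"
  proof (cases "p mod c = 0")
    case True
    then show ?thesis using N0 H p' q by simp
  next
    case False
    have m: "(p - 1) mod c = p mod c - 1"
    proof -
      have "p - 1 = p div c * c + (p mod c - 1)" using False
        by (metis Nat.add_diff_assoc One_nat_def Suc_leI div_mult_mod_eq not_gr_zero)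
      moreover have "p mod c - 1 < c" using c by (meson le_less_trans diff_le_self mod_less_divisor)
      ultimately show ?thesis by simp
    qed
    have a: "p - 1 - (p - 1) mod c = p - p mod c" unfolding m using False by simp
    have b: "c - 1 - (p - 1) mod c = c - p mod c" unfolding m using False by simp
    have "?h $$ (p - 1, q) =
        (H * N ^\<^sub>m (c - 1 - (p - 1) mod c)) $$ (p - 1 - (p - 1) mod c + (c - 1), q)"
      by (rule hmat_entry) (use p q in auto)
    then have "?h $$ (p - 1, q) = (H * N ^\<^sub>m (c - p mod c)) $$ (?p, q)" unfolding a b .
    with False show ?thesis by simp
  qed
  also have "\<dots> = (free_mat c r * ?h) $$ (p, q)"
    by (rule free_mat_mult_entry[symmetric, OF _ p q]) simp
  finally show "(?h * N) $$ (p, q) = (free_mat c r * ?h) $$ (p, q)" .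
qed (use N in \<open>auto simp: hmat_def free_mat_def\<close>)

lemma hmat_last_row:
  assumes "H \<in> carrier_mat m m" "N \<in> carrier_mat m m" "p < m" "q < m" "p mod c = c - 1"
  shows "hmat c m H N $$ (p, q) = (H :: 'k::field mat) $$ (p, q)"
proof -
  have "p mod c \<le> p" by simp
  then have "p - p mod c + (c - 1) = p" using assms(5) by linarith
  then show ?thesis using assms by (simp add: hmat_def)
qed

text \<open>In an intertwiner the row p arises from the last row of its block by c - 1 - p mod c
  multiplications with N. Thus the last rows determine h, and \<open>hmat\<close> recovers it from
  them.\<close>

lemma hmat_eqI:
  assumes H: "H \<in> carrier_mat (c * r) (c * r)"
    and h: "h \<in> carrier_mat (c * r) (c * r)" and N: "N \<in> carrier_mat (c * r) (c * r)"
    and hN: "h * N = free_mat c r * h"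
    and hH: "\<And>p q. p < c * r \<Longrightarrow> q < c * r \<Longrightarrow> p mod c = c - 1 \<Longrightarrow> h $$ (p, q) = H $$ (p, q)"
  shows "hmat c (c * r) H N = (h :: 'k::field mat)"
proof (rule eq_matI)
  let ?m = "c * r"
  fix p q assume "p < dim_row h" "q < dim_col h"
  with h have p: "p < ?m" and q: "q < ?m" by auto
  have c: "c > 0" using p by (cases c) auto
  let ?p = "p - p mod c + (c - 1)" and ?e = "c - 1 - p mod c"
  have p': "?p < ?m" by (rule block_last_less[OF p])
  have pm: "?p mod c = c - 1"
  proof -
    have "?p = c * (p div c) + (c - 1)" by (simp add: minus_mod_eq_mult_div)
    then have "?p mod c = (c - 1) mod c" by (metis mod_mult_self4)
    then show ?thesis using c by simp
  qed
  have "hmat c ?m H N $$ (p, q) = (H * N ^\<^sub>m ?e) $$ (?p, q)" using p q by (simp add: hmat_def)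
  also have "\<dots> = (\<Sum>l<?m. H $$ (?p, l) * (N ^\<^sub>m ?e) $$ (l, q))"
    by (rule mat_mult_entry[OF H pow_carrier_mat[OF N] p' q])
  also have "\<dots> = (\<Sum>l<?m. h $$ (?p, l) * (N ^\<^sub>m ?e) $$ (l, q))"
    using hH[OF p' _ pm] by (intro sum.cong) auto
  also have "\<dots> = (h * N ^\<^sub>m ?e) $$ (?p, q)"
    by (rule mat_mult_entry[symmetric, OF h pow_carrier_mat[OF N] p' q])
  also have "\<dots> = h $$ (?p - ?e, q)"
    unfolding intertwine_pow_entry[OF h N hN p' q] pm by simp
  also have "?p - ?e = p"
  proof -
    have "p mod c \<le> p" "p mod c < c" using c by auto
    then show ?thesis by linarith
  qed
  finally show "hmat c ?m H N $$ (p, q) = h $$ (p, q)" .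
qed (use h in \<open>auto simp: hmat_def\<close>)

lemma sum_lessThan_add: "(\<Sum>p<a + b. f p) = (\<Sum>p<a. f p) + (\<Sum>l<b. f (a + l :: nat) :: 'a::comm_monoid_add)"
  by (induction b) (simp_all add: add.assoc)

lemma sum_blocks: "(\<Sum>k<r. \<Sum>l<c. f (k * c + l)) = (\<Sum>p<c * (r :: nat). f p :: 'a::comm_monoid_add)"
proof (induct r)
  case (Suc r)
  then show ?case using sum_lessThan_add[of f "c * r" c] by (simp add: algebra_simps)
qed simp

lemma card_residues: "card {p. p < c * r \<and> P (p mod c)} = r * card {l. l < c \<and> P l}"
  for c r :: nat
proof -
  have "card {p. p < c * r \<and> P (p mod c)} = (\<Sum>p<c * r. if P (p mod c) then 1 else 0)"
    by (simp add: sum.If_cases Int_def)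
  also have "\<dots> = (\<Sum>k<r. \<Sum>l<c. if P ((k * c + l) mod c) then 1 else 0)"
    by (rule sum_blocks[symmetric])
  also have "\<dots> = (\<Sum>k<r. \<Sum>l<c. if P l then 1 else 0)"
    by (intro sum.cong) auto
  also have "\<dots> = r * card {l. l < c \<and> P l}" by (simp add: sum.If_cases Int_def)
  finally show ?thesis .
qed

lemma block_index_less: "k < r \<Longrightarrow> l < c \<Longrightarrow> k * c + l < c * (r :: nat)"
proof -
  assume "k < r" "l < c"
  then have "c * (k + 1) \<le> c * r" by (intro mult_le_mono) auto
  with \<open>l < c\<close> show ?thesis by (simp add: algebra_simps)
qed

text \<open>The first columns of the blocks of the inverse of h serve as basis: its column k c + l
  is N^l applied to b k, so that expanding a vector amounts to multiplying it by h.\<close>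

lemma free_of_rank_intertwine:
  assumes N: "N \<in> carrier_mat (c * r) (c * r)" and h: "h \<in> carrier_mat (c * r) (c * r)" "det h \<noteq> 0"
    and hN: "h * N = free_mat c r * h"
  shows "free_of_rank c (c * r) (N :: 'k::field mat) r"
proof -
  let ?m = "c * r"
  define g where "g = minv h"
  have g: "g \<in> carrier_mat ?m ?m" and hg: "h * g = 1\<^sub>m ?m" and gh: "g * h = 1\<^sub>m ?m"
    using minv[OF h] by (auto simp: g_def)
  have Ng: "N * g = g * free_mat c r"
  proof -
    have "N * g = g * h * (N * g)" using N g by (simp add: gh)
    also have "\<dots> = g * (h * N * g)"
      using g h N free_mat_carrier[of c r, where 'a = 'k] by (simp add: assoc_mult_mat[of _ ?m ?m _ ?m _ ?m])
    also have "\<dots> = g * (free_mat c r * (h * g))"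
      unfolding hN using g h free_mat_carrier[of c r, where 'a = 'k] by (simp add: assoc_mult_mat[of _ ?m ?m _ ?m _ ?m])
    finally show ?thesis unfolding hg using g by (simp add: free_mat_def)
  qed
  have Neg: "N ^\<^sub>m e * g = g * free_mat c r ^\<^sub>m e" for e
    using intertwine_pow[OF g free_mat_carrier N Ng[symmetric]] by simp
  define b where "b k = col g (k * c)" for k
  have b: "b k \<in> carrier_vec ?m" for k
  proof -
    have "dim_vec (b k) = ?m" using g by (simp add: b_def)
    then show ?thesis by (rule carrier_vecI)
  qed
  have Nb: "(N ^\<^sub>m l *\<^sub>v b k) $ p = g $$ (p, k * c + l)" if "k < r" "l < c" "p < ?m" for k l p
  proof -
    have kc: "k * c < ?m" using block_index_less[of k r 0 c] that by (cases c) auto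
    have "(N ^\<^sub>m l *\<^sub>v b k) $ p = (N ^\<^sub>m l * g) $$ (p, k * c)"
      using that kc g N by (simp add: b_def)
    also have "\<dots> = g $$ (p, k * c + l)"
      unfolding Neg using mult_free_mat_pow_entry[OF g that(3) kc, of l] that(2) by simp
    finally show ?thesis .
  qed
  have exp: "(\<Sum>k<r. \<Sum>l<c. u (k, l) * (N ^\<^sub>m l *\<^sub>v b k) $ p) = (g *\<^sub>v vec ?m (\<lambda>q. u (q div c, q mod c))) $ p"
    if p: "p < ?m" for u p
  proof -
    have "(g *\<^sub>v vec ?m (\<lambda>q. u (q div c, q mod c))) $ p = (\<Sum>q<?m. g $$ (p, q) * u (q div c, q mod c))"
      using p g by (simp add: scalar_prod_def atLeast0LessThan)
    also have "\<dots> = (\<Sum>k<r. \<Sum>l<c. g $$ (p, k * c + l) * u ((k * c + l) div c, (k * c + l) mod c))"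
      by (rule sum_blocks[symmetric])
    also have "\<dots> = (\<Sum>k<r. \<Sum>l<c. u (k, l) * (N ^\<^sub>m l *\<^sub>v b k) $ p)"
      by (intro sum.cong) (auto simp: Nb p)
    finally show ?thesis by simp
  qed
  show ?thesis
    unfolding free_of_rank_def
  proof (intro exI[of _ b] conjI allI impI ballI b)
    fix v :: "'k vec" assume v: "v \<in> carrier_vec ?m"
    define u where "u = restrict (\<lambda>(k, l). (h *\<^sub>v v) $ (k * c + l)) ({..<r} \<times> {..<c})"
    show "\<exists>!u. u \<in> {..<r} \<times> {..<c} \<rightarrow>\<^sub>E UNIV \<and>
      (\<forall>p<?m. v $ p = (\<Sum>k<r. \<Sum>l<c. u (k, l) * (N ^\<^sub>m l *\<^sub>v b k) $ p))"
    proof (intro ex1I conjI allI impI)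
      show "u \<in> {..<r} \<times> {..<c} \<rightarrow>\<^sub>E UNIV" by (auto simp: u_def)
      have "vec ?m (\<lambda>q. u (q div c, q mod c)) = h *\<^sub>v v"
      proof (rule eq_vecI)
        fix q assume "q < dim_vec (h *\<^sub>v v)"
        then have q: "q < ?m" using h by simp
        then have "q div c < r" "q mod c < c"
          by (simp_all add: less_mult_imp_div_less mult.commute) (cases c; simp)
        then show "vec ?m (\<lambda>q. u (q div c, q mod c)) $ q = (h *\<^sub>v v) $ q" using q by (simp add: u_def)
      qed (use h in simp)
      then have "g *\<^sub>v vec ?m (\<lambda>q. u (q div c, q mod c)) = v"
        using assoc_mult_mat_vec[OF g h(1) v] gh v by simp
      then show "v $ p = (\<Sum>k<r. \<Sum>l<c. u (k, l) * (N ^\<^sub>m l *\<^sub>v b k) $ p)" if "p < ?m" for p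
        using exp[OF that, of u] by simp
    next
      fix u' assume u': "u' \<in> {..<r} \<times> {..<c} \<rightarrow>\<^sub>E UNIV \<and>
        (\<forall>p<?m. v $ p = (\<Sum>k<r. \<Sum>l<c. u' (k, l) * (N ^\<^sub>m l *\<^sub>v b k) $ p))"
      let ?w = "vec ?m (\<lambda>q. u' (q div c, q mod c))"
      have w: "?w \<in> carrier_vec ?m" by simp
      have "v = g *\<^sub>v ?w" using u' exp g v by (intro eq_vecI) auto
      then have "h *\<^sub>v v = ?w" using assoc_mult_mat_vec[OF h(1) g w] hg by simp
      show "u' = u"
      proof (rule PiE_ext)
        show "u' \<in> {..<r} \<times> {..<c} \<rightarrow>\<^sub>E UNIV" using u' by blast
        show "u \<in> {..<r} \<times> {..<c} \<rightarrow>\<^sub>E UNIV" by (auto simp: u_def)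
        fix x assume "x \<in> {..<r} \<times> {..<c}"
        then obtain k l where x: "x = (k, l)" "k < r" "l < c" by auto
        have "u (k, l) = ?w $ (k * c + l)" using x \<open>h *\<^sub>v v = ?w\<close> by (simp add: u_def)
        also have "\<dots> = u' (k, l)" using block_index_less[OF x(2,3)] x(3) by simp
        finally show "u' x = u x" using x by simp
      qed
    qed
  qed
qed

lemma ex1_unique: "\<exists>!x. P x \<Longrightarrow> P a \<Longrightarrow> P b \<Longrightarrow> a = b"
  by blast

text \<open>The vectors N^l applied to b k are the columns of a change of basis g under which N
  becomes the standard matrix; its inverse is the intertwiner.\<close>

lemma free_of_rank_imp_intertwine:
  assumes N: "N \<in> carrier_mat (c * r) (c * r)" and N0: "N ^\<^sub>m c = 0\<^sub>m (c * r) (c * r)"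
    and free: "free_of_rank c (c * r) (N :: 'k::field mat) r"
  shows "\<exists>h\<in>carrier_mat (c * r) (c * r). det h \<noteq> 0 \<and> h * N = free_mat c r * h"
proof -
  let ?m = "c * r"
  from free obtain b where conj: "(\<forall>k<r. b k \<in> carrier_vec ?m) \<and>
      (\<forall>v\<in>carrier_vec ?m. \<exists>!u. u \<in> {..<r} \<times> {..<c} \<rightarrow>\<^sub>E UNIV \<and>
        (\<forall>p<?m. v $ p = (\<Sum>k<r. \<Sum>l<c. u (k, l) * (N ^\<^sub>m l *\<^sub>v b k) $ p)))"
    unfolding free_of_rank_def by (elim exE)
  note b = conjunct1[OF conj, THEN spec, THEN mp] and uniq = conjunct2[OF conj, THEN bspec]
  define g where "g = mat ?m ?m (\<lambda>(p, q). (N ^\<^sub>m (q mod c) *\<^sub>v b (q div c)) $ p)"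
  have g: "g \<in> carrier_mat ?m ?m" by (simp add: g_def)
  have exp: "(\<Sum>k<r. \<Sum>l<c. u (k * c + l) * (N ^\<^sub>m l *\<^sub>v b k) $ p) = (\<Sum>q<?m. g $$ (p, q) * u q)"
    if p: "p < ?m" for u p
  proof -
    have "(\<Sum>q<?m. g $$ (p, q) * u q) = (\<Sum>k<r. \<Sum>l<c. g $$ (p, k * c + l) * u (k * c + l))"
      by (rule sum_blocks[symmetric])
    also have "\<dots> = (\<Sum>k<r. \<Sum>l<c. u (k * c + l) * (N ^\<^sub>m l *\<^sub>v b k) $ p)"
      using p by (intro sum.cong) (auto simp: g_def block_index_less)
    finally show ?thesis by simp
  qed
  have det: "det g \<noteq> 0"
  proof
    assume "det g = 0"
    \<comment> \<open>A nonzero vector in the kernel of g would be a second expansion of the zero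
      vector.\<close>
    then obtain w where w: "w \<in> carrier_vec ?m" "w \<noteq> 0\<^sub>v ?m" "g *\<^sub>v w = 0\<^sub>v ?m"
      using det_0_iff_vec_prod_zero_field[OF g] by blast
    let ?u = "\<lambda>w :: nat \<Rightarrow> 'k. restrict (\<lambda>(k, l). w (k * c + l)) ({..<r} \<times> {..<c})"
    define Q where "Q u \<longleftrightarrow> u \<in> {..<r} \<times> {..<c} \<rightarrow>\<^sub>E UNIV \<and>
      (\<forall>p<?m. 0\<^sub>v ?m $ p = (\<Sum>k<r. \<Sum>l<c. u (k, l) * (N ^\<^sub>m l *\<^sub>v b k) $ p))" for u
    have uniqQ: "\<exists>!u. Q u" unfolding Q_def by (rule uniq) simp
    have P: "?u w \<in> {..<r} \<times> {..<c} \<rightarrow>\<^sub>E UNIV \<and>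
        (\<forall>p<?m. 0\<^sub>v ?m $ p = (\<Sum>k<r. \<Sum>l<c. ?u w (k, l) * (N ^\<^sub>m l *\<^sub>v b k) $ p))"
      if "\<And>p. p < ?m \<Longrightarrow> (\<Sum>q<?m. g $$ (p, q) * w q) = 0" for w
    proof (intro conjI allI impI)
      fix p assume p: "p < ?m"
      have "(\<Sum>k<r. \<Sum>l<c. ?u w (k, l) * (N ^\<^sub>m l *\<^sub>v b k) $ p) =
          (\<Sum>k<r. \<Sum>l<c. w (k * c + l) * (N ^\<^sub>m l *\<^sub>v b k) $ p)"
        by (intro sum.cong) auto
      then show "0\<^sub>v ?m $ p = (\<Sum>k<r. \<Sum>l<c. ?u w (k, l) * (N ^\<^sub>m l *\<^sub>v b k) $ p)"
        using exp[OF p, of w] that[OF p] p by simp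
    qed auto
    have PQ: "Q (?u w)" if "\<And>p. p < ?m \<Longrightarrow> (\<Sum>q<?m. g $$ (p, q) * w q) = 0" for w
      unfolding Q_def by (rule P[OF that])
    have "(\<Sum>q<?m. g $$ (p, q) * w $ q) = 0" if "p < ?m" for p
    proof -
      have "(g *\<^sub>v w) $ p = 0" using w(3) that by simp
      then show ?thesis using that g w(1) by (simp add: scalar_prod_def atLeast0LessThan)
    qed
    then have "Q (?u (\<lambda>q. w $ q))" by (rule PQ)
    moreover have "Q (?u (\<lambda>_. 0))" by (rule PQ) simp
    ultimately have eq: "?u (\<lambda>q. w $ q) = ?u (\<lambda>_. 0)" by (rule ex1_unique[OF uniqQ])
    have "w $ q = 0" if q: "q < ?m" for q
    proof -
      have "q div c < r" "q mod c < c"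
        using q by (simp_all add: less_mult_imp_div_less mult.commute) (cases c; simp)
      then show ?thesis using fun_cong[OF eq, of "(q div c, q mod c)"] by simp
    qed
    then have "w = 0\<^sub>v ?m" using w(1) by (intro eq_vecI) auto
    with w(2) show False by blast
  qed
  have Ng: "N * g = g * free_mat c r"
  proof (rule eq_matI)
    fix p q assume "p < dim_row (g * free_mat c r)" "q < dim_col (g * free_mat c r)"
    then have p: "p < ?m" and q: "q < ?m" by (auto simp: g_def free_mat_def)
    have c: "c > 0" using q by (cases c) auto
    have qr: "q div c < r" using q by (simp add: less_mult_imp_div_less mult.commute)
    have colg: "col g q = N ^\<^sub>m (q mod c) *\<^sub>v b (q div c)"
      using q N by (intro eq_vecI) (auto simp: g_def)
    have "N *\<^sub>v (N ^\<^sub>m (q mod c) *\<^sub>v b (q div c)) = N ^\<^sub>m Suc (q mod c) *\<^sub>v b (q div c)"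
    proof -
      have "N ^\<^sub>m Suc (q mod c) = N * N ^\<^sub>m (q mod c)"
        using intertwine_pow[OF N N N refl, of "q mod c"] by simp
      then show ?thesis
        using assoc_mult_mat_vec[OF N pow_carrier_mat[OF N] b[OF qr], of "q mod c"] by simp
    qed
    moreover have "(N * g) $$ (p, q) = (N *\<^sub>v col g q) $ p" using p q N g by simp
    ultimately have "(N * g) $$ (p, q) = (N ^\<^sub>m Suc (q mod c) *\<^sub>v b (q div c)) $ p"
      unfolding colg by simp
    also have "\<dots> = (if q mod c + 1 < c then g $$ (p, q + 1) else 0)"
    proof (cases "q mod c + 1 < c")
      case True
      have m: "(q + 1) mod c = q mod c + 1" "(q + 1) div c = q div c"
        using True by (simp_all add: mod_Suc div_Suc)
      have "q + 1 \<noteq> ?m" using m by auto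
      then have "q + 1 < ?m" using q by simp
      with True m p show ?thesis by (simp add: g_def)
    next
      case False
      then have "Suc (q mod c) = c" using c mod_less_divisor[OF c, of q] by linarith
      then show ?thesis using N0 p b[OF qr] False by simp
    qed
    also have "\<dots> = (g * free_mat c r) $$ (p, q)"
      by (rule mult_free_mat_entry[symmetric, OF g p q])
    finally show "(N * g) $$ (p, q) = (g * free_mat c r) $$ (p, q)" .
  qed (use N in \<open>auto simp: g_def free_mat_def\<close>)
  have h: "minv g \<in> carrier_mat ?m ?m" and hg: "minv g * g = 1\<^sub>m ?m" and gh: "g * minv g = 1\<^sub>m ?m"
    using minv[OF g det] by auto
  have "minv g * N = minv g * N * (g * minv g)" using h N by (simp add: gh)
  also have "\<dots> = minv g * (N * g) * minv g"
    using g h N free_mat_carrier[of c r, where 'a = 'k] by (simp add: assoc_mult_mat[of _ ?m ?m _ ?m _ ?m])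
  also have "\<dots> = (minv g * g) * free_mat c r * minv g"
    unfolding Ng using g h free_mat_carrier[of c r, where 'a = 'k] by (simp add: assoc_mult_mat[of _ ?m ?m _ ?m _ ?m])
  also have "\<dots> = free_mat c r * minv g" unfolding hg by (simp add: free_mat_def)
  finally show ?thesis using h det_minv[OF g det] by blast
qed

text \<open>The intertwiner is the inverse of the conjugating matrix.\<close>

lemma orbit_free_mat_iff:
  assumes N: "N \<in> carrier_mat (c * r) (c * r)"
  shows "N \<in> orbit (GL (c * r)) (\<lambda>g A. g * A * inv\<^bsub>GL (c * r)\<^esub> g) (free_mat c r) \<longleftrightarrow>
    (\<exists>h\<in>carrier_mat (c * r) (c * r). det h \<noteq> 0 \<and> h * N = free_mat c r * (h :: 'k::field mat))"
proof
  let ?m = "c * r"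
  assume "N \<in> orbit (GL ?m) (\<lambda>g A. g * A * inv\<^bsub>GL ?m\<^esub> g) (free_mat c r)"
  then obtain g where g': "g \<in> carrier (GL ?m)" and Ng: "N = g * free_mat c r * inv\<^bsub>GL ?m\<^esub> g"
    unfolding orbit_def by blast
  have g: "g \<in> carrier_mat ?m ?m" "det g \<noteq> 0" using g' by (auto simp: carrier_GL)
  note i = minv_carrier[OF g]
  have FG: "free_mat c r * minv g \<in> carrier_mat ?m ?m" by (rule mult_carrier_mat[OF free_mat_carrier i])
  have "minv g * N = minv g * g * (free_mat c r * minv g)"
    unfolding Ng inv_GL[OF g'] assoc_mult_mat[OF g(1) free_mat_carrier i] assoc_mult_mat[OF i g(1) FG] ..
  then have "minv g * N = free_mat c r * minv g" unfolding minv_mult[OF g] left_mult_one_mat[OF FG] .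
  then show "\<exists>h\<in>carrier_mat ?m ?m. det h \<noteq> 0 \<and> h * N = free_mat c r * h"
    using i det_minv[OF g] by blast
next
  let ?m = "c * r"
  assume "\<exists>h\<in>carrier_mat ?m ?m. det h \<noteq> 0 \<and> h * N = free_mat c r * h"
  then obtain h where h: "h \<in> carrier_mat ?m ?m" "det h \<noteq> 0" and hN: "h * N = free_mat c r * h" by blast
  note i = minv_carrier[OF h]
  have G: "minv h \<in> carrier (GL ?m)" using i det_minv[OF h] by (simp add: carrier_GL)
  have hG: "h \<in> carrier (GL ?m)" using h by (simp add: carrier_GL)
  interpret group "GL ?m :: 'k mat monoid" by (rule group_GL)
  have "inv\<^bsub>GL ?m\<^esub> (minv h) = h" using inv_inv[OF hG] inv_GL[OF hG] by simp
  moreover have "minv h * free_mat c r * h = N"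
  proof -
    have "minv h * free_mat c r * h = minv h * h * N"
      using h i N hN free_mat_carrier[of c r, where 'a = 'k] by (simp add: assoc_mult_mat[of _ ?m ?m _ ?m _ ?m])
    then show ?thesis unfolding minv_mult[OF h] using N by simp
  qed
  ultimately show "N \<in> orbit (GL ?m) (\<lambda>g A. g * A * inv\<^bsub>GL ?m\<^esub> g) (free_mat c r)"
    unfolding orbit_def using G by (intro CollectI exI[of _ "minv h"]) auto
qed

subsection \<open>Homomorphisms of free modules\<close>

text \<open>
  With \<open>y = x^f\<close>, the module \<open>free_mat c r\<close> is free over \<open>K[y]\<close> modulo \<open>y^(c/f)\<close>, with a basis given by
  the indices whose residue modulo \<open>c\<close> is less than \<open>f\<close>.  The columns of \<open>hom_extend\<close> with these
  indices are those of \<open>B\<close>, and the others are determined by compatibility with \<open>P\<close>.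
\<close>

definition hom_extend :: "nat \<Rightarrow> nat \<Rightarrow> nat \<Rightarrow> nat \<Rightarrow> 'k::field mat \<Rightarrow> 'k mat \<Rightarrow> 'k mat" where
  "hom_extend c f n m P B = mat n m (\<lambda>(p, q).
     (P ^\<^sub>m (q mod c div f) * B) $$ (p, q - f * (q mod c div f)))"

lemma hom_extend_carrier [simp]: "hom_extend c f n m P B \<in> carrier_mat n m"
  by (simp add: hom_extend_def)

lemma hom_extend_generator:
  assumes "P \<in> carrier_mat n n" "B \<in> carrier_mat n m" "p < n" "q < m" "q mod c < f"
  shows "hom_extend c f n m P B $$ (p, q) = (B :: 'k::field mat) $$ (p, q)"
  using assms by (simp add: hom_extend_def)

text \<open>Multiplication by P raises the exponent of a column by one, which gives the column f
  places further on in its block. At the end of the block the exponent reaches k = c / f, where the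
  power of P is 0, as is the column on the other side.\<close>

lemma hom_extend_commute:
  assumes P: "P \<in> carrier_mat n n" and B: "B \<in> carrier_mat n (c * r)"
    and c: "c = k * f" and f: "f > 0" and P0: "P ^\<^sub>m k = 0\<^sub>m n n"
  shows "P * hom_extend c f n (c * r) P B = hom_extend c f n (c * r) P B * (free_mat c r ^\<^sub>m f :: 'k::field mat)"
proof (rule eq_matI)
  let ?m = "c * r" and ?E = "hom_extend c f n (c * r) P B"
  fix p q assume "p < dim_row (?E * free_mat c r ^\<^sub>m f)" "q < dim_col (?E * free_mat c r ^\<^sub>m f)"
  moreover have "dim_row (?E * free_mat c r ^\<^sub>m f) = n" "dim_col (?E * free_mat c r ^\<^sub>m f) = ?m"
    by (simp_all add: hom_extend_def free_mat_def)
  ultimately have p: "p < n" and q: "q < ?m" by simp_all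
  define s where "s = q mod c div f"
  define q0 where "q0 = q - f * s"
  have q0: "q0 < ?m" using q by (simp add: q0_def)
  have Ps: "P ^\<^sub>m s * B \<in> carrier_mat n ?m" by (rule mult_carrier_mat[OF pow_carrier_mat[OF P] B])
  have "(P * ?E) $$ (p, q) = (\<Sum>l<n. P $$ (p, l) * ?E $$ (l, q))"
    by (rule mat_mult_entry[OF P _ p q]) simp
  also have "\<dots> = (\<Sum>l<n. P $$ (p, l) * (P ^\<^sub>m s * B) $$ (l, q0))"
    using q by (intro sum.cong) (auto simp: hom_extend_def s_def q0_def)
  also have "\<dots> = (P * (P ^\<^sub>m s * B)) $$ (p, q0)"
    by (rule mat_mult_entry[symmetric, OF P Ps p q0])
  also have "P * (P ^\<^sub>m s * B) = P ^\<^sub>m Suc s * B"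
    using intertwine_pow[OF P P P refl, of s] assoc_mult_mat[OF P pow_carrier_mat[OF P] B, of s] by simp
  also have "(P ^\<^sub>m Suc s * B) $$ (p, q0) = (if q mod c + f < c then ?E $$ (p, q + f) else 0)"
  proof (cases "q mod c + f < c")
    case True
    then have m: "(q + f) mod c = q mod c + f" by (metis mod_add_left_eq mod_less)
    then have s: "(q + f) mod c div f = Suc s" using f by (simp add: s_def)
    have "q + f < ?m"
    proof -
      have "q + f = c * (q div c) + (q mod c + f)" by simp
      moreover have "q div c < r" using q by (simp add: less_mult_imp_div_less mult.commute)
      ultimately show ?thesis using block_index_less[OF _ True, of "q div c" r] by (simp add: mult.commute)
    qed
    moreover have "q + f - f * Suc s = q0" by (simp add: q0_def)
    ultimately show ?thesis using True p s by (simp add: hom_extend_def)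
  next
    case False
    have cpos: "c > 0" using q by (cases c) auto
    have "s < k" using mod_less_divisor[OF cpos, of q] c f
      by (simp add: s_def less_mult_imp_div_less)
    moreover have "k - 1 \<le> s"
    proof -
      have "(k - 1) * f \<le> q mod c" using False c by (simp add: diff_mult_distrib)
      then have "(k - 1) * f div f \<le> q mod c div f" by (rule div_le_mono)
      then show ?thesis using f by (simp add: s_def)
    qed
    ultimately have "Suc s = k" by linarith
    then show ?thesis using False P0 B p q0 by simp
  qed
  also have "\<dots> = (?E * free_mat c r ^\<^sub>m f) $$ (p, q)"
    by (rule mult_free_mat_pow_entry[symmetric, OF _ p q]) simp
  finally show "(P * ?E) $$ (p, q) = (?E * free_mat c r ^\<^sub>m f) $$ (p, q)" .
qed (use P in \<open>simp_all add: hom_extend_def free_mat_def\<close>)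

text \<open>By the commutation rule, the column q + f s of E is P^s times the column q as long as
  both lie in one block; so the columns with residue below f determine E.\<close>

lemma hom_extend_unique:
  assumes P: "P \<in> carrier_mat n n" and B: "B \<in> carrier_mat n (c * r)" and E: "E \<in> carrier_mat n (c * r)"
    and c: "f dvd c" and f: "f > 0"
    and PE: "P * E = E * free_mat c r ^\<^sub>m f"
    and EB: "\<And>p q. p < n \<Longrightarrow> q < c * r \<Longrightarrow> q mod c < f \<Longrightarrow> E $$ (p, q) = B $$ (p, q)"
  shows "hom_extend c f n (c * r) P B = (E :: 'k::field mat)"
proof (rule eq_matI)
  let ?m = "c * r"
  fix p q assume "p < dim_row E" "q < dim_col E"
  with E have p: "p < n" and q: "q < ?m" by auto
  have *: "(P ^\<^sub>m s * E) $$ (p, q) = (if q mod c + f * s < c then E $$ (p, q + f * s) else 0)"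
    if "p < n" "q < ?m" for s p q
    using that
  proof (induction s arbitrary: q)
    case 0
    moreover have "q mod c < c" using 0 by (cases c) auto
    ultimately show ?case using E P by simp
  next
    case (Suc s)
    have Es: "P ^\<^sub>m s * E \<in> carrier_mat n ?m" by (rule mult_carrier_mat[OF pow_carrier_mat[OF P] E])
    have "P ^\<^sub>m Suc s * E = P ^\<^sub>m s * (E * free_mat c r ^\<^sub>m f)"
      using assoc_mult_mat[OF pow_carrier_mat[OF P] P E, of s] PE by simp
    also have "\<dots> = P ^\<^sub>m s * E * free_mat c r ^\<^sub>m f"
      by (rule assoc_mult_mat[symmetric, OF pow_carrier_mat[OF P] E pow_carrier_mat[OF free_mat_carrier]])
    finally have "(P ^\<^sub>m Suc s * E) $$ (p, q) =
        (if q mod c + f < c then (P ^\<^sub>m s * E) $$ (p, q + f) else 0)"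
      using mult_free_mat_pow_entry[OF Es Suc.prems, of f] by simp
    also have "\<dots> = (if q mod c + f * Suc s < c then E $$ (p, q + f * Suc s) else 0)"
    proof (cases "q mod c + f < c")
      case True
      then have m: "(q + f) mod c = q mod c + f" by (metis mod_add_left_eq mod_less)
      have "q + f = c * (q div c) + (q mod c + f)" by simp
      moreover have "q div c < r" using Suc.prems by (simp add: less_mult_imp_div_less mult.commute)
      ultimately have "q + f < ?m"
        using block_index_less[OF _ True, of "q div c" r] by (simp add: mult.commute)
      with Suc.IH[OF Suc.prems(1) this] True m show ?thesis by (simp add: algebra_simps)
    qed auto
    finally show ?case .
  qed
  define s where "s = q mod c div f"
  \<comment> \<open>The column of the same block with residue \<open>q mod c mod f\<close>, from
    which s steps of length f lead to q.\<close>
  define q0 where "q0 = q - f * s"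
  have le: "f * s \<le> q mod c" by (simp add: s_def)
  have "q mod c \<le> q" by simp
  with le have "f * s \<le> q" by (rule order_trans)
  then have qq0: "q = q0 + f * s" by (simp add: q0_def)
  have q0: "q0 < ?m" using q by (simp add: q0_def)
  have cpos: "c > 0" using q by (cases c) auto
  have q0m: "q0 mod c = q mod c - f * s"
  proof -
    have "q0 = c * (q div c) + (q mod c - f * s)"
      using le by (simp add: q0_def)
    moreover have "q mod c - f * s < c" using cpos by (meson le_less_trans diff_le_self mod_less_divisor)
    ultimately show ?thesis by simp
  qed
  also have "\<dots> = q mod c mod f" by (simp add: s_def minus_mult_div_eq_mod)
  finally have q0f: "q0 mod c < f" using f by simp
  have "hom_extend c f n ?m P B $$ (p, q) = (P ^\<^sub>m s * B) $$ (p, q0)"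
    using p q by (simp add: hom_extend_def s_def q0_def)
  also have "\<dots> = (\<Sum>l<n. (P ^\<^sub>m s) $$ (p, l) * B $$ (l, q0))"
    by (rule mat_mult_entry[OF pow_carrier_mat[OF P] B p q0])
  also have "\<dots> = (\<Sum>l<n. (P ^\<^sub>m s) $$ (p, l) * E $$ (l, q0))"
    using EB[OF _ q0 q0f] by (intro sum.cong) auto
  also have "\<dots> = (P ^\<^sub>m s * E) $$ (p, q0)"
    by (rule mat_mult_entry[symmetric, OF pow_carrier_mat[OF P] E p q0])
  also have "\<dots> = E $$ (p, q)"
    unfolding *[OF p q0] using q0m le qq0 mod_less_divisor[OF cpos, of q] by simp
  finally show "hom_extend c f n ?m P B $$ (p, q) = E $$ (p, q)" .
qed (use E in \<open>auto simp: hom_extend_def\<close>)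

section \<open>Locally free representations\<close>

lemma gg_ff: "gg C i j * ff C i j = nat \<bar>C i j\<bar>"
proof -
  have "gcd (C i j) (C j i) dvd C i j" by simp
  then have "\<bar>gcd (C i j) (C j i)\<bar> dvd \<bar>C i j\<bar>" by (simp only: dvd_abs_iff abs_dvd_iff)
  then have "gg C i j dvd nat \<bar>C i j\<bar>" unfolding gg_def by (simp add: nat_dvd_iff)
  then show ?thesis by (simp add: ff_def)
qed

text \<open>The assumptions hold for the empty set of arrows as well, and this instance describes
  the base of the bundle, the orbit of the loops. The number k is the common nilpotency order of the
  f_ji-th power of the loop at i and the f_ij-th power of the loop at j.\<close>

locale lf_data =
  fixes n :: nat and C :: "nat \<Rightarrow> nat \<Rightarrow> int" and c r d :: "nat \<Rightarrow> nat" and \<Omega> :: "(nat \<times> nat) set"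
  assumes c_pos: "i \<in> {1..n} \<Longrightarrow> c i > 0"
    and \<Omega>_vertices: "(i, j) \<in> \<Omega> \<Longrightarrow> i \<in> {1..n} \<and> j \<in> {1..n}"
    and \<Omega>_exponents: "(i, j) \<in> \<Omega> \<Longrightarrow> \<exists>k. c i = k * ff C j i \<and> c j = k * ff C i j \<and> ff C i j > 0"
    and d_eq: "d i = c i * r i"
begin

abbreviation X :: "rep_coord set" where "X \<equiv> rep_coords n C \<Omega> d"

abbreviation is_arrow :: "nat \<Rightarrow> nat \<Rightarrow> nat \<Rightarrow> bool" where
  "is_arrow i j g \<equiv> (i, j) \<in> \<Omega> \<and> g \<in> {1..gg C i j}"

lemma finite_\<Omega>: "finite \<Omega>"
proof -
  have "\<Omega> \<subseteq> {1..n} \<times> {1..n}" using \<Omega>_vertices by auto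
  then show ?thesis by (rule finite_subset) simp
qed

lemma Eps_X: "(Eps i, p, q) \<in> X \<longleftrightarrow> i \<in> {1..n} \<and> p < d i \<and> q < d i"
  by (auto simp: rep_coords_def entries_def arrows_def)

lemma Alpha_X: "(Alpha i j g, p, q) \<in> X \<longleftrightarrow> is_arrow i j g \<and> p < d i \<and> q < d j"
  by (auto simp: rep_coords_def entries_def arrows_def)

lemma Eps_loop: "(Eps i, p, q) \<in> loop_coords n d \<longleftrightarrow> i \<in> {1..n} \<and> p < d i \<and> q < d i"
  by (auto simp: loop_coords_def entries_def)

lemma Alpha_loop: "(Alpha i j g, p, q) \<notin> loop_coords n d"
  by (auto simp: loop_coords_def entries_def)

lemma loop_subset_X: "loop_coords n d \<subseteq> X"
  by (auto simp: rep_coords_def loop_coords_def entries_def arrows_def)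

lemma finite_X: "finite X"
proof -
  define D where "D = (\<Sum>i\<in>{1..n}. d i)"
  have D: "d i \<le> D" if "i \<in> {1..n}" for i unfolding D_def using that by (intro member_le_sum) auto
  have "finite (arrows n C \<Omega>)"
  proof -
    have "arrows n C \<Omega> \<subseteq> Eps ` {1..n} \<union> (\<Union>(i, j)\<in>\<Omega>. Alpha i j ` {1..gg C i j})"
      unfolding arrows_def by auto
    then show ?thesis by (rule finite_subset) (use finite_\<Omega> in auto)
  qed
  moreover have "X \<subseteq> arrows n C \<Omega> \<times> {..<D} \<times> {..<D}"
  proof
    fix z assume z: "z \<in> X"
    obtain a p q where e: "z = (a, p, q)" by (cases z) auto
    show "z \<in> arrows n C \<Omega> \<times> {..<D} \<times> {..<D}"
    proof (cases a)
      case (Eps i)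
      then show ?thesis using z D[of i] unfolding e by (auto simp: Eps_X arrows_def)
    next
      case (Alpha i j g)
      then have "is_arrow i j g" "p < d i" "q < d j" using z unfolding e by (auto simp: Alpha_X)
      then show ?thesis using \<Omega>_vertices[of i j] D[of i] D[of j] Alpha e by (auto simp: arrows_def)
    qed
  qed
  ultimately show ?thesis by (meson finite_SigmaI finite_lessThan finite_subset)
qed

lemma arrow_mat_carrier: "arrow_mat d M (Eps i) \<in> carrier_mat (d i) (d i)"
  "arrow_mat d M (Alpha i j g) \<in> carrier_mat (d i) (d j)"
  by (simp_all add: arrow_mat_def)

lemma arrow_mat_entry: "p < d i \<Longrightarrow> q < d i \<Longrightarrow> arrow_mat d M (Eps i) $$ (p, q) = M (Eps i, p, q)"
  "p < d i \<Longrightarrow> q < d j \<Longrightarrow> arrow_mat d M (Alpha i j g) $$ (p, q) = M (Alpha i j g, p, q)"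
  by (simp_all add: arrow_mat_def)

definition of_mats :: "(arrow \<Rightarrow> 'k::field mat) \<Rightarrow> rep_coord \<Rightarrow> 'k" where
  "of_mats A = (\<lambda>(a, p, q). if (a, p, q) \<in> X then A a $$ (p, q) else 0)"

lemma of_mats_affine: "of_mats A \<in> affine_space X"
  by (auto simp: of_mats_def affine_space_def)

lemma arrow_mat_of_mats:
  "i \<in> {1..n} \<Longrightarrow> A (Eps i) \<in> carrier_mat (d i) (d i) \<Longrightarrow> arrow_mat d (of_mats A) (Eps i) = A (Eps i)"
  "is_arrow i j g \<Longrightarrow> A (Alpha i j g) \<in> carrier_mat (d i) (d j) \<Longrightarrow>
    arrow_mat d (of_mats A) (Alpha i j g) = A (Alpha i j g)"
  by (auto simp: arrow_mat_def of_mats_def Eps_X Alpha_X intro!: eq_matI)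

lemma of_mats_eqI:
  assumes M: "M \<in> affine_space X"
    and "\<And>i. i \<in> {1..n} \<Longrightarrow> A (Eps i) = arrow_mat d M (Eps i)"
    and "\<And>i j g. is_arrow i j g \<Longrightarrow> A (Alpha i j g) = arrow_mat d M (Alpha i j g)"
  shows "of_mats A = M"
proof
  fix z :: rep_coord
  obtain a p q where z: "z = (a, p, q)" by (cases z) auto
  show "of_mats A z = M z"
  proof (cases "z \<in> X")
    case True
    then show ?thesis unfolding z
      by (cases a) (auto simp: of_mats_def Eps_X Alpha_X assms(2,3) arrow_mat_entry)
  next
    case False
    then show ?thesis using M by (auto simp: of_mats_def z affine_space_def)
  qed
qed

lemma rep_H_iff: "M \<in> rep_H n C c \<Omega> d \<longleftrightarrow> M \<in> affine_space X \<and>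
  (\<forall>i\<in>{1..n}. arrow_mat d M (Eps i) ^\<^sub>m c i = 0\<^sub>m (d i) (d i)) \<and>
  (\<forall>i j g. is_arrow i j g \<longrightarrow>
     arrow_mat d M (Eps i) ^\<^sub>m ff C j i * arrow_mat d M (Alpha i j g) =
     arrow_mat d M (Alpha i j g) * arrow_mat d M (Eps j) ^\<^sub>m ff C i j)"
  unfolding rep_H_def by auto

text \<open>The rows of h are the coordinate functions of a basis of M_i on which the loop acts by
  the standard matrix.\<close>

definition intertwiner :: "nat \<Rightarrow> 'k::field mat \<Rightarrow> 'k mat \<Rightarrow> bool" where
  "intertwiner i N h \<longleftrightarrow> h \<in> carrier_mat (d i) (d i) \<and> det h \<noteq> 0 \<and> h * N = free_mat (c i) (r i) * h"

lemma rep_lf_iff: "M \<in> rep_lf n C c \<Omega> r \<longleftrightarrow> M \<in> rep_H n C c \<Omega> d \<and>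
  (\<forall>i\<in>{1..n}. \<exists>h. intertwiner i (arrow_mat d M (Eps i)) h)"
proof -
  have d: "(\<lambda>i. c i * r i) = d" by (simp add: d_eq fun_eq_iff)
  have "free_of_rank (c i) (d i) (arrow_mat d M (Eps i)) (r i) \<longleftrightarrow>
      (\<exists>h. intertwiner i (arrow_mat d M (Eps i)) h)"
    if i: "i \<in> {1..n}" and M: "M \<in> rep_H n C c \<Omega> d" for i
  proof
    assume "free_of_rank (c i) (d i) (arrow_mat d M (Eps i)) (r i)"
    then show "\<exists>h. intertwiner i (arrow_mat d M (Eps i)) h"
      using free_of_rank_imp_intertwine[of "arrow_mat d M (Eps i)" "c i" "r i"]
        arrow_mat_carrier(1)[of M i] M i
      unfolding intertwiner_def rep_H_iff d_eq by blast
  next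
    assume "\<exists>h. intertwiner i (arrow_mat d M (Eps i)) h"
    then show "free_of_rank (c i) (d i) (arrow_mat d M (Eps i)) (r i)"
      using free_of_rank_intertwine[of "arrow_mat d M (Eps i)" "c i" "r i"] arrow_mat_carrier(1)[of M i]
      unfolding intertwiner_def d_eq by blast
  qed
  then show ?thesis unfolding rep_lf_def Let_def d by blast
qed

lemma orbit_free_iff: "x \<in> orbit_free n c r \<longleftrightarrow> x \<in> affine_space (loop_coords n d) \<and>
  (\<forall>i\<in>{1..n}. \<exists>h. intertwiner i (arrow_mat d x (Eps i)) h)"
proof -
  have d: "(\<lambda>i. c i * r i) = d" by (simp add: d_eq fun_eq_iff)
  have "arrow_mat d x (Eps i) \<in> orbit (GL (d i)) (\<lambda>g A. g * A * inv\<^bsub>GL (d i)\<^esub> g) (free_mat (c i) (r i))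
      \<longleftrightarrow> (\<exists>h. intertwiner i (arrow_mat d x (Eps i)) h)" for i
    using orbit_free_mat_iff[of "arrow_mat d x (Eps i)" "c i" "r i"] arrow_mat_carrier(1)[of x i]
    unfolding intertwiner_def d_eq by blast
  then show ?thesis unfolding orbit_free_def Let_def d by simp
qed

lemma intertwiner_minv:
  assumes "intertwiner i N h" "N \<in> carrier_mat (d i) (d i)"
  shows "minv h * free_mat (c i) (r i) * h = N"
proof -
  have h: "h \<in> carrier_mat (d i) (d i)" "det h \<noteq> 0" "h * N = free_mat (c i) (r i) * h"
    using assms(1) by (auto simp: intertwiner_def)
  have F: "free_mat (c i) (r i) \<in> carrier_mat (d i) (d i)" by (simp add: d_eq)
  note m = minv_carrier[OF h(1,2)]
  show ?thesis
    unfolding assoc_mult_mat[OF m F h(1)] h(3)[symmetric] assoc_mult_mat[OF m h(1) assms(2), symmetric]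
      minv_mult[OF h(1,2)] left_mult_one_mat[OF assms(2)] ..
qed

lemma intertwinerI:
  assumes h: "h \<in> carrier_mat (d i) (d i)" "det h \<noteq> 0"
  shows "intertwiner i (minv h * free_mat (c i) (r i) * h) h"
    and "minv h * free_mat (c i) (r i) * h \<in> carrier_mat (d i) (d i)"
proof -
  have F: "free_mat (c i) (r i) \<in> carrier_mat (d i) (d i)" by (simp add: d_eq)
  note m = minv_carrier[OF h]
  have Fh: "free_mat (c i) (r i) * h \<in> carrier_mat (d i) (d i)" by (rule mult_carrier_mat[OF F h(1)])
  have "h * (minv h * free_mat (c i) (r i) * h) = h * minv h * (free_mat (c i) (r i) * h)"
    unfolding assoc_mult_mat[OF m F h(1)] assoc_mult_mat[OF h(1) m Fh] ..
  then show "intertwiner i (minv h * free_mat (c i) (r i) * h) h"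
    unfolding intertwiner_def mult_minv[OF h] left_mult_one_mat[OF Fh] using h by blast
  show "minv h * free_mat (c i) (r i) * h \<in> carrier_mat (d i) (d i)"
    by (rule mult_carrier_mat[OF mult_carrier_mat[OF m F] h(1)])
qed

text \<open>
  The representation with loops \<open>N\<close>, given bases in which the loops become \<open>free_mat\<close> (with the
  coordinates \<open>h\<close>), and the images \<open>s\<close> of the generators of \<open>M\<^sub>j\<close> over \<open>K[\<epsilon>\<^sub>j^f\<^sub>i\<^sub>j]\<close>.
\<close>

definition rep_mats :: "(nat \<Rightarrow> 'k::field mat) \<Rightarrow> (nat \<Rightarrow> 'k mat) \<Rightarrow> (rep_coord \<Rightarrow> 'k) \<Rightarrow> arrow \<Rightarrow> 'k mat" where
  "rep_mats N h s a = (case a of Eps i \<Rightarrow> N i | Alpha i j g \<Rightarrow>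
     hom_extend (c j) (ff C i j) (d i) (d j) (N i ^\<^sub>m ff C j i) (arrow_mat d s (Alpha i j g)) * h j)"

definition build_rep :: "(nat \<Rightarrow> 'k::field mat) \<Rightarrow> (nat \<Rightarrow> 'k mat) \<Rightarrow> (rep_coord \<Rightarrow> 'k) \<Rightarrow> rep_coord \<Rightarrow> 'k" where
  "build_rep N h s = of_mats (rep_mats N h s)"

text \<open>The residue condition selects the generators of M_j over the subring of f_ij-th powers
  of the loop; the entries of their images under the arrows are independent coordinates.\<close>

definition alpha_coords :: "rep_coord set" where
  "alpha_coords = {(Alpha i j g, p, q) | i j g p q. is_arrow i j g \<and> p < d i \<and> q < d j \<and> q mod c j < ff C i j}"

lemma Alpha_alpha: "(Alpha i j g, p, q) \<in> alpha_coords \<longleftrightarrow>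
    is_arrow i j g \<and> p < d i \<and> q < d j \<and> q mod c j < ff C i j"
  by (auto simp: alpha_coords_def)

lemma Eps_alpha: "(Eps i, p, q) \<notin> alpha_coords"
  by (auto simp: alpha_coords_def)

lemma alpha_subset_X: "alpha_coords \<subseteq> X"
  by (auto simp: alpha_coords_def Alpha_X)

lemma finite_alpha: "finite alpha_coords"
  using finite_X alpha_subset_X by (rule finite_subset[rotated])

lemma exponentsE:
  assumes "(i, j) \<in> \<Omega>"
  obtains k where "c i = ff C j i * k" "c j = k * ff C i j" "ff C i j > 0"
  using \<Omega>_exponents[OF assms] by (metis mult.commute)

text \<open>With respect to h, an arrow is a matrix E that intertwines the f_ij-th power of the
  standard matrix F with the f_ji-th power of N_i; multiplying E by h_j replaces F by N_j and gives
  the relation. The extension to E is consistent because c_i = k f_ji makes the k-th power of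
  N_i^f_ji vanish.\<close>

lemma build_rep:
  assumes N: "\<And>i. i \<in> {1..n} \<Longrightarrow> N i \<in> carrier_mat (d i) (d i)"
    and h: "\<And>i. i \<in> {1..n} \<Longrightarrow> intertwiner i (N i) (h i)"
  shows build_rep_lf: "build_rep N h s \<in> rep_lf n C c \<Omega> r"
    and build_rep_Eps: "i \<in> {1..n} \<Longrightarrow> arrow_mat d (build_rep N h s) (Eps i) = N i"
    and build_rep_Alpha: "is_arrow i j g \<Longrightarrow> arrow_mat d (build_rep N h s) (Alpha i j g) * minv (h j) =
      hom_extend (c j) (ff C i j) (d i) (d j) (N i ^\<^sub>m ff C j i) (arrow_mat d s (Alpha i j g))"
proof -
  let ?M = "build_rep N h s"
  define E where "E i j g =
    hom_extend (c j) (ff C i j) (d i) (d j) (N i ^\<^sub>m ff C j i) (arrow_mat d s (Alpha i j g))" for i j g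
  have E: "E i j g \<in> carrier_mat (d i) (d j)" for i j g by (simp add: E_def)
  have hc: "h i \<in> carrier_mat (d i) (d i)" and hd: "det (h i) \<noteq> 0"
    and hN: "h i * N i = free_mat (c i) (r i) * h i" if "i \<in> {1..n}" for i
    using h[OF that] by (auto simp: intertwiner_def)
  have Eps: "arrow_mat d ?M (Eps i) = N i" if "i \<in> {1..n}" for i
    using arrow_mat_of_mats(1)[OF that, of "rep_mats N h s"] N[OF that]
    by (simp add: build_rep_def rep_mats_def)
  have Alpha: "arrow_mat d ?M (Alpha i j g) = E i j g * h j" if "is_arrow i j g" for i j g
  proof -
    have "j \<in> {1..n}" using \<Omega>_vertices that by blast
    then have "E i j g * h j \<in> carrier_mat (d i) (d j)" using E hc by (intro mult_carrier_mat) auto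
    then show ?thesis
      using arrow_mat_of_mats(2)[OF that, of "rep_mats N h s"] by (simp add: build_rep_def rep_mats_def E_def)
  qed
  show "i \<in> {1..n} \<Longrightarrow> arrow_mat d ?M (Eps i) = N i" by (rule Eps)
  show "arrow_mat d ?M (Alpha i j g) * minv (h j) =
      hom_extend (c j) (ff C i j) (d i) (d j) (N i ^\<^sub>m ff C j i) (arrow_mat d s (Alpha i j g))"
    if a: "is_arrow i j g"
  proof -
    have j: "j \<in> {1..n}" using \<Omega>_vertices a by blast
    have "E i j g * h j * minv (h j) = E i j g * (h j * minv (h j))"
      by (rule assoc_mult_mat[OF E hc[OF j] minv_carrier[OF hc[OF j] hd[OF j]]])
    also have "\<dots> = E i j g"
      unfolding mult_minv[OF hc[OF j] hd[OF j]] by (rule right_mult_one_mat[OF E])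
    finally show ?thesis using Alpha[OF a] by (simp add: E_def)
  qed
  have nil: "N i ^\<^sub>m c i = 0\<^sub>m (d i) (d i)" if "i \<in> {1..n}" for i
    using intertwine_nilpotent[of "h i" "c i" "r i" "N i"] hc[OF that] hd[OF that] N[OF that] hN[OF that]
    unfolding d_eq by blast
  have rel: "N i ^\<^sub>m ff C j i * (E i j g * h j) = E i j g * h j * N j ^\<^sub>m ff C i j" if a: "is_arrow i j g" for i j g
  proof -
    have i: "i \<in> {1..n}" and j: "j \<in> {1..n}" using \<Omega>_vertices a by blast+
    obtain k where k: "c i = ff C j i * k" "c j = k * ff C i j" "ff C i j > 0" using exponentsE a by metis
    have P: "N i ^\<^sub>m ff C j i \<in> carrier_mat (d i) (d i)" by (rule pow_carrier_mat[OF N[OF i]])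
    have F: "free_mat (c j) (r j) \<in> carrier_mat (d j) (d j)" by (simp add: d_eq)
    have Ff: "free_mat (c j) (r j) ^\<^sub>m ff C i j \<in> carrier_mat (d j) (d j)" by (rule pow_carrier_mat[OF F])
    have "(N i ^\<^sub>m ff C j i) ^\<^sub>m k = N i ^\<^sub>m (ff C j i * k)" by (rule pow_mat_mult[OF N[OF i]])
    then have P0: "(N i ^\<^sub>m ff C j i) ^\<^sub>m k = 0\<^sub>m (d i) (d i)" using nil[OF i] k(1) by simp
    have "N i ^\<^sub>m ff C j i * E i j g = E i j g * free_mat (c j) (r j) ^\<^sub>m ff C i j"
      unfolding E_def d_eq[of j]
      by (rule hom_extend_commute[OF P _ k(2,3) P0]) (use arrow_mat_carrier(2)[of s i j g] in \<open>simp add: d_eq\<close>)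
    then have "N i ^\<^sub>m ff C j i * (E i j g * h j) = E i j g * free_mat (c j) (r j) ^\<^sub>m ff C i j * h j"
      by (simp only: assoc_mult_mat[symmetric, OF P E hc[OF j]])
    also have "\<dots> = E i j g * (free_mat (c j) (r j) ^\<^sub>m ff C i j * h j)"
      by (rule assoc_mult_mat[OF E Ff hc[OF j]])
    also have "\<dots> = E i j g * (h j * N j ^\<^sub>m ff C i j)"
      using intertwine_pow[OF hc[OF j] N[OF j] F hN[OF j], of "ff C i j"] by simp
    also have "\<dots> = E i j g * h j * N j ^\<^sub>m ff C i j"
      by (rule assoc_mult_mat[symmetric, OF E hc[OF j] pow_carrier_mat[OF N[OF j]]])
    finally show ?thesis .
  qed
  have "?M \<in> rep_H n C c \<Omega> d"
    unfolding rep_H_iff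
  proof (intro conjI ballI allI impI)
    show "?M \<in> affine_space X" unfolding build_rep_def by (rule of_mats_affine)
    show "arrow_mat d ?M (Eps i) ^\<^sub>m c i = 0\<^sub>m (d i) (d i)" if "i \<in> {1..n}" for i
      unfolding Eps[OF that] by (rule nil[OF that])
    fix i j g assume a: "is_arrow i j g"
    have i: "i \<in> {1..n}" and j: "j \<in> {1..n}" using \<Omega>_vertices a by blast+
    show "arrow_mat d ?M (Eps i) ^\<^sub>m ff C j i * arrow_mat d ?M (Alpha i j g) =
        arrow_mat d ?M (Alpha i j g) * arrow_mat d ?M (Eps j) ^\<^sub>m ff C i j"
      unfolding Eps[OF i] Eps[OF j] Alpha[OF a] by (rule rel[OF a])
  qed
  then show "?M \<in> rep_lf n C c \<Omega> r"
    unfolding rep_lf_iff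
  proof (intro conjI ballI)
    fix i assume i: "i \<in> {1..n}"
    show "\<exists>h. intertwiner i (arrow_mat d ?M (Eps i)) h" unfolding Eps[OF i] using h[OF i] by blast
  qed
qed

text \<open>Conversely, the matrix of an arrow of M times the inverse of h_j commutes in the same
  way, so \<open>hom_extend_unique\<close> recovers it from its generator columns.\<close>

lemma build_rep_eqI:
  assumes M: "M \<in> rep_H n C c \<Omega> d"
    and N: "\<And>i. i \<in> {1..n} \<Longrightarrow> N i = arrow_mat d M (Eps i)"
    and h: "\<And>i. i \<in> {1..n} \<Longrightarrow> intertwiner i (N i) (h i)"
    and s: "\<And>i j g p q. (Alpha i j g, p, q) \<in> alpha_coords \<Longrightarrow>
      s (Alpha i j g, p, q) = (arrow_mat d M (Alpha i j g) * minv (h j)) $$ (p, q)"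
  shows "build_rep N h s = M"
  unfolding build_rep_def
proof (rule of_mats_eqI)
  show "M \<in> affine_space X" using M by (simp add: rep_H_iff)
  show "rep_mats N h s (Eps i) = arrow_mat d M (Eps i)" if "i \<in> {1..n}" for i
    using N[OF that] by (simp add: rep_mats_def)
  fix i j g assume a: "is_arrow i j g"
  have i: "i \<in> {1..n}" and j: "j \<in> {1..n}" using \<Omega>_vertices a by blast+
  have hc: "h j \<in> carrier_mat (d j) (d j)" "det (h j) \<noteq> 0"
    using h[OF j] by (auto simp: intertwiner_def)
  note mc = minv_carrier[OF hc]
  let ?A = "arrow_mat d M (Alpha i j g)" and ?P = "N i ^\<^sub>m ff C j i"
  note A = arrow_mat_carrier(2)[of M i j g]
  have Nc: "N i \<in> carrier_mat (d i) (d i)" "N j \<in> carrier_mat (d j) (d j)"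
    using N[OF i] N[OF j] arrow_mat_carrier(1) by auto
  have P: "?P \<in> carrier_mat (d i) (d i)" by (rule pow_carrier_mat[OF Nc(1)])
  have F: "free_mat (c j) (r j) \<in> carrier_mat (d j) (d j)" by (simp add: d_eq)
  have E: "?A * minv (h j) \<in> carrier_mat (d i) (c j * r j)" using mult_carrier_mat[OF A mc] by (simp add: d_eq)
  obtain k where k: "c i = ff C j i * k" "c j = k * ff C i j" "ff C i j > 0" using exponentsE a by metis
  have mN: "minv (h j) * free_mat (c j) (r j) = N j * minv (h j)"
  proof -
    have "minv (h j) * free_mat (c j) (r j) = minv (h j) * free_mat (c j) (r j) * (h j * minv (h j))"
      unfolding mult_minv[OF hc] using right_mult_one_mat[OF mult_carrier_mat[OF mc F]] by simp
    also have "\<dots> = minv (h j) * free_mat (c j) (r j) * h j * minv (h j)"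
      by (rule assoc_mult_mat[symmetric, OF mult_carrier_mat[OF mc F] hc(1) mc])
    finally show ?thesis unfolding intertwiner_minv[OF h[OF j] Nc(2)] .
  qed
  have PE: "?P * (?A * minv (h j)) = ?A * minv (h j) * free_mat (c j) (r j) ^\<^sub>m ff C i j"
  proof -
    have "?P * (?A * minv (h j)) = ?P * ?A * minv (h j)" by (rule assoc_mult_mat[symmetric, OF P A mc])
    also have "?P * ?A = ?A * N j ^\<^sub>m ff C i j"
      using M a N[OF i] N[OF j] by (simp add: rep_H_iff)
    also have "?A * N j ^\<^sub>m ff C i j * minv (h j) = ?A * (N j ^\<^sub>m ff C i j * minv (h j))"
      by (rule assoc_mult_mat[OF A pow_carrier_mat[OF Nc(2)] mc])
    also have "N j ^\<^sub>m ff C i j * minv (h j) = minv (h j) * free_mat (c j) (r j) ^\<^sub>m ff C i j"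
      by (rule intertwine_pow[symmetric, OF mc F Nc(2) mN])
    also have "?A * (minv (h j) * free_mat (c j) (r j) ^\<^sub>m ff C i j) =
        ?A * minv (h j) * free_mat (c j) (r j) ^\<^sub>m ff C i j"
      by (rule assoc_mult_mat[symmetric, OF A mc pow_carrier_mat[OF F]])
    finally show ?thesis .
  qed
  have "hom_extend (c j) (ff C i j) (d i) (c j * r j) ?P (arrow_mat d s (Alpha i j g)) = ?A * minv (h j)"
  proof (rule hom_extend_unique[OF P _ E _ k(3) PE])
    show "arrow_mat d s (Alpha i j g) \<in> carrier_mat (d i) (c j * r j)"
      using arrow_mat_carrier(2)[of s i j g] by (simp add: d_eq)
    show "ff C i j dvd c j" using k(2) by simp
    fix p q assume "p < d i" "q < c j * r j" "q mod c j < ff C i j"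
    then show "(?A * minv (h j)) $$ (p, q) = arrow_mat d s (Alpha i j g) $$ (p, q)"
      using s[of i j g p q] a by (simp add: Alpha_alpha arrow_mat_entry d_eq)
  qed
  then have "rep_mats N h s (Alpha i j g) = ?A * minv (h j) * h j"
    by (simp add: rep_mats_def d_eq)
  also have "\<dots> = ?A * (minv (h j) * h j)" by (rule assoc_mult_mat[OF A mc hc(1)])
  also have "\<dots> = ?A" unfolding minv_mult[OF hc] by (rule right_mult_one_mat[OF A])
  finally show "rep_mats N h s (Alpha i j g) = ?A" .
qed

subsection \<open>Rationality\<close>

lemma rat_mat_Eps:
  "i \<in> {1..n} \<Longrightarrow> loop_coords n d \<subseteq> Y \<Longrightarrow> rat_mat Y W (d i) (d i) (\<lambda>M. arrow_mat d M (Eps i))"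
  unfolding rat_mat_def by (auto simp: arrow_mat_carrier arrow_mat_entry Eps_loop intro!: rat_on_coord)

lemma rat_mat_Alpha:
  "is_arrow i j g \<Longrightarrow> rat_mat X W (d i) (d j) (\<lambda>M. arrow_mat d M (Alpha i j g))"
  unfolding rat_mat_def by (auto simp: arrow_mat_carrier arrow_mat_entry Alpha_X intro!: rat_on_coord)

lemma rat_mat_hmat:
  assumes N: "rat_mat Y W (d i) (d i) N" and H: "H \<in> carrier_mat (d i) (d i)"
  shows "rat_mat Y W (d i) (d i) (\<lambda>v. hmat (c i) (d i) H (N v))"
  unfolding rat_mat_def
proof (intro conjI ballI allI impI)
  fix p q assume p: "p < d i" and q: "q < d i"
  have "p - p mod c i + (c i - 1) < d i"
    using p block_last_less unfolding d_eq by blast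
  then have "rat_on Y W (\<lambda>v. (H * N v ^\<^sub>m (c i - 1 - p mod c i)) $$ (p - p mod c i + (c i - 1), q))"
    using q by (intro rat_on_mult_entry[OF rat_mat_const[OF H] rat_mat_pow[OF N]])
  then show "rat_on Y W (\<lambda>v. hmat (c i) (d i) H (N v) $$ (p, q))"
    using p q by (simp add: hmat_entry)
qed simp

lemma rat_on_build_rep:
  assumes N: "\<And>i. i \<in> {1..n} \<Longrightarrow> rat_mat Y W (d i) (d i) (\<lambda>v. N v i)"
    and h: "\<And>i. i \<in> {1..n} \<Longrightarrow> rat_mat Y W (d i) (d i) (\<lambda>v. h v i)"
    and s: "\<And>i j g. is_arrow i j g \<Longrightarrow> rat_mat Y W (d i) (d j) (\<lambda>v. arrow_mat d (s v) (Alpha i j g))"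
    and z: "z \<in> X"
  shows "rat_on Y W (\<lambda>v. build_rep (N v) (h v) (s v) z)"
proof -
  obtain a p q where e: "z = (a, p, q)" by (cases z) auto
  show ?thesis
  proof (cases a)
    case (Eps i)
    then have ipq: "i \<in> {1..n}" "p < d i" "q < d i" using z e by (auto simp: Eps_X)
    then show ?thesis using rat_matD[OF N] z e Eps
      by (simp add: build_rep_def of_mats_def rep_mats_def)
  next
    case (Alpha i j g)
    then have a: "is_arrow i j g" and p: "p < d i" and q: "q < d j" using z e by (auto simp: Alpha_X)
    have i: "i \<in> {1..n}" and j: "j \<in> {1..n}" using \<Omega>_vertices a by blast+
    have "rat_mat Y W (d i) (d j) (\<lambda>v. hom_extend (c j) (ff C i j) (d i) (d j) (N v i ^\<^sub>m ff C j i)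
        (arrow_mat d (s v) (Alpha i j g)))"
      unfolding hom_extend_def
    proof (rule rat_mat_mat)
      fix p q assume p: "p < d i" and q: "q < d j"
      have "rat_on Y W (\<lambda>v. ((N v i ^\<^sub>m ff C j i) ^\<^sub>m (q mod c j div ff C i j) *
          arrow_mat d (s v) (Alpha i j g)) $$ (p, q - ff C i j * (q mod c j div ff C i j)))"
        by (intro rat_on_mult_entry[OF rat_mat_pow[OF rat_mat_pow[OF N[OF i]]] s[OF a] p]) (use q in simp)
      then show "rat_on Y W (\<lambda>v. (\<lambda>(p, q). ((N v i ^\<^sub>m ff C j i) ^\<^sub>m (q mod c j div ff C i j) *
          arrow_mat d (s v) (Alpha i j g)) $$ (p, q - ff C i j * (q mod c j div ff C i j))) (p, q))"
        by simp
    qed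
    from rat_on_mult_entry[OF this h[OF j] p q] show ?thesis
      using z e Alpha by (simp add: build_rep_def of_mats_def rep_mats_def)
  qed
qed

subsection \<open>Charts\<close>

abbreviation hm :: "(nat \<Rightarrow> 'k::field mat) \<Rightarrow> (rep_coord \<Rightarrow> 'k) \<Rightarrow> nat \<Rightarrow> 'k mat" where
  "hm H M i \<equiv> hmat (c i) (d i) (H i) (arrow_mat d M (Eps i))"

text \<open>One product over all vertices, so that a single function cuts out the domain of a
  chart.\<close>

definition hdet :: "(nat \<Rightarrow> 'k::field mat) \<Rightarrow> (rep_coord \<Rightarrow> 'k) \<Rightarrow> 'k" where
  "hdet H M = (\<Prod>i\<in>{1..n}. det (hm H M i))"

definition based :: "(nat \<Rightarrow> 'k::field mat) \<Rightarrow> bool" where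
  "based H \<longleftrightarrow> (\<forall>i\<in>{1..n}. H i \<in> carrier_mat (d i) (d i))"

lemma hdet_nonzero: "hdet H M \<noteq> 0 \<longleftrightarrow> (\<forall>i\<in>{1..n}. det (hm H M i) \<noteq> 0)"
  by (auto simp: hdet_def)

lemma rat_mat_hm:
  "based H \<Longrightarrow> i \<in> {1..n} \<Longrightarrow> loop_coords n d \<subseteq> Y \<Longrightarrow> rat_mat Y W (d i) (d i) (\<lambda>M. hm H M i)"
  by (intro rat_mat_hmat rat_mat_Eps) (auto simp: based_def)

lemma rat_on_hdet: "based H \<Longrightarrow> loop_coords n d \<subseteq> Y \<Longrightarrow> rat_on Y W (hdet H)"
  unfolding hdet_def by (intro rat_on_prod rat_on_det[OF rat_mat_hm]) auto

lemma intertwiner_hm: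
  assumes H: "based H" and i: "i \<in> {1..n}"
    and M: "arrow_mat d M (Eps i) ^\<^sub>m c i = 0\<^sub>m (d i) (d i)" and h: "hdet H M \<noteq> 0"
  shows "intertwiner i (arrow_mat d M (Eps i)) (hm H M i)"
proof -
  have "det (hm H M i) \<noteq> 0" using h i by (auto simp: hdet_nonzero)
  moreover have "hm H M i * arrow_mat d M (Eps i) = free_mat (c i) (r i) * hm H M i"
    using hmat_intertwine[of "H i" "c i" "r i" "arrow_mat d M (Eps i)"] H i M arrow_mat_carrier(1)[of M i]
    unfolding based_def d_eq by blast
  ultimately show ?thesis by (simp add: intertwiner_def)
qed

lemma nilpotent_of_intertwiner:
  assumes "intertwiner i (arrow_mat d M (Eps i)) h"
  shows "arrow_mat d M (Eps i) ^\<^sub>m c i = 0\<^sub>m (d i) (d i)"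
  using assms intertwine_nilpotent[of h "c i" "r i" "arrow_mat d M (Eps i)"] arrow_mat_carrier(1)[of M i]
  unfolding intertwiner_def d_eq by blast

text \<open>The intertwiners of M themselves serve as H, because \<open>hmat\<close> gives back an
  intertwiner from its last rows.\<close>

lemma ex_based:
  assumes "\<forall>i\<in>{1..n}. \<exists>h. intertwiner i (arrow_mat d M (Eps i)) h"
  shows "\<exists>H. based H \<and> hdet H M \<noteq> 0"
proof -
  obtain H where H: "\<forall>i\<in>{1..n}. intertwiner i (arrow_mat d M (Eps i)) (H i)"
    using assms by (rule bchoice[THEN exE])
  have "hm H M i = H i" if "i \<in> {1..n}" for i
    using hmat_eqI[of "H i" "c i" "r i" "H i" "arrow_mat d M (Eps i)"] H that arrow_mat_carrier(1)[of M i]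
    unfolding intertwiner_def d_eq by blast
  then show ?thesis using H by (intro exI[of _ H]) (auto simp: based_def intertwiner_def hdet_nonzero)
qed

section \<open>The locally free locus is open, and the representation variety is closed\<close>

lemma rep_H_affine: "rep_H n C c \<Omega> d \<subseteq> affine_space X"
  by (auto simp: rep_H_def)

lemma rep_lf_rep_H: "rep_lf n C c \<Omega> r \<subseteq> rep_H n C c \<Omega> d"
  by (auto simp: rep_lf_iff)

lemma rep_lf_affine: "rep_lf n C c \<Omega> r \<subseteq> affine_space X"
  using rep_lf_rep_H rep_H_affine by (rule order_trans)

lemma rep_lf_hdet: "based H \<Longrightarrow> M \<in> rep_H n C c \<Omega> d \<Longrightarrow> hdet H M \<noteq> 0 \<Longrightarrow> M \<in> rep_lf n C c \<Omega> r"
  unfolding rep_lf_iff using intertwiner_hm unfolding rep_H_iff by blast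

text \<open>Where the determinants for some H do not vanish, the nilpotency relations make
  \<open>hm\<close> an intertwiner. Freeness is thus detected by determinants, without ranks of
  powers of the loops.\<close>

lemma openin_rep_lf: "openin (var_top X (rep_H n C c \<Omega> d)) (rep_lf n C c \<Omega> r :: (rep_coord \<Rightarrow> 'k::field) set)"
  unfolding openin_var_top[OF rep_H_affine]
proof (intro conjI ballI rep_lf_rep_H)
  fix M :: "rep_coord \<Rightarrow> 'k" assume M: "M \<in> rep_lf n C c \<Omega> r"
  then obtain H where H: "based H" "hdet H M \<noteq> 0" using ex_based unfolding rep_lf_iff by blast
  obtain f where f: "f \<in> poly_fun X"
    "{v \<in> rep_H n C c \<Omega> d. hdet H v \<noteq> 0} = {v \<in> rep_H n C c \<Omega> d. f v \<noteq> 0}"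
    using rat_on_openin[OF rep_H_affine rat_on_hdet[OF H(1) loop_subset_X]] by blast
  have "{v \<in> rep_H n C c \<Omega> d. f v \<noteq> 0} \<subseteq> rep_lf n C c \<Omega> r"
    unfolding f(2)[symmetric] using rep_lf_hdet[OF H(1)] by blast
  moreover have "f M \<noteq> 0" using f(2) H(2) M rep_lf_rep_H by blast
  ultimately show "\<exists>f\<in>poly_fun X. f M \<noteq> 0 \<and> {v \<in> rep_H n C c \<Omega> d. f v \<noteq> 0} \<subseteq> rep_lf n C c \<Omega> r"
    using f(1) by blast
qed

lemma closedin_rep_H: "closedin (zariski X) (rep_H n C c \<Omega> d :: (rep_coord \<Rightarrow> 'k::field) set)"
proof -
  let ?A = "\<lambda>a M. arrow_mat d (M :: rep_coord \<Rightarrow> 'k) a"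
  \<comment> \<open>Every coordinate labels one scalar equation: a loop entry an entry of the
    nilpotency relation, an \<alpha> entry an entry of the commutation relation.\<close>
  define I where "I = {(Eps i, p, q) | i p q. i \<in> {1..n} \<and> p < d i \<and> q < d i} \<union>
    {(Alpha i j g, p, q) | i j g p q. is_arrow i j g \<and> p < d i \<and> q < d j}"
  define f where "f = (\<lambda>(a, p, q) M. case a of
      Eps i \<Rightarrow> (?A (Eps i) M ^\<^sub>m c i) $$ (p, q)
    | Alpha i j g \<Rightarrow> (?A (Eps i) M ^\<^sub>m ff C j i * ?A (Alpha i j g) M) $$ (p, q) -
        (?A (Alpha i j g) M * ?A (Eps j) M ^\<^sub>m ff C i j) $$ (p, q))"
  have "rat_on X (affine_space X) (f z)" if zI: "z \<in> I" for z
  proof -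
    obtain a p q where z: "z = (a, p, q)" by (cases z) auto
    show ?thesis
    proof (cases a)
      case (Eps i)
      then have "i \<in> {1..n}" "p < d i" "q < d i" using zI by (auto simp: I_def z)
      then have "rat_on X (affine_space X) (\<lambda>M. (?A (Eps i) M ^\<^sub>m c i) $$ (p, q))"
        by (intro rat_matD[OF rat_mat_pow[OF rat_mat_Eps]] loop_subset_X)
      then show ?thesis by (simp add: f_def z Eps)
    next
      case (Alpha i j g)
      then have a: "is_arrow i j g" "p < d i" "q < d j" using zI by (auto simp: I_def z)
      then have "i \<in> {1..n}" "j \<in> {1..n}" using \<Omega>_vertices by blast+
      then have "rat_on X (affine_space X) (\<lambda>M. (?A (Eps i) M ^\<^sub>m ff C j i * ?A (Alpha i j g) M) $$ (p, q) -
          (?A (Alpha i j g) M * ?A (Eps j) M ^\<^sub>m ff C i j) $$ (p, q))"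
        using a by (intro rat_on_diff rat_on_mult_entry[OF rat_mat_pow[OF rat_mat_Eps] rat_mat_Alpha]
            rat_on_mult_entry[OF rat_mat_Alpha rat_mat_pow[OF rat_mat_Eps]] loop_subset_X)
      then show ?thesis by (simp add: f_def z Alpha)
    qed
  qed
  then have "closedin (zariski X) {v \<in> affine_space X. \<forall>i\<in>I. f i v = 0}" by (rule rat_on_closedin_zariski)
  also have "{v \<in> affine_space X. \<forall>i\<in>I. f i v = 0} = rep_H n C c \<Omega> d"
  proof -
    have "(\<forall>z\<in>I. f z M = 0) \<longleftrightarrow> (\<forall>i\<in>{1..n}. ?A (Eps i) M ^\<^sub>m c i = 0\<^sub>m (d i) (d i)) \<and>
      (\<forall>i j g. is_arrow i j g \<longrightarrow>
        ?A (Eps i) M ^\<^sub>m ff C j i * ?A (Alpha i j g) M = ?A (Alpha i j g) M * ?A (Eps j) M ^\<^sub>m ff C i j)"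
      (is "?L \<longleftrightarrow> ?R1 \<and> ?R2") for M
    proof (intro iffI conjI ballI allI impI)
      assume L: ?L
      show "?A (Eps i) M ^\<^sub>m c i = 0\<^sub>m (d i) (d i)" if i: "i \<in> {1..n}" for i
      proof (rule eq_matI)
        fix p q assume "p < dim_row (0\<^sub>m (d i) (d i) :: 'k mat)" "q < dim_col (0\<^sub>m (d i) (d i) :: 'k mat)"
        then have pq: "p < d i" "q < d i" by auto
        then have "(Eps i, p, q) \<in> I" using i by (auto simp: I_def)
        with L have "f (Eps i, p, q) M = 0" by blast
        then show "(?A (Eps i) M ^\<^sub>m c i) $$ (p, q) = 0\<^sub>m (d i) (d i) $$ (p, q)" using pq by (simp add: f_def)
      qed (simp_all add: arrow_mat_def)
      show "?A (Eps i) M ^\<^sub>m ff C j i * ?A (Alpha i j g) M = ?A (Alpha i j g) M * ?A (Eps j) M ^\<^sub>m ff C i j"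
        if a: "is_arrow i j g" for i j g
      proof (rule eq_mat_carrierI)
        fix p q assume "p < d i" "q < d j"
        then have "(Alpha i j g, p, q) \<in> I" using a by (auto simp: I_def)
        with L have "f (Alpha i j g, p, q) M = 0" by blast
        then show "(?A (Eps i) M ^\<^sub>m ff C j i * ?A (Alpha i j g) M) $$ (p, q) =
            (?A (Alpha i j g) M * ?A (Eps j) M ^\<^sub>m ff C i j) $$ (p, q)" by (simp add: f_def)
      qed (intro mult_carrier_mat[OF pow_carrier_mat] mult_carrier_mat[OF _ pow_carrier_mat] arrow_mat_carrier)+
    next
      fix z assume R: "?R1 \<and> ?R2" and z: "z \<in> I"
      then show "f z M = 0" unfolding I_def f_def by auto
    qed
    then show ?thesis by (auto simp: rep_H_iff)
  qed
  finally show ?thesis .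
qed

lemma quasi_affine_rep_lf: "quasi_affine X (rep_lf n C c \<Omega> r :: (rep_coord \<Rightarrow> 'k::field) set)"
proof -
  obtain U :: "(rep_coord \<Rightarrow> 'k) set" where "openin (zariski X) U" "rep_lf n C c \<Omega> r = U \<inter> rep_H n C c \<Omega> d"
    using openin_rep_lf unfolding var_top_def openin_subtopology by blast
  then show ?thesis unfolding quasi_affine_def using finite_X closedin_rep_H by (metis Int_commute)
qed

text \<open>The entries of \<open>hmat\<close> that are not prescribed.\<close>

definition loop_free :: "rep_coord set" where
  "loop_free = {(Eps i, p, q) | i p q. i \<in> {1..n} \<and> p < d i \<and> q < d i \<and> p mod c i \<noteq> c i - 1}"

definition chart_coords :: "rep_coord set" where
  "chart_coords = loop_free \<union> alpha_coords"

lemma Eps_chart: "(Eps i, p, q) \<in> chart_coords \<longleftrightarrow> i \<in> {1..n} \<and> p < d i \<and> q < d i \<and> p mod c i \<noteq> c i - 1"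
  by (auto simp: chart_coords_def loop_free_def Eps_alpha)

lemma Alpha_chart: "(Alpha i j g, p, q) \<in> chart_coords \<longleftrightarrow> (Alpha i j g, p, q) \<in> alpha_coords"
  by (auto simp: chart_coords_def loop_free_def)

lemma chart_subset_X: "chart_coords \<subseteq> X"
  using alpha_subset_X by (auto simp: chart_coords_def loop_free_def Eps_X)

lemma finite_chart: "finite chart_coords"
  using finite_X chart_subset_X by (rule finite_subset[rotated])

text \<open>The loop coordinates are the free entries of the frame \<open>hm\<close>, not of the
  loop itself; the others are the images of the generators with respect to this frame.\<close>

definition \<phi>_chart :: "(nat \<Rightarrow> 'k::field mat) \<Rightarrow> (rep_coord \<Rightarrow> 'k) \<Rightarrow> rep_coord \<Rightarrow> 'k" where
  "\<phi>_chart H M = (\<lambda>(a, p, q). if (a, p, q) \<in> chart_coords then (case a of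
      Eps i \<Rightarrow> hm H M i $$ (p, q)
    | Alpha i j g \<Rightarrow> (arrow_mat d M (Alpha i j g) * minv (hm H M j)) $$ (p, q)) else 0)"

definition complete :: "(nat \<Rightarrow> 'k::field mat) \<Rightarrow> (rep_coord \<Rightarrow> 'k) \<Rightarrow> rep_coord \<Rightarrow> 'k" where
  "complete H s = (\<lambda>(a, p, q). case a of
      Eps i \<Rightarrow> if p mod c i = c i - 1 then H i $$ (p, q) else s (a, p, q)
    | Alpha i j g \<Rightarrow> s (a, p, q))"

text \<open>The loop entries of s are read as a frame, the \<alpha> entries as images of generators.
  The map does not depend on H: the inverse of every chart is \<open>param\<close> after
  \<open>complete H\<close>, and \<open>param\<close> itself is the global surjection behind
  irreducibility.\<close>

definition param :: "(rep_coord \<Rightarrow> 'k::field) \<Rightarrow> rep_coord \<Rightarrow> 'k" where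
  "param s = build_rep (\<lambda>i. minv (arrow_mat d s (Eps i)) * free_mat (c i) (r i) * arrow_mat d s (Eps i))
     (\<lambda>i. arrow_mat d s (Eps i)) s"

definition chart_domain :: "(nat \<Rightarrow> 'k::field mat) \<Rightarrow> (rep_coord \<Rightarrow> 'k) set" where
  "chart_domain H = {M \<in> rep_lf n C c \<Omega> r. hdet H M \<noteq> 0}"

definition chart_range :: "(nat \<Rightarrow> 'k::field mat) \<Rightarrow> (rep_coord \<Rightarrow> 'k) set" where
  "chart_range H = {s \<in> affine_space chart_coords. (\<Prod>i\<in>{1..n}. det (arrow_mat d (complete H s) (Eps i))) \<noteq> 0}"

lemma param:
  assumes h: "\<And>i. i \<in> {1..n} \<Longrightarrow> det (arrow_mat d s (Eps i)) \<noteq> 0"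
  shows param_lf: "param s \<in> rep_lf n C c \<Omega> r"
    and param_Eps: "i \<in> {1..n} \<Longrightarrow> arrow_mat d (param s) (Eps i) =
      minv (arrow_mat d s (Eps i)) * free_mat (c i) (r i) * arrow_mat d s (Eps i)"
    and param_Alpha: "is_arrow i j g \<Longrightarrow> p < d i \<Longrightarrow> q < d j \<Longrightarrow> q mod c j < ff C i j \<Longrightarrow>
      (arrow_mat d (param s) (Alpha i j g) * minv (arrow_mat d s (Eps j))) $$ (p, q) = s (Alpha i j g, p, q)"
proof -
  let ?h = "\<lambda>i. arrow_mat d s (Eps i)"
  let ?N = "\<lambda>i. minv (?h i) * free_mat (c i) (r i) * ?h i"
  have N: "?N i \<in> carrier_mat (d i) (d i)" "intertwiner i (?N i) (?h i)" if "i \<in> {1..n}" for i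
    using intertwinerI[OF arrow_mat_carrier(1) h[OF that]] by blast+
  show "param s \<in> rep_lf n C c \<Omega> r" unfolding param_def by (rule build_rep_lf[OF N])
  show "i \<in> {1..n} \<Longrightarrow> arrow_mat d (param s) (Eps i) = ?N i" unfolding param_def by (rule build_rep_Eps[OF N])
  show "(arrow_mat d (param s) (Alpha i j g) * minv (?h j)) $$ (p, q) = s (Alpha i j g, p, q)"
    if a: "is_arrow i j g" and pq: "p < d i" "q < d j" "q mod c j < ff C i j"
  proof -
    have "i \<in> {1..n}" using a \<Omega>_vertices by blast
    then have P: "?N i ^\<^sub>m ff C j i \<in> carrier_mat (d i) (d i)" by (intro pow_carrier_mat N)
    have b: "arrow_mat d (param s) (Alpha i j g) * minv (?h j) =
        hom_extend (c j) (ff C i j) (d i) (d j) (?N i ^\<^sub>m ff C j i) (arrow_mat d s (Alpha i j g))"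
      unfolding param_def by (rule build_rep_Alpha[OF N a])
    show ?thesis
      unfolding b hom_extend_generator[OF P arrow_mat_carrier(2) pq]
      by (rule arrow_mat_entry(2)[OF pq(1,2)])
  qed
qed

lemma complete_Eps_last:
  "p < d i \<Longrightarrow> q < d i \<Longrightarrow> p mod c i = c i - 1 \<Longrightarrow>
    arrow_mat d (complete H s) (Eps i) $$ (p, q) = H i $$ (p, q)"
  by (simp add: arrow_mat_entry complete_def)

text \<open>The completed frame is an intertwiner for the loop built from it, and its last rows are
  those of H, so \<open>hmat_eqI\<close> gives it back.\<close>

lemma hm_param_complete:
  assumes H: "based H" and s: "s \<in> chart_range H" and i: "i \<in> {1..n}"
  shows "hm H (param (complete H s)) i = arrow_mat d (complete H s) (Eps i)"
proof -
  let ?h = "arrow_mat d (complete H s) (Eps i)"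
  have h: "det (arrow_mat d (complete H s) (Eps i)) \<noteq> 0" if "i \<in> {1..n}" for i
    using s that by (auto simp: chart_range_def)
  note N = intertwinerI[OF arrow_mat_carrier(1) h[OF i]]
  have "hmat (c i) (c i * r i) (H i) (minv ?h * free_mat (c i) (r i) * ?h) = ?h"
  proof (rule hmat_eqI)
    show "H i \<in> carrier_mat (c i * r i) (c i * r i)" using H i by (simp add: based_def flip: d_eq)
    show "?h \<in> carrier_mat (c i * r i) (c i * r i)" unfolding d_eq[symmetric] by (rule arrow_mat_carrier)
    show "minv ?h * free_mat (c i) (r i) * ?h \<in> carrier_mat (c i * r i) (c i * r i)"
      unfolding d_eq[symmetric] by (rule N(2))
    show "?h * (minv ?h * free_mat (c i) (r i) * ?h) = free_mat (c i) (r i) * ?h"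
      using N(1) by (simp add: intertwiner_def)
    show "?h $$ (p, q) = H i $$ (p, q)" if "p < c i * r i" "q < c i * r i" "p mod c i = c i - 1" for p q
      using that complete_Eps_last[of p i q H s] by (simp add: d_eq)
  qed
  moreover have "arrow_mat d (param (complete H s)) (Eps i) = minv ?h * free_mat (c i) (r i) * ?h"
    by (rule param_Eps[OF h i])
  ultimately show ?thesis by (simp only: d_eq)
qed

lemma param_complete_domain:
  assumes H: "based H" and s: "s \<in> chart_range H"
  shows "param (complete H s) \<in> chart_domain H"
proof -
  have h: "det (arrow_mat d (complete H s) (Eps i)) \<noteq> 0" if "i \<in> {1..n}" for i
    using s that by (auto simp: chart_range_def)
  show ?thesis
    unfolding chart_domain_def hdet_nonzero using param_lf[OF h] hm_param_complete[OF H s] h by auto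
qed

lemma \<phi>_chart_param:
  assumes H: "based H" and s: "s \<in> chart_range H"
  shows "\<phi>_chart H (param (complete H s)) = s"
proof
  have h: "det (arrow_mat d (complete H s) (Eps i)) \<noteq> 0" if "i \<in> {1..n}" for i
    using s that by (auto simp: chart_range_def)
  fix z :: rep_coord
  obtain a p q where z: "z = (a, p, q)" by (cases z) auto
  show "\<phi>_chart H (param (complete H s)) z = s z"
  proof (cases "z \<in> chart_coords")
    case False
    then show ?thesis using s by (auto simp: \<phi>_chart_def z chart_range_def affine_space_def)
  next
    case True
    show ?thesis
    proof (cases a)
      case (Eps i)
      then have i: "i \<in> {1..n}" "p < d i" "q < d i" "p mod c i \<noteq> c i - 1"
        using True by (auto simp: z Eps_chart)
      then have "arrow_mat d (complete H s) (Eps i) $$ (p, q) = s z"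
        by (simp add: arrow_mat_entry complete_def z Eps)
      then show ?thesis
        using True hm_param_complete[OF H s i(1)] by (simp add: \<phi>_chart_def z Eps)
    next
      case (Alpha i j g)
      then have a: "is_arrow i j g" "p < d i" "q < d j" "q mod c j < ff C i j"
        using True Alpha_chart[of i j g p q] Alpha_alpha[of i j g p q] by (auto simp: z)
      have j: "j \<in> {1..n}" using a \<Omega>_vertices by blast
      show ?thesis
        using True param_Alpha[OF h a] hm_param_complete[OF H s j]
        by (simp add: \<phi>_chart_def z Alpha complete_def)
    qed
  qed
qed

lemma complete_\<phi>_chart_Eps:
  assumes H: "based H" and i: "i \<in> {1..n}"
  shows "arrow_mat d (complete H (\<phi>_chart H M)) (Eps i) = hm H M i"
proof (rule eq_matI)
  fix p q assume "p < dim_row (hm H M i)" "q < dim_col (hm H M i)"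
  then have pq: "p < d i" "q < d i" by (auto simp: hmat_def)
  show "arrow_mat d (complete H (\<phi>_chart H M)) (Eps i) $$ (p, q) = hm H M i $$ (p, q)"
  proof (cases "p mod c i = c i - 1")
    case True
    have "hm H M i $$ (p, q) = H i $$ (p, q)"
      by (rule hmat_last_row[OF _ arrow_mat_carrier(1) pq True]) (use H i in \<open>simp add: based_def\<close>)
    then show ?thesis using complete_Eps_last[OF pq True] by simp
  next
    case False
    then have "(Eps i, p, q) \<in> chart_coords" using pq i by (simp add: Eps_chart)
    then show ?thesis using pq False by (simp add: arrow_mat_entry complete_def \<phi>_chart_def)
  qed
qed (simp_all add: arrow_mat_def hmat_def)

lemma \<phi>_chart_range:
  assumes H: "based H" and M: "M \<in> chart_domain H"
  shows "\<phi>_chart H M \<in> chart_range H"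
proof -
  have "\<phi>_chart H M \<in> affine_space chart_coords" by (auto simp: \<phi>_chart_def affine_space_def)
  moreover have "(\<Prod>i\<in>{1..n}. det (arrow_mat d (complete H (\<phi>_chart H M)) (Eps i))) = hdet H M"
    unfolding hdet_def by (intro prod.cong) (auto simp: complete_\<phi>_chart_Eps[OF H])
  moreover have "hdet H M \<noteq> 0" using M unfolding chart_domain_def by blast
  ultimately show ?thesis unfolding chart_range_def by (simp only: mem_Collect_eq simp_thms)
qed

lemma param_\<phi>_chart:
  assumes H: "based H" and M: "M \<in> chart_domain H"
  shows "param (complete H (\<phi>_chart H M)) = M"
  unfolding param_def
proof (rule build_rep_eqI)
  let ?s = "complete H (\<phi>_chart H M)"
  have "M \<in> rep_lf n C c \<Omega> r" and hd: "hdet H M \<noteq> 0" using M by (auto simp: chart_domain_def)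
  then show MH: "M \<in> rep_H n C c \<Omega> d" using rep_lf_rep_H by blast
  have it: "intertwiner i (arrow_mat d M (Eps i)) (hm H M i)" if "i \<in> {1..n}" for i
    using intertwiner_hm[OF H that _ hd] MH that by (simp add: rep_H_iff)
  show N: "minv (arrow_mat d ?s (Eps i)) * free_mat (c i) (r i) * arrow_mat d ?s (Eps i) = arrow_mat d M (Eps i)"
    if "i \<in> {1..n}" for i
    unfolding complete_\<phi>_chart_Eps[OF H that] by (rule intertwiner_minv[OF it[OF that] arrow_mat_carrier(1)])
  show "intertwiner i (minv (arrow_mat d ?s (Eps i)) * free_mat (c i) (r i) * arrow_mat d ?s (Eps i))
      (arrow_mat d ?s (Eps i))" if "i \<in> {1..n}" for i
    unfolding N[OF that] unfolding complete_\<phi>_chart_Eps[OF H that] by (rule it[OF that])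
  fix i j g p q assume a: "(Alpha i j g, p, q) \<in> alpha_coords"
  then have "j \<in> {1..n}" using \<Omega>_vertices by (auto simp: Alpha_alpha)
  then show "?s (Alpha i j g, p, q) = (arrow_mat d M (Alpha i j g) * minv (arrow_mat d ?s (Eps j))) $$ (p, q)"
    unfolding complete_\<phi>_chart_Eps[OF H \<open>j \<in> {1..n}\<close>]
    using a Alpha_chart[of i j g p q] by (simp add: complete_def \<phi>_chart_def)
qed

lemma rat_on_\<phi>_chart:
  assumes H: "based H" and z: "z \<in> chart_coords"
  shows "rat_on X (chart_domain H) (\<lambda>M. \<phi>_chart H M z)"
proof -
  have hd: "det (hm H M i) \<noteq> 0" if "M \<in> chart_domain H" "i \<in> {1..n}" for M i
    using that by (auto simp: chart_domain_def hdet_nonzero)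
  obtain a p q where e: "z = (a, p, q)" by (cases z) auto
  show ?thesis
  proof (cases a)
    case (Eps i)
    then have i: "i \<in> {1..n}" "p < d i" "q < d i" using z by (auto simp: e Eps_chart)
    show ?thesis
      using rat_matD[OF rat_mat_hm[OF H i(1) loop_subset_X] i(2,3)] z by (simp add: \<phi>_chart_def e Eps)
  next
    case (Alpha i j g)
    then have a: "is_arrow i j g" "p < d i" "q < d j"
      using z Alpha_chart[of i j g p q] Alpha_alpha[of i j g p q] by (auto simp: e)
    then have j: "j \<in> {1..n}" using \<Omega>_vertices by blast
    have "rat_on X (chart_domain H) (\<lambda>M. (arrow_mat d M (Alpha i j g) * minv (hm H M j)) $$ (p, q))"
      by (intro rat_on_mult_entry[OF rat_mat_Alpha[OF a(1)] rat_mat_minv[OF rat_mat_hm[OF H j loop_subset_X]]] a hd j)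
    then show ?thesis using z by (simp add: \<phi>_chart_def e Alpha)
  qed
qed

text \<open>The family \<sigma> of parameters is \<open>complete H\<close> for the charts and the
  identity for the global parametrization.\<close>

lemma rat_on_param:
  assumes h: "\<And>i s. i \<in> {1..n} \<Longrightarrow> s \<in> W \<Longrightarrow> det (arrow_mat d (\<sigma> s) (Eps i)) \<noteq> 0"
    and r: "\<And>z. z \<in> X \<Longrightarrow> rat_on Y W (\<lambda>s. \<sigma> s z)" and z: "z \<in> X"
  shows "rat_on Y W (\<lambda>s. param (\<sigma> s) z)"
  unfolding param_def
proof (rule rat_on_build_rep[OF _ _ _ z])
  show h': "rat_mat Y W (d i) (d i) (\<lambda>s. arrow_mat d (\<sigma> s) (Eps i))" if "i \<in> {1..n}" for i
    unfolding rat_mat_def using that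
    by (auto simp: arrow_mat_carrier arrow_mat_entry Eps_X intro!: r)
  show "rat_mat Y W (d i) (d i) (\<lambda>s. minv (arrow_mat d (\<sigma> s) (Eps i)) * free_mat (c i) (r i) * arrow_mat d (\<sigma> s) (Eps i))"
    if "i \<in> {1..n}" for i
  proof -
    have F: "free_mat (c i) (r i) \<in> carrier_mat (d i) (d i)" by (simp add: d_eq)
    show ?thesis
      by (rule rat_mat_mult[OF rat_mat_mult[OF rat_mat_minv[OF h'[OF that] h[OF that]] rat_mat_const[OF F]] h'[OF that]])
  qed
  show "rat_mat Y W (d i) (d j) (\<lambda>s. arrow_mat d (\<sigma> s) (Alpha i j g))" if "is_arrow i j g" for i j g
    unfolding rat_mat_def using that
    by (auto simp: arrow_mat_carrier arrow_mat_entry Alpha_X intro!: r)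
qed

lemma rat_on_complete:
  assumes "W \<subseteq> affine_space chart_coords"
  shows "rat_on chart_coords W (\<lambda>s. complete H s z)"
proof -
  obtain a p q where e: "z = (a, p, q)" by (cases z) auto
  show ?thesis
  proof (cases "\<exists>i. a = Eps i \<and> p mod c i = c i - 1")
    case True
    then show ?thesis by (auto simp: complete_def e)
  next
    case False
    then have "complete H s z = s z" for s by (cases a) (auto simp: complete_def e)
    then show ?thesis using rat_on_affine_space_coord[OF assms, of z] by simp
  qed
qed

lemma openin_chart_range: "openin (zariski chart_coords) (chart_range H)"
proof -
  have "rat_mat chart_coords (affine_space chart_coords) (d i) (d i) (\<lambda>s. arrow_mat d (complete H s) (Eps i))" for i
    by (auto simp: rat_mat_def arrow_mat_carrier arrow_mat_entry intro!: rat_on_complete)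
  then have "rat_on chart_coords (affine_space chart_coords)
      (\<lambda>s. \<Prod>i\<in>{1..n}. det (arrow_mat d (complete H s) (Eps i)))"
    by (intro rat_on_prod rat_on_det)
  then obtain p where p: "p \<in> poly_fun chart_coords" "chart_range H = {v \<in> affine_space chart_coords. p v \<noteq> 0}"
    unfolding chart_range_def using rat_on_openin[OF order_refl] by blast
  show ?thesis unfolding p(2) by (rule openin_zariski_nonzero[OF p(1)])
qed

lemma openin_chart_domain:
  assumes "based H"
  shows "openin (var_top X (rep_lf n C c \<Omega> r)) (chart_domain H)"
  unfolding openin_var_top[OF rep_lf_affine]
proof (intro conjI ballI)
  obtain p where p: "p \<in> poly_fun X" "chart_domain H = {v \<in> rep_lf n C c \<Omega> r. p v \<noteq> 0}"
    unfolding chart_domain_def using rat_on_openin[OF rep_lf_affine rat_on_hdet[OF assms loop_subset_X]] by blast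
  fix x assume "x \<in> chart_domain H"
  then show "\<exists>f\<in>poly_fun X. f x \<noteq> 0 \<and> {v \<in> rep_lf n C c \<Omega> r. f v \<noteq> 0} \<subseteq> chart_domain H"
    using p by (intro bexI[of _ p]) auto
qed (auto simp: chart_domain_def)

lemma affine_chart_rep_lf:
  assumes H: "based H"
  shows "affine_chart X (rep_lf n C c \<Omega> r) (chart_domain H) chart_coords (chart_range H)
    (\<phi>_chart H) (\<lambda>s. param (complete H s))"
proof -
  have W: "chart_range H \<subseteq> affine_space chart_coords" by (auto simp: chart_range_def)
  have "rat_on chart_coords (chart_range H) (\<lambda>s. param (complete H s) z)" if "z \<in> X" for z
    by (rule rat_on_param[OF _ rat_on_complete[OF W] that]) (auto simp: chart_range_def)
  then show ?thesis
    unfolding affine_chart_def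
    by (intro conjI ballI funcsetI finite_chart rep_lf_affine openin_chart_domain[OF H] openin_chart_range
        rat_on_\<phi>_chart[OF H] \<phi>_chart_range[OF H] param_complete_domain[OF H] param_\<phi>_chart[OF H]
        \<phi>_chart_param[OF H])
qed

lemma rep_lf_chart_domain:
  assumes "M \<in> rep_lf n C c \<Omega> r"
  shows "\<exists>H. based H \<and> M \<in> chart_domain H"
  using ex_based[of M] assms unfolding chart_domain_def rep_lf_iff by blast


subsection \<open>Dimensions\<close>

text \<open>Each of the r_i blocks has c_i - 1 rows that are not prescribed, and each row has d_i =
  c_i r_i entries.\<close>

lemma card_loop_free: "card loop_free = (\<Sum>i\<in>{1..n}. c i * (c i - 1) * (r i)\<^sup>2)"
proof -
  let ?A = "\<lambda>i. {p. p < d i \<and> p mod c i \<noteq> c i - 1}"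
  let ?B = "SIGMA i:{1..n}. ?A i \<times> {..<d i}"
  have "loop_free = (\<lambda>(i, p, q). (Eps i, p, q)) ` ?B"
    by (force simp: loop_free_def)
  moreover have "inj_on (\<lambda>(i, p, q). (Eps i, p, q)) ?B" by (auto simp: inj_on_def)
  ultimately have "card loop_free = card ?B" by (simp only: card_image)
  also have "\<dots> = (\<Sum>i\<in>{1..n}. card (?A i) * d i)"
    by (subst card_SigmaI) (auto simp: card_cartesian_product)
  also have "\<dots> = (\<Sum>i\<in>{1..n}. c i * (c i - 1) * (r i)\<^sup>2)"
  proof (rule sum.cong)
    fix i assume i: "i \<in> {1..n}"
    have "{l. l < c i \<and> l \<noteq> c i - 1} = {..<c i} - {c i - 1}" by auto
    then have "card {l. l < c i \<and> l \<noteq> c i - 1} = c i - 1" using c_pos[OF i] by simp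
    then have "card (?A i) = r i * (c i - 1)"
      unfolding d_eq using card_residues[of "c i" "r i" "\<lambda>l. l \<noteq> c i - 1"] by simp
    then show "card (?A i) * d i = c i * (c i - 1) * (r i)\<^sup>2" by (simp add: d_eq power2_eq_square)
  qed simp
  finally show ?thesis .
qed

text \<open>There are g_ij arrows, d_i rows and f_ij r_j generators, and g_ij f_ij = |c_ij|.\<close>

lemma card_alpha: "card alpha_coords = (\<Sum>(i, j)\<in>\<Omega>. c i * nat \<bar>C i j\<bar> * r i * r j)"
proof -
  let ?A = "\<lambda>i j. {q. q < d j \<and> q mod c j < ff C i j}"
  let ?B = "SIGMA (i, j):\<Omega>. {1..gg C i j} \<times> {..<d i} \<times> ?A i j"
  have "alpha_coords = (\<lambda>((i, j), g, p, q). (Alpha i j g, p, q)) ` ?B"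
    by (force simp: alpha_coords_def)
  moreover have "inj_on (\<lambda>((i, j), g, p, q). (Alpha i j g, p, q)) ?B" by (auto simp: inj_on_def)
  ultimately have "card alpha_coords = card ?B" by (simp only: card_image)
  also have "\<dots> = (\<Sum>(i, j)\<in>\<Omega>. gg C i j * (d i * card (?A i j)))"
    by (subst card_SigmaI) (auto simp: card_cartesian_product finite_\<Omega> case_prod_unfold)
  also have "\<dots> = (\<Sum>(i, j)\<in>\<Omega>. c i * nat \<bar>C i j\<bar> * r i * r j)"
  proof (rule sum.cong)
    fix x assume x: "x \<in> \<Omega>"
    obtain i j where ij: "x = (i, j)" by (cases x)
    obtain k where k: "c j = k * ff C i j" "ff C i j > 0" using exponentsE x unfolding ij by metis
    have "k > 0" using k(1) c_pos \<Omega>_vertices x unfolding ij by fastforce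
    \<comment> \<open>All residues below f_ij occur modulo c_j.\<close>
    then have "ff C i j \<le> c j" using k(1) by simp
    then have "{l. l < c j \<and> l < ff C i j} = {..<ff C i j}" by auto
    then have "card (?A i j) = r j * ff C i j"
      unfolding d_eq using card_residues[of "c j" "r j" "\<lambda>l. l < ff C i j"] by simp
    then show "(case x of (i, j) \<Rightarrow> gg C i j * (d i * card (?A i j))) =
        (case x of (i, j) \<Rightarrow> c i * nat \<bar>C i j\<bar> * r i * r j)"
      by (simp add: ij d_eq gg_ff[symmetric])
  qed simp
  finally show ?thesis .
qed

lemma card_chart: "card chart_coords =
    (\<Sum>i\<in>{1..n}. c i * (c i - 1) * (r i)\<^sup>2) + (\<Sum>(i, j)\<in>\<Omega>. c i * nat \<bar>C i j\<bar> * r i * r j)"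
proof -
  have "loop_free \<inter> alpha_coords = {}" by (auto simp: loop_free_def alpha_coords_def)
  moreover have "finite loop_free" using finite_chart by (simp add: chart_coords_def)
  ultimately show ?thesis
    unfolding chart_coords_def by (subst card_Un_disjoint) (auto simp: finite_alpha card_loop_free card_alpha)
qed

section \<open>Nonemptiness, smoothness, dimension and irreducibility\<close>

lemma rep_lf_atlas:
  assumes "(M :: rep_coord \<Rightarrow> 'k::alg_closed_field) \<in> rep_lf n C c \<Omega> r"
  shows "\<exists>V' S W \<phi> \<psi>. M \<in> V' \<and> affine_chart X (rep_lf n C c \<Omega> r) V' (S :: rep_coord set) W \<phi> \<psi> \<and>
    card S = card chart_coords"
proof -
  obtain H where H: "based H" "M \<in> chart_domain H" using rep_lf_chart_domain[OF assms] by blast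
  show ?thesis
    by (rule exI[of _ "chart_domain H"], rule exI[of _ chart_coords], rule exI[of _ "chart_range H"],
        rule exI[of _ "\<phi>_chart H"], rule exI[of _ "\<lambda>s. param (complete H s)"])
      (intro conjI H(2) affine_chart_rep_lf[OF H(1)] refl)
qed

lemma rep_lf_nonempty: "rep_lf n C c \<Omega> r \<noteq> ({} :: (rep_coord \<Rightarrow> 'k::field) set)"
proof -
  define s :: "rep_coord \<Rightarrow> 'k" where "s = (\<lambda>(a, p, q). if p = q then 1 else 0)"
  have "arrow_mat d s (Eps i) = 1\<^sub>m (d i)" for i
    by (rule eq_matI) (auto simp: arrow_mat_def s_def)
  then have "param s \<in> rep_lf n C c \<Omega> r" by (intro param_lf) simp
  then show ?thesis by blast
qed

lemma smooth_rep_lf: "smooth_variety X (rep_lf n C c \<Omega> r :: (rep_coord \<Rightarrow> 'k::alg_closed_field) set)"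
  by (rule affine_atlas_smooth[OF quasi_affine_rep_lf rep_lf_affine rep_lf_atlas])

lemma krull_dim_rep_lf:
  "krull_dim (var_top X (rep_lf n C c \<Omega> r :: (rep_coord \<Rightarrow> 'k::alg_closed_field) set)) = enat (card chart_coords)"
  by (rule affine_atlas_krull_dim[OF rep_lf_affine rep_lf_atlas rep_lf_nonempty])

text \<open>The function \<open>complete H s\<close> can be nonzero outside X, as it copies entries
  of H at arbitrary indices. It has to be cut off to become a point of affine space, which must not
  change the representation.\<close>

lemma param_cong:
  assumes "\<And>z. z \<in> X \<Longrightarrow> s z = s' z"
  shows "param s = param s'"
proof -
  have E: "arrow_mat d s (Eps i) = arrow_mat d s' (Eps i)" if "i \<in> {1..n}" for i
    using assms that by (auto simp: arrow_mat_def Eps_X intro!: eq_matI)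
  have A: "arrow_mat d s (Alpha i j g) = arrow_mat d s' (Alpha i j g)" if "is_arrow i j g" for i j g
    using assms that by (auto simp: arrow_mat_def Alpha_X intro!: eq_matI)
  let ?m = "\<lambda>s. rep_mats (\<lambda>i. minv (arrow_mat d s (Eps i)) * free_mat (c i) (r i) * arrow_mat d s (Eps i))
     (\<lambda>i. arrow_mat d s (Eps i)) s"
  have "?m s a = ?m s' a" if "(a, p, q) \<in> X" for a p q
  proof (cases a)
    case (Eps i)
    then show ?thesis using that E by (simp add: rep_mats_def Eps_X)
  next
    case (Alpha i j g)
    then have a: "is_arrow i j g" using that by (simp add: Alpha_X)
    then have "i \<in> {1..n}" "j \<in> {1..n}" using \<Omega>_vertices by blast+
    then show ?thesis using Alpha E A[OF a] by (simp add: rep_mats_def)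
  qed
  then show ?thesis by (auto simp: param_def build_rep_def of_mats_def fun_eq_iff)
qed

lemma irreducible_rep_lf:
  "irreducible_space (var_top X (rep_lf n C c \<Omega> r :: (rep_coord \<Rightarrow> 'k::alg_closed_field) set))"
proof -
  define P where "P = {s \<in> affine_space X. (\<Prod>i\<in>{1..n}. det (arrow_mat d (s :: rep_coord \<Rightarrow> 'k) (Eps i))) \<noteq> 0}"
  have P: "P \<subseteq> affine_space X" by (auto simp: P_def)
  have Pd: "det (arrow_mat d s (Eps i)) \<noteq> 0" if "s \<in> P" "i \<in> {1..n}" for s i
    using that by (auto simp: P_def)
  have "rat_on X (affine_space X) (\<lambda>s. \<Prod>i\<in>{1..n}. det (arrow_mat d (s :: rep_coord \<Rightarrow> 'k) (Eps i)))"
    by (intro rat_on_prod rat_on_det[OF rat_mat_Eps] loop_subset_X)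
  then obtain p where p: "p \<in> poly_fun X" "P = {v \<in> affine_space X. p v \<noteq> 0}"
    unfolding P_def using rat_on_openin[OF order_refl] by blast
  have "openin (zariski X) P" unfolding p(2) by (rule openin_zariski_nonzero[OF p(1)])
  have surj: "param ` P = rep_lf n C c \<Omega> r"
  proof (intro equalityI subsetI)
    fix M assume "M \<in> param ` P"
    then show "M \<in> rep_lf n C c \<Omega> r" using param_lf Pd by blast
  next
    fix M :: "rep_coord \<Rightarrow> 'k" assume "M \<in> rep_lf n C c \<Omega> r"
    then obtain H where H: "based H" "M \<in> chart_domain H" using rep_lf_chart_domain by blast
    define s where "s = complete H (\<phi>_chart H M)"
    define s' where "s' z = (if z \<in> X then s z else 0)" for z
    have "param s' = M"
      using param_cong[of s' s] param_\<phi>_chart[OF H] by (simp add: s'_def s_def)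
    moreover have "s' \<in> P"
    proof -
      have "arrow_mat d s' (Eps i) = arrow_mat d s (Eps i)" if "i \<in> {1..n}" for i
        using that by (auto simp: arrow_mat_def s'_def Eps_X intro!: eq_matI)
      then have "(\<Prod>i\<in>{1..n}. det (arrow_mat d s' (Eps i))) = (\<Prod>i\<in>{1..n}. det (arrow_mat d s (Eps i)))"
        by (intro prod.cong) auto
      moreover have "(\<Prod>i\<in>{1..n}. det (arrow_mat d s (Eps i))) \<noteq> 0"
        using \<phi>_chart_range[OF H] unfolding s_def chart_range_def by blast
      ultimately have "(\<Prod>i\<in>{1..n}. det (arrow_mat d s' (Eps i))) \<noteq> 0" by (simp only: not_False_eq_True)
      moreover have "s' \<in> affine_space X" by (simp add: s'_def affine_space_def)
      ultimately show ?thesis unfolding P_def by blast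
    qed
    ultimately show "M \<in> param ` P" by blast
  qed
  then have "P \<noteq> {}" using rep_lf_nonempty by blast
  have "irreducible_space (var_top X (affine_space X \<inter> P))"
  proof (rule irreducible_flat[OF _ _ \<open>openin (zariski X) P\<close>])
    show "affine_space X \<inter> P \<noteq> {}" using P \<open>P \<noteq> {}\<close> by blast
  qed (auto intro: line_affine_space)
  moreover have "affine_space X \<inter> P = P" using P by blast
  moreover have "continuous_map (var_top X P) (var_top X (rep_lf n C c \<Omega> r)) param"
  proof (rule rat_on_continuous_map[OF P rep_lf_affine])
    show "param \<in> P \<rightarrow> rep_lf n C c \<Omega> r" using surj by blast
    show "rat_on X P (\<lambda>x. param x b)" if "b \<in> X" for b
      by (rule rat_on_param[OF Pd rat_on_coord that])
  qed
  moreover have "param ` topspace (var_top X P) = topspace (var_top X (rep_lf n C c \<Omega> r))"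
    unfolding topspace_var_top[OF P] topspace_var_top[OF rep_lf_affine] by (rule surj)
  ultimately show ?thesis using irreducible_space_continuous_image by metis
qed

subsection \<open>The vector bundle\<close>

text \<open>Without \<alpha> arrows a locally free representation is just a family of loops
  conjugate to the standard ones, so facts about \<open>rep_lf\<close> transfer to the base of the
  bundle.\<close>

lemma orbit_free_rep_lf: "orbit_free n c r = rep_lf n C c {} r \<and> loop_coords n d = rep_coords n C {} d"
proof -
  interpret E: lf_data n C c r d "{}" by unfold_locales (auto simp: c_pos d_eq)
  have l: "loop_coords n d = rep_coords n C {} d"
    by (simp add: loop_coords_def rep_coords_def arrows_def)
  have "x \<in> orbit_free n c r \<longleftrightarrow> x \<in> rep_lf n C c {} r" for x
    unfolding orbit_free_iff E.rep_lf_iff E.rep_H_iff l using nilpotent_of_intertwiner by blast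
  with l show ?thesis by blast
qed

lemma quasi_affine_orbit_free:
  "quasi_affine (loop_coords n d) (orbit_free n c r :: (rep_coord \<Rightarrow> 'k::field) set)"
proof -
  interpret E: lf_data n C c r d "{}" by unfold_locales (auto simp: c_pos d_eq)
  show ?thesis using E.quasi_affine_rep_lf orbit_free_rep_lf by metis
qed

lemma orbit_free_affine: "orbit_free n c r \<subseteq> affine_space (loop_coords n d)"
  unfolding orbit_free_iff by (auto simp: orbit_free_iff)

lemma arrow_mat_pi_bar: "i \<in> {1..n} \<Longrightarrow> arrow_mat d (pi_bar n d M) (Eps i) = arrow_mat d M (Eps i)"
  by (auto simp: arrow_mat_def pi_bar_def Eps_loop intro!: eq_matI)

text \<open>The frame depends on the loops only. Chart domains are therefore unions of whole fibres,
  the preimages of open subsets of the base.\<close>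

lemma hdet_pi_bar: "hdet H (pi_bar n d M) = hdet H M"
  unfolding hdet_def by (intro prod.cong) (auto simp: arrow_mat_pi_bar)

lemma pi_bar_orbit: "M \<in> rep_lf n C c \<Omega> r \<Longrightarrow> pi_bar n d M \<in> orbit_free n c r"
  unfolding orbit_free_iff rep_lf_iff
  by (auto simp: arrow_mat_pi_bar) (auto simp: pi_bar_def affine_space_def)

lemma pi_bar_eqI:
  assumes "b \<in> affine_space (loop_coords n d)"
    and "\<And>i. i \<in> {1..n} \<Longrightarrow> arrow_mat d M (Eps i) = arrow_mat d b (Eps i)"
  shows "pi_bar n d M = b"
proof
  fix z :: rep_coord
  obtain a p q where z: "z = (a, p, q)" by (cases z) auto
  show "pi_bar n d M z = b z"
  proof (cases "z \<in> loop_coords n d")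
    case True
    then obtain i where i: "a = Eps i" using Alpha_loop by (cases a) (auto simp: z)
    with True have ipq: "i \<in> {1..n}" "p < d i" "q < d i" by (auto simp: z Eps_loop)
    then have "M z = b z" using assms(2)[OF ipq(1)] arrow_mat_entry(1)[OF ipq(2,3)] by (metis z i)
    then show ?thesis using True by (simp add: pi_bar_def)
  next
    case False
    then show ?thesis using affine_spaceD[OF assms(1)] by (simp add: pi_bar_def)
  qed
qed

lemma pi_bar_eqD:
  "pi_bar n d M = pi_bar n d M' \<Longrightarrow> i \<in> {1..n} \<Longrightarrow> arrow_mat d M (Eps i) = arrow_mat d M' (Eps i)"
  using arrow_mat_pi_bar by metis

lemma arrow_mat_fibre:
  "i \<in> {1..n} \<Longrightarrow> arrow_mat d (fibre_add n d M M') (Eps i) = arrow_mat d M (Eps i)"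
  "arrow_mat d (fibre_add n d M M') (Alpha i j g) =
    arrow_mat d M (Alpha i j g) + arrow_mat d M' (Alpha i j g)"
  "i \<in> {1..n} \<Longrightarrow> arrow_mat d (fibre_scale n d t M) (Eps i) = arrow_mat d M (Eps i)"
  "arrow_mat d (fibre_scale n d t M) (Alpha i j g) = t \<cdot>\<^sub>m arrow_mat d M (Alpha i j g)"
  by (auto simp: arrow_mat_def fibre_add_def fibre_scale_def Eps_loop Alpha_loop intro!: eq_matI)

lemma pi_bar_fibre: "pi_bar n d (fibre_add n d M M') = pi_bar n d M"
  "pi_bar n d (fibre_scale n d t M) = pi_bar n d M"
  by (auto simp: pi_bar_def fibre_add_def fibre_scale_def)

text \<open>Once the loops are fixed, the relation of an \<alpha> arrow is linear in its
  matrix.\<close>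

lemma fibre_add_rep_lf:
  assumes M: "M \<in> rep_lf n C c \<Omega> r" "M' \<in> rep_lf n C c \<Omega> r" and eq: "pi_bar n d M = pi_bar n d M'"
  shows "fibre_add n d M M' \<in> rep_lf n C c \<Omega> r"
  unfolding rep_lf_iff rep_H_iff
proof (intro conjI ballI allI impI)
  show "fibre_add n d M M' \<in> affine_space X"
  proof -
    have "M \<in> affine_space X" "M' \<in> affine_space X" using M rep_lf_affine by blast+
    then show ?thesis using loop_subset_X by (auto simp: affine_space_def fibre_add_def)
  qed
  show "arrow_mat d (fibre_add n d M M') (Eps i) ^\<^sub>m c i = 0\<^sub>m (d i) (d i)" if "i \<in> {1..n}" for i
    unfolding arrow_mat_fibre(1)[OF that] using M(1) that by (auto simp: rep_lf_iff rep_H_iff)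
  show "\<exists>h. intertwiner i (arrow_mat d (fibre_add n d M M') (Eps i)) h" if "i \<in> {1..n}" for i
    unfolding arrow_mat_fibre(1)[OF that] using M(1) that by (auto simp: rep_lf_iff)
  fix i j g assume a: "is_arrow i j g"
  have i: "i \<in> {1..n}" and j: "j \<in> {1..n}" using \<Omega>_vertices a by blast+
  let ?P = "arrow_mat d M (Eps i) ^\<^sub>m ff C j i" and ?Q = "arrow_mat d M (Eps j) ^\<^sub>m ff C i j"
  let ?A = "arrow_mat d M (Alpha i j g)" and ?B = "arrow_mat d M' (Alpha i j g)"
  have P: "?P \<in> carrier_mat (d i) (d i)" and Q: "?Q \<in> carrier_mat (d j) (d j)"
    by (intro pow_carrier_mat arrow_mat_carrier)+
  note A = arrow_mat_carrier(2)[of M i j g] and B = arrow_mat_carrier(2)[of M' i j g]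
  have "?P * ?A = ?A * ?Q" using M(1) a by (auto simp: rep_lf_iff rep_H_iff)
  moreover have "?P * ?B = ?B * ?Q"
    unfolding pi_bar_eqD[OF eq i] pi_bar_eqD[OF eq j] using M(2) a by (auto simp: rep_lf_iff rep_H_iff)
  ultimately show "arrow_mat d (fibre_add n d M M') (Eps i) ^\<^sub>m ff C j i * arrow_mat d (fibre_add n d M M') (Alpha i j g) =
      arrow_mat d (fibre_add n d M M') (Alpha i j g) * arrow_mat d (fibre_add n d M M') (Eps j) ^\<^sub>m ff C i j"
    unfolding arrow_mat_fibre(1)[OF i] arrow_mat_fibre(1)[OF j] arrow_mat_fibre(2)
      mult_add_distrib_mat[OF P A B] add_mult_distrib_mat[OF A B Q] by simp
qed

lemma fibre_scale_rep_lf: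
  assumes M: "M \<in> rep_lf n C c \<Omega> r"
  shows "fibre_scale n d t M \<in> rep_lf n C c \<Omega> r"
  unfolding rep_lf_iff rep_H_iff
proof (intro conjI ballI allI impI)
  show "fibre_scale n d t M \<in> affine_space X"
  proof -
    have "M \<in> affine_space X" using M rep_lf_affine by blast
    then show ?thesis using loop_subset_X by (auto simp: affine_space_def fibre_scale_def)
  qed
  show "arrow_mat d (fibre_scale n d t M) (Eps i) ^\<^sub>m c i = 0\<^sub>m (d i) (d i)" if "i \<in> {1..n}" for i
    unfolding arrow_mat_fibre(3)[OF that] using M that by (auto simp: rep_lf_iff rep_H_iff)
  show "\<exists>h. intertwiner i (arrow_mat d (fibre_scale n d t M) (Eps i)) h" if "i \<in> {1..n}" for i
    unfolding arrow_mat_fibre(3)[OF that] using M that by (auto simp: rep_lf_iff)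
  fix i j g assume a: "is_arrow i j g"
  have i: "i \<in> {1..n}" and j: "j \<in> {1..n}" using \<Omega>_vertices a by blast+
  let ?P = "arrow_mat d M (Eps i) ^\<^sub>m ff C j i" and ?Q = "arrow_mat d M (Eps j) ^\<^sub>m ff C i j"
  let ?A = "arrow_mat d M (Alpha i j g)"
  have P: "?P \<in> carrier_mat (d i) (d i)" and Q: "?Q \<in> carrier_mat (d j) (d j)"
    by (intro pow_carrier_mat arrow_mat_carrier)+
  note A = arrow_mat_carrier(2)[of M i j g]
  have "?P * ?A = ?A * ?Q" using M a by (auto simp: rep_lf_iff rep_H_iff)
  then show "arrow_mat d (fibre_scale n d t M) (Eps i) ^\<^sub>m ff C j i * arrow_mat d (fibre_scale n d t M) (Alpha i j g) =
      arrow_mat d (fibre_scale n d t M) (Alpha i j g) * arrow_mat d (fibre_scale n d t M) (Eps j) ^\<^sub>m ff C i j"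
    unfolding arrow_mat_fibre(3)[OF i] arrow_mat_fibre(3)[OF j] arrow_mat_fibre(4)
      mult_smult_distrib[OF P A] mult_smult_assoc_mat[OF A Q] by simp
qed

text \<open>On a fibre the frame is constant, and the coordinates are entries of the arrow matrix
  times one fixed inverse.\<close>

lemma \<phi>_chart_fibre:
  assumes H: "based H" and M: "M \<in> chart_domain H" and z: "z \<in> alpha_coords"
  shows "pi_bar n d M = pi_bar n d M' \<Longrightarrow>
      \<phi>_chart H (fibre_add n d M M') z = \<phi>_chart H M z + \<phi>_chart H M' z"
    and "\<phi>_chart H (fibre_scale n d t M) z = t * \<phi>_chart H M z"
proof -
  obtain i j g p q where z': "z = (Alpha i j g, p, q)"
    using z by (auto simp: alpha_coords_def)
  have zc: "(Alpha i j g, p, q) \<in> chart_coords" using z by (simp add: z' Alpha_chart)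
  have pq: "p < d i" "q < d j" and j: "j \<in> {1..n}" using z \<Omega>_vertices by (auto simp: z' Alpha_alpha)
  have "det (hm H M j) \<noteq> 0" using M j by (auto simp: chart_domain_def hdet_nonzero)
  then have m: "minv (hm H M j) \<in> carrier_mat (d j) (d j)" by (intro minv_carrier) simp
  note A = arrow_mat_carrier(2)[of _ i j g]
  show "\<phi>_chart H (fibre_add n d M M') z = \<phi>_chart H M z + \<phi>_chart H M' z" if "pi_bar n d M = pi_bar n d M'"
  proof -
    have "(arrow_mat d M (Alpha i j g) + arrow_mat d M' (Alpha i j g)) * minv (hm H M j) =
        arrow_mat d M (Alpha i j g) * minv (hm H M j) + arrow_mat d M' (Alpha i j g) * minv (hm H M j)"
      by (rule add_mult_distrib_mat[OF A A m])
    then show ?thesis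
      using pq zc j pi_bar_eqD[OF that j] m by (simp add: \<phi>_chart_def z' arrow_mat_fibre carrier_matD[OF A])
  qed
  have "t \<cdot>\<^sub>m arrow_mat d M (Alpha i j g) * minv (hm H M j) = t \<cdot>\<^sub>m (arrow_mat d M (Alpha i j g) * minv (hm H M j))"
    by (rule mult_smult_assoc_mat[OF A m])
  then show "\<phi>_chart H (fibre_scale n d t M) z = t * \<phi>_chart H M z"
    using pq zc j m by (simp add: \<phi>_chart_def z' arrow_mat_fibre carrier_matD[OF A])
qed

text \<open>The base is not parametrized here: a point is sent to its loops and its \<alpha>
  coordinates, and the inverse rebuilds the arrows with the frame \<open>hm H b\<close> that the
  loops b determine.\<close>

lemma local_trivialization:
  fixes H :: "nat \<Rightarrow> 'k::alg_closed_field mat" and \<iota> :: "nat \<Rightarrow> rep_coord"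
  assumes H: "based H" and \<iota>: "bij_betw \<iota> {..<e} alpha_coords"
  defines "U \<equiv> {b \<in> orbit_free n c r. hdet H b \<noteq> 0}"
    and "\<tau> \<equiv> \<lambda>M k. if k < e then \<phi>_chart H M (\<iota> k) else 0"
  shows "variety_iso X {x \<in> rep_lf n C c \<Omega> r. pi_bar n d x \<in> U} (loop_coords n d <+> {..<e})
    (var_prod U (affine_space {..<e})) (\<lambda>x. case_sum (pi_bar n d x) (\<tau> x))"
proof -
  let ?Y = "loop_coords n d <+> {..<e}" and ?W = "var_prod U (affine_space {..<e})"
  let ?\<Phi> = "\<lambda>x. case_sum (pi_bar n d x) (\<tau> x)"
  have dom: "{x \<in> rep_lf n C c \<Omega> r. pi_bar n d x \<in> U} = chart_domain H"
    using pi_bar_orbit by (auto simp: U_def chart_domain_def hdet_pi_bar)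
  have dX: "chart_domain H \<subseteq> affine_space X" using rep_lf_affine by (auto simp: chart_domain_def)
  have W: "?W \<subseteq> affine_space ?Y"
  proof
    fix y assume "y \<in> ?W"
    then obtain b t where y: "y = case_sum b t" and b: "b \<in> U" and t: "t \<in> affine_space {..<e}"
      by (auto simp: var_prod_def)
    have b: "b \<in> affine_space (loop_coords n d)" using b orbit_free_affine by (auto simp: U_def)
    have "y a = 0" if "a \<notin> ?Y" for a
    proof (cases a)
      case (Inl z)
      then have "z \<notin> loop_coords n d" using that by blast
      then show ?thesis using affine_spaceD[OF b] Inl by (simp add: y)
    next
      case (Inr k)
      then have "k \<notin> {..<e}" using that by blast
      then show ?thesis using affine_spaceD[OF t] Inr by (simp add: y)
    qed
    then show "y \<in> affine_space ?Y" by (simp add: affine_space_def)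
  qed
  define idx where "idx = inv_into {..<e} \<iota>"
  have idx: "idx z < e" "\<iota> (idx z) = z" if "z \<in> alpha_coords" for z
    using \<iota> that inv_into_into[of z \<iota> "{..<e}"] f_inv_into_f[of z \<iota> "{..<e}"]
    by (auto simp: idx_def bij_betw_def)
  have \<iota>_idx: "\<iota> k \<in> alpha_coords" "idx (\<iota> k) = k" if "k < e" for k
    using \<iota> that by (auto simp: idx_def bij_betw_def)
  \<comment> \<open>The fibre coordinates are placed at the entries of the generator columns, with 0
    elsewhere; \<open>idx\<close> inverts the numbering \<iota>.\<close>
  define gen where "gen w z = (if z \<in> alpha_coords then w (Inr (idx z)) else 0)" for w :: "rep_coord + nat \<Rightarrow> 'k" and z
  define \<Psi> where "\<Psi> w = build_rep (\<lambda>i. arrow_mat d (w \<circ> Inl) (Eps i)) (hm H (w \<circ> Inl)) (gen w)"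
    for w :: "rep_coord + nat \<Rightarrow> 'k"
  have it: "intertwiner i (arrow_mat d b (Eps i)) (hm H b i)" if b: "b \<in> U" and i: "i \<in> {1..n}" for b i
  proof (rule intertwiner_hm[OF H i])
    obtain h where "intertwiner i (arrow_mat d b (Eps i)) h"
      using b i unfolding U_def orbit_free_iff by blast
    then show "arrow_mat d b (Eps i) ^\<^sub>m c i = 0\<^sub>m (d i) (d i)" by (rule nilpotent_of_intertwiner)
    show "hdet H b \<noteq> 0" using b by (simp add: U_def)
  qed
  have \<Psi>: "\<Psi> (case_sum b t) \<in> chart_domain H" "pi_bar n d (\<Psi> (case_sum b t)) = b" "\<tau> (\<Psi> (case_sum b t)) = t"
    if b: "b \<in> U" and t: "t \<in> affine_space {..<e}" for b t
  proof -
    have w: "case_sum b t \<circ> Inl = b" by auto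
    note B = arrow_mat_carrier(1) it[OF b]
    have E: "arrow_mat d (\<Psi> (case_sum b t)) (Eps i) = arrow_mat d b (Eps i)" if "i \<in> {1..n}" for i
      unfolding \<Psi>_def w by (rule build_rep_Eps[OF B that])
    have "b \<in> affine_space (loop_coords n d)" using b orbit_free_affine by (auto simp: U_def)
    then show pi: "pi_bar n d (\<Psi> (case_sum b t)) = b" by (rule pi_bar_eqI) (rule E)
    have "\<Psi> (case_sum b t) \<in> rep_lf n C c \<Omega> r" unfolding \<Psi>_def w by (rule build_rep_lf[OF B])
    then show "\<Psi> (case_sum b t) \<in> chart_domain H" using b pi by (simp flip: dom)
    show "\<tau> (\<Psi> (case_sum b t)) = t"
    proof
      fix k
      show "\<tau> (\<Psi> (case_sum b t)) k = t k"
      proof (cases "k < e")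
        case True
        obtain i j g p q where z: "\<iota> k = (Alpha i j g, p, q)"
          using \<iota>_idx(1)[OF True] by (auto simp: alpha_coords_def)
        have zc: "(Alpha i j g, p, q) \<in> chart_coords" using \<iota>_idx(1)[OF True] by (simp add: z Alpha_chart)
        have a: "is_arrow i j g" "p < d i" "q < d j" "q mod c j < ff C i j"
          using \<iota>_idx(1)[OF True] by (auto simp: z Alpha_alpha)
        have i: "i \<in> {1..n}" and j: "j \<in> {1..n}" using \<Omega>_vertices a by blast+
        have "arrow_mat d (\<Psi> (case_sum b t)) (Alpha i j g) * minv (hm H b j) =
            hom_extend (c j) (ff C i j) (d i) (d j) (arrow_mat d b (Eps i) ^\<^sub>m ff C j i)
              (arrow_mat d (gen (case_sum b t)) (Alpha i j g))"
          unfolding \<Psi>_def w by (rule build_rep_Alpha[OF B a(1)])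
        then have "\<phi>_chart H (\<Psi> (case_sum b t)) (\<iota> k) = arrow_mat d (gen (case_sum b t)) (Alpha i j g) $$ (p, q)"
          using zc E[OF j] hom_extend_generator[OF pow_carrier_mat[OF arrow_mat_carrier(1)] arrow_mat_carrier(2) a(2,3,4)]
          by (simp add: \<phi>_chart_def z)
        also have "\<dots> = gen (case_sum b t) (\<iota> k)" using arrow_mat_entry(2)[OF a(2,3)] by (simp add: z)
        also have "\<dots> = t k" using \<iota>_idx[OF True] by (simp add: gen_def)
        finally show ?thesis using True by (simp add: \<tau>_def)
      next
        case False
        then show ?thesis using t by (simp add: \<tau>_def affine_space_def)
      qed
    qed
  qed
  have reg1: "regular_map X (chart_domain H) ?Y ?W ?\<Phi>"
  proof (rule rat_on_regular_map[OF dX])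
    show "?\<Phi> \<in> chart_domain H \<rightarrow> ?W"
    proof
      fix x assume "x \<in> chart_domain H"
      then have "pi_bar n d x \<in> U" by (simp flip: dom)
      moreover have "\<tau> x \<in> affine_space {..<e}" by (simp add: \<tau>_def affine_space_def)
      ultimately show "?\<Phi> x \<in> ?W" unfolding var_prod_def by blast
    qed
    fix b assume "b \<in> ?Y"
    then show "rat_on X (chart_domain H) (\<lambda>x. ?\<Phi> x b)"
    proof (elim PlusE)
      fix z assume z: "z \<in> loop_coords n d" "b = Inl z"
      then have "rat_on X (chart_domain H) (\<lambda>x. x z)" using loop_subset_X by (intro rat_on_coord) blast
      then show ?thesis using z by (simp add: pi_bar_def)
    next
      fix k assume k: "k \<in> {..<e}" "b = Inr k"
      then have "\<iota> k \<in> chart_coords" using \<iota>_idx(1) by (auto simp: chart_coords_def)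
      then show ?thesis using rat_on_\<phi>_chart[OF H] k by (simp add: \<tau>_def)
    qed
  qed
  have reg2: "regular_map ?Y ?W X (chart_domain H) \<Psi>"
  proof (rule rat_on_regular_map[OF W])
    show "\<Psi> \<in> ?W \<rightarrow> chart_domain H" using \<Psi>(1) by (auto simp: var_prod_def)
    fix z assume z: "z \<in> X"
    have N: "rat_mat ?Y ?W (d i) (d i) (\<lambda>w. arrow_mat d (w \<circ> Inl) (Eps i))" if "i \<in> {1..n}" for i
      unfolding rat_mat_def using that
      by (auto simp: arrow_mat_carrier arrow_mat_entry Eps_loop intro!: rat_on_coord)
    have rg: "rat_on ?Y ?W (\<lambda>w. gen w z)" for z
      by (cases "z \<in> alpha_coords") (auto simp: gen_def idx intro!: rat_on_coord)
    show "rat_on ?Y ?W (\<lambda>w. \<Psi> w z)"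
      unfolding \<Psi>_def
    proof (rule rat_on_build_rep[OF N _ _ z])
      show "rat_mat ?Y ?W (d i) (d i) (\<lambda>w. hm H (w \<circ> Inl) i)" if "i \<in> {1..n}" for i
        by (rule rat_mat_hmat[OF N[OF that]]) (use H that in \<open>simp add: based_def\<close>)
      show "rat_mat ?Y ?W (d i) (d j) (\<lambda>w. arrow_mat d (gen w) (Alpha i j g))" if "is_arrow i j g" for i j g
        unfolding rat_mat_def
        by (auto simp: arrow_mat_carrier arrow_mat_entry intro!: rg)
    qed
  qed
  have inv1: "\<Psi> (?\<Phi> x) = x" if x: "x \<in> chart_domain H" for x
    unfolding \<Psi>_def
  proof (rule build_rep_eqI)
    have w: "?\<Phi> x \<circ> Inl = pi_bar n d x" by auto
    have xU: "pi_bar n d x \<in> U" using x by (simp flip: dom)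
    show "x \<in> rep_H n C c \<Omega> d" using x rep_lf_rep_H by (auto simp: chart_domain_def)
    show "arrow_mat d (?\<Phi> x \<circ> Inl) (Eps i) = arrow_mat d x (Eps i)" if "i \<in> {1..n}" for i
      unfolding w by (rule arrow_mat_pi_bar[OF that])
    show "intertwiner i (arrow_mat d (?\<Phi> x \<circ> Inl) (Eps i)) (hm H (?\<Phi> x \<circ> Inl) i)" if "i \<in> {1..n}" for i
      unfolding w by (rule it[OF xU that])
    fix i j g p q assume a: "(Alpha i j g, p, q) \<in> alpha_coords"
    then have j: "j \<in> {1..n}" using \<Omega>_vertices by (auto simp: Alpha_alpha)
    have "gen (?\<Phi> x) (Alpha i j g, p, q) = \<phi>_chart H x (Alpha i j g, p, q)"
      using a idx by (simp add: gen_def \<tau>_def)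
    then show "gen (?\<Phi> x) (Alpha i j g, p, q) =
        (arrow_mat d x (Alpha i j g) * minv (hm H (?\<Phi> x \<circ> Inl) j)) $$ (p, q)"
      unfolding w arrow_mat_pi_bar[OF j] using a Alpha_chart[of i j g p q] by (simp add: \<phi>_chart_def)
  qed
  have inv2: "?\<Phi> (\<Psi> y) = y" if y: "y \<in> ?W" for y
  proof -
    obtain b t where bt: "y = case_sum b t" "b \<in> U" "t \<in> affine_space {..<e}"
      using y by (auto simp: var_prod_def)
    show ?thesis unfolding bt(1) \<Psi>(2,3)[OF bt(2,3)] ..
  qed
  show ?thesis
    unfolding variety_iso_def dom
    by (intro conjI exI[of _ \<Psi>] ballI reg1 reg2 inv1 inv2)
qed

lemma vector_bundle_rep_lf:
  "vector_bundle X (rep_lf n C c \<Omega> r :: (rep_coord \<Rightarrow> 'k::alg_closed_field) set)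
     (loop_coords n d) (orbit_free n c r) (pi_bar n d) (fibre_add n d) (fibre_scale n d) (card alpha_coords)"
  unfolding vector_bundle_def
proof (intro conjI ballI allI impI quasi_affine_rep_lf quasi_affine_orbit_free)
  let ?V = "rep_lf n C c \<Omega> r :: (rep_coord \<Rightarrow> 'k) set" and ?e = "card alpha_coords"
  show "regular_map X ?V (loop_coords n d) (orbit_free n c r) (pi_bar n d)"
  proof (rule rat_on_regular_map[OF rep_lf_affine])
    show "pi_bar n d \<in> ?V \<rightarrow> orbit_free n c r" using pi_bar_orbit by blast
    fix b assume b: "b \<in> loop_coords n d"
    then have "rat_on X ?V (\<lambda>x. x b)" using loop_subset_X by (intro rat_on_coord) blast
    with b show "rat_on X ?V (\<lambda>x. pi_bar n d x b)" by (simp add: pi_bar_def)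
  qed
  show "fibre_add n d x x' \<in> ?V" if "x \<in> ?V" "x' \<in> ?V" "pi_bar n d x = pi_bar n d x'" for x x'
    by (rule fibre_add_rep_lf[OF that])
  show "pi_bar n d (fibre_add n d x x') = pi_bar n d x" for x x' :: "rep_coord \<Rightarrow> 'k"
    by (rule pi_bar_fibre)
  show "fibre_scale n d t x \<in> ?V" if "x \<in> ?V" for t x by (rule fibre_scale_rep_lf[OF that])
  show "pi_bar n d (fibre_scale n d t x) = pi_bar n d x" for t and x :: "rep_coord \<Rightarrow> 'k"
    by (rule pi_bar_fibre)
  fix b :: "rep_coord \<Rightarrow> 'k" assume b: "b \<in> orbit_free n c r"
  then obtain H where H: "based H" "hdet H b \<noteq> 0" using ex_based unfolding orbit_free_iff by blast
  obtain \<iota> where \<iota>: "bij_betw \<iota> {..<?e} alpha_coords"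
    using ex_bij_betw_nat_finite[OF finite_alpha] by (auto simp: atLeast0LessThan)
  define U where "U = {b \<in> orbit_free n c r. hdet H b \<noteq> 0}"
  define \<tau> where "\<tau> = (\<lambda>M k. if k < ?e then \<phi>_chart H M (\<iota> k) else 0)"
  have \<iota>_alpha: "\<iota> k \<in> alpha_coords" if "k < ?e" for k using \<iota> that by (auto simp: bij_betw_def)
  have dom: "x \<in> chart_domain H" if "x \<in> ?V" "pi_bar n d x \<in> U" for x
    using that by (auto simp: chart_domain_def U_def hdet_pi_bar)
  have "openin (var_top (loop_coords n d) (orbit_free n c r)) U"
  proof -
    obtain p where p: "p \<in> poly_fun (loop_coords n d)" "U = {v \<in> orbit_free n c r. p v \<noteq> 0}"
      unfolding U_def using rat_on_openin[OF orbit_free_affine rat_on_hdet[OF H(1) order_refl]] by blast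
    then show ?thesis unfolding openin_var_top[OF orbit_free_affine] by blast
  qed
  moreover have "b \<in> U" using b H by (simp add: U_def)
  moreover have "variety_iso X {x \<in> ?V. pi_bar n d x \<in> U} (loop_coords n d <+> {..<?e})
      (var_prod U (affine_space {..<?e})) (\<lambda>x. case_sum (pi_bar n d x) (\<tau> x))"
    unfolding U_def \<tau>_def by (rule local_trivialization[OF H(1) \<iota>])
  moreover have "\<tau> (fibre_add n d x x') = \<tau> x + \<tau> x'"
    if "x \<in> ?V" "pi_bar n d x \<in> U \<and> pi_bar n d x = pi_bar n d x'" for x x'
  proof
    fix k
    show "\<tau> (fibre_add n d x x') k = (\<tau> x + \<tau> x') k"
    proof (cases "k < ?e")
      case True
      have "x \<in> chart_domain H" using dom that by blast
      from \<phi>_chart_fibre(1)[OF H(1) this \<iota>_alpha[OF True] conjunct2[OF that(2)]] True show ?thesis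
        by (simp add: \<tau>_def)
    qed (simp add: \<tau>_def)
  qed
  moreover have "\<tau> (fibre_scale n d t x) = fun_scale t (\<tau> x)" if "x \<in> ?V" "pi_bar n d x \<in> U" for t x
  proof
    fix k
    show "\<tau> (fibre_scale n d t x) k = fun_scale t (\<tau> x) k"
      using \<phi>_chart_fibre(2)[OF H(1) dom \<iota>_alpha, of x k t] that by (simp add: \<tau>_def fun_scale_def)
  qed
  ultimately show "\<exists>U \<tau>. openin (var_top (loop_coords n d) (orbit_free n c r)) U \<and> b \<in> U \<and>
      variety_iso X {x \<in> ?V. pi_bar n d x \<in> U} (loop_coords n d <+> {..<?e})
        (var_prod U (affine_space {..<?e})) (\<lambda>x. case_sum (pi_bar n d x) (\<tau> x)) \<and>
      (\<forall>x\<in>?V. \<forall>x'\<in>?V. pi_bar n d x \<in> U \<and> pi_bar n d x = pi_bar n d x' \<longrightarrow>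
        \<tau> (fibre_add n d x x') = \<tau> x + \<tau> x') \<and>
      (\<forall>a. \<forall>x\<in>?V. pi_bar n d x \<in> U \<longrightarrow> \<tau> (fibre_scale n d a x) = fun_scale a (\<tau> x))"
    by (intro exI[of _ U] exI[of _ \<tau>] conjI ballI allI impI)
qed

subsection \<open>The group\<close>

definition group_mat :: "(nat \<times> nat \<times> nat \<Rightarrow> 'k) \<Rightarrow> nat \<Rightarrow> 'k mat" where
  "group_mat x i = mat (d i) (d i) (\<lambda>(p, q). x (i, p, q))"

lemma finite_G_coords: "finite (G_coords n d)"
proof -
  have "G_coords n d = (SIGMA i:{1..n}. {..<d i} \<times> {..<d i})" by (auto simp: G_coords_def)
  then show ?thesis by simp
qed

lemma card_G_coords: "card (G_coords n d) = (\<Sum>i\<in>{1..n}. d i * d i)"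
proof -
  have "G_coords n d = (SIGMA i:{1..n}. {..<d i} \<times> {..<d i})" by (auto simp: G_coords_def)
  then show ?thesis by (simp add: card_cartesian_product)
qed

lemma rat_mat_group_mat:
  "i \<in> {1..n} \<Longrightarrow> rat_mat (G_coords n d) W (d i) (d i) (\<lambda>x. group_mat x i)"
  unfolding rat_mat_def by (auto simp: group_mat_def G_coords_def intro!: rat_on_coord)

lemma G_var_eq: "G_var n d = {x \<in> affine_space (G_coords n d). (\<Prod>i\<in>{1..n}. det (group_mat x i)) \<noteq> 0}"
  by (auto simp: G_var_def group_mat_def carrier_GL)

text \<open>The product of the determinants cuts out an open subset of the affine space of all
  tuples of matrices.\<close>

lemma krull_dim_G_var:
  "krull_dim (var_top (G_coords n d) (G_var n d :: (nat \<times> nat \<times> nat \<Rightarrow> 'k::alg_closed_field) set)) =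
    enat (card (G_coords n d))"
proof (rule krull_dim_open_affine[OF finite_G_coords])
  have "rat_on (G_coords n d) (affine_space (G_coords n d))
      (\<lambda>x. \<Prod>i\<in>{1..n}. det (group_mat (x :: nat \<times> nat \<times> nat \<Rightarrow> 'k) i))"
    by (intro rat_on_prod rat_on_det[OF rat_mat_group_mat])
  then obtain p where p: "p \<in> poly_fun (G_coords n d)"
    "(G_var n d :: (nat \<times> nat \<times> nat \<Rightarrow> 'k) set) = {v \<in> affine_space (G_coords n d). p v \<noteq> 0}"
    unfolding G_var_eq using rat_on_openin[OF order_refl] by blast
  show "openin (zariski (G_coords n d)) (G_var n d :: (nat \<times> nat \<times> nat \<Rightarrow> 'k) set)"
    unfolding p(2) by (rule openin_zariski_nonzero[OF p(1)])
  define x :: "nat \<times> nat \<times> nat \<Rightarrow> 'k"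
    where "x = (\<lambda>(i, p, q). if (i, p, q) \<in> G_coords n d \<and> p = q then 1 else 0)"
  have "group_mat x i = 1\<^sub>m (d i)" if "i \<in> {1..n}" for i
    using that by (intro eq_matI) (auto simp: group_mat_def x_def G_coords_def)
  moreover have "x \<in> affine_space (G_coords n d)" by (auto simp: affine_space_def x_def)
  ultimately have "x \<in> G_var n d" unfolding G_var_eq by simp
  then show "(G_var n d :: (nat \<times> nat \<times> nat \<Rightarrow> 'k) set) \<noteq> {}" by blast
qed


subsection \<open>Orbits\<close>

text \<open>With \<open>minv\<close> in place of the group inverse the action is defined for
  arbitrary matrices, and its entries are rational in those of g.\<close>

definition mat_act :: "(nat \<Rightarrow> 'k::field mat) \<Rightarrow> (rep_coord \<Rightarrow> 'k) \<Rightarrow> rep_coord \<Rightarrow> 'k" where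
  "mat_act g M = of_mats (\<lambda>a. g (target a) * arrow_mat d M a * minv (g (source a)))"

lemma X_vertices: "(a, p, q) \<in> X \<Longrightarrow> target a \<in> {1..n} \<and> source a \<in> {1..n}"
  using \<Omega>_vertices by (cases a) (auto simp: Eps_X Alpha_X)

lemma mat_act_cong:
  assumes "\<And>a p q. (a, p, q) \<in> X \<Longrightarrow>
    g (target a) * arrow_mat d M a * minv (g (source a)) = g' (target a) * arrow_mat d M a * minv (g' (source a))"
  shows "mat_act g M = mat_act g' M"
  using assms by (auto simp: mat_act_def of_mats_def fun_eq_iff)

lemma carrier_G_grp:
  "g \<in> carrier (G_grp n d) \<Longrightarrow> i \<in> {1..n} \<Longrightarrow> g i \<in> carrier_mat (d i) (d i) \<and> det (g i) \<noteq> (0 :: 'k::field)"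
  unfolding G_grp_def by (auto simp: PiE_iff carrier_GL)

lemma G_act_eq_mat_act:
  assumes g: "g \<in> carrier (G_grp n d)"
  shows "G_act n C \<Omega> d g M = mat_act g M"
proof -
  have "inv\<^bsub>GL (d i)\<^esub> (g i) = minv (g i)" if "i \<in> {1..n}" for i
    using carrier_G_grp[OF g that] by (intro inv_GL) (simp add: carrier_GL)
  then show ?thesis
    using X_vertices by (auto simp: G_act_def mat_act_def of_mats_def fun_eq_iff)
qed

lemma orbit_self:
  assumes M: "M \<in> affine_space X"
  shows "M \<in> orbit (G_grp n d) (G_act n C \<Omega> d) (M :: rep_coord \<Rightarrow> 'k::field)"
proof -
  define g :: "nat \<Rightarrow> 'k mat" where "g = (\<lambda>i\<in>{1..n}. 1\<^sub>m (d i))"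
  have g: "g \<in> carrier (G_grp n d)" unfolding G_grp_def by (auto simp: g_def carrier_GL)
  have one: "g i = 1\<^sub>m (d i)" "minv (g i) = 1\<^sub>m (d i)" if "i \<in> {1..n}" for i
    using that by (auto simp: g_def intro!: minv_eqI)
  have "mat_act g M = M"
    unfolding mat_act_def
  proof (rule of_mats_eqI[OF M])
    show "g (target (Eps i)) * arrow_mat d M (Eps i) * minv (g (source (Eps i))) = arrow_mat d M (Eps i)"
      if "i \<in> {1..n}" for i
      using one[OF that] arrow_mat_carrier(1)[of M i] by simp
    fix i j g' assume "is_arrow i j g'"
    then have "i \<in> {1..n}" "j \<in> {1..n}" using \<Omega>_vertices by blast+
    then show "g (target (Alpha i j g')) * arrow_mat d M (Alpha i j g') * minv (g (source (Alpha i j g'))) =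
        arrow_mat d M (Alpha i j g')"
      using one arrow_mat_carrier(2)[of M i j g'] by simp
  qed
  then show ?thesis unfolding orbit_def using g G_act_eq_mat_act[OF g] by (metis (mono_tags, lifting) mem_Collect_eq)
qed

lemma rat_on_mat_act:
  assumes W: "W \<subseteq> G_var n d" and z: "z \<in> X"
  shows "rat_on (G_coords n d) W (\<lambda>x. mat_act (group_mat x) M z)"
proof -
  obtain a p q where e: "z = (a, p, q)" by (cases z) auto
  have det: "det (group_mat x i) \<noteq> 0" if "x \<in> W" "i \<in> {1..n}" for x i
    using that W by (auto simp: G_var_eq)
  have v: "target a \<in> {1..n}" "source a \<in> {1..n}" using X_vertices z unfolding e by blast+
  have pq: "p < d (target a)" "q < d (source a)" using z unfolding e by (cases a; auto simp: Eps_X Alpha_X)+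
  have A: "arrow_mat d M a \<in> carrier_mat (d (target a)) (d (source a))" by (simp add: arrow_mat_def)
  have "rat_on (G_coords n d) W (\<lambda>x. (group_mat x (target a) * arrow_mat d M a * minv (group_mat x (source a))) $$ (p, q))"
    by (rule rat_on_mult_entry[OF rat_mat_mult[OF rat_mat_group_mat[OF v(1)] rat_mat_const[OF A]]
          rat_mat_minv[OF rat_mat_group_mat[OF v(2)] det[OF _ v(2)]] pq])
  then show ?thesis using z by (simp add: mat_act_def of_mats_def e)
qed

text \<open>Scalars act trivially, so that one entry of the group element may be normalized to \<open>1\<close>.\<close>

lemma orbit_normalized:
  assumes g: "g \<in> carrier (G_grp n d)" and i: "i \<in> {1..n}" and di: "d i > 0"
  shows "\<exists>p<d i. \<exists>q<d i. \<exists>x\<in>G_var n d. x (i, p, q) = 1 \<and>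
    mat_act (group_mat x) M = G_act n C \<Omega> d g (M :: rep_coord \<Rightarrow> 'k::field)"
proof -
  have gi: "g i \<in> carrier_mat (d i) (d i)" "det (g i) \<noteq> 0" using carrier_G_grp[OF g i] by auto
  \<comment> \<open>A matrix of size 0 has determinant 1 although it is the zero matrix; this is
    where a vertex with positive dimension is used.\<close>
  have "g i \<noteq> 0\<^sub>m (d i) (d i)" using gi(2) di by auto
  then obtain p q where pq: "p < d i" "q < d i" "g i $$ (p, q) \<noteq> 0"
    using gi(1) eq_mat_carrierI[OF gi(1) zero_carrier_mat] by auto
  define k where "k = inverse (g i $$ (p, q))"
  have k: "k \<noteq> 0" using pq by (simp add: k_def)
  define x where "x = (\<lambda>(j, p, q). if (j, p, q) \<in> G_coords n d then k * g j $$ (p, q) else 0)"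
  have gm: "group_mat x j = k \<cdot>\<^sub>m g j" if "j \<in> {1..n}" for j
    using that carrier_G_grp[OF g that]
    by (intro eq_mat_carrierI[of _ "d j" "d j"]) (auto simp: group_mat_def x_def G_coords_def)
  have "det (group_mat x j) \<noteq> 0" if "j \<in> {1..n}" for j
    unfolding gm[OF that] using carrier_G_grp[OF g that] k by simp
  then have "x \<in> G_var n d" unfolding G_var_eq by (auto simp: affine_space_def x_def)
  moreover have "x (i, p, q) = 1" using pq i by (simp add: x_def G_coords_def k_def)
  moreover have "mat_act (group_mat x) M = mat_act g M"
  proof (rule mat_act_cong)
    fix a p q assume "(a, p, q) \<in> X"
    then have v: "target a \<in> {1..n}" "source a \<in> {1..n}" using X_vertices by blast+
    have A: "arrow_mat d M a \<in> carrier_mat (d (target a)) (d (source a))" by (simp add: arrow_mat_def)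
    show "group_mat x (target a) * arrow_mat d M a * minv (group_mat x (source a)) =
        g (target a) * arrow_mat d M a * minv (g (source a))"
      unfolding gm[OF v(1)] gm[OF v(2)]
      by (rule conj_smult[OF _ _ _ A k]) (use carrier_G_grp[OF g] v in auto)
  qed
  ultimately show ?thesis using pq(1,2) G_act_eq_mat_act[OF g] by metis
qed

text \<open>
  If there were finitely many orbits, a chart would be covered by finitely many rational images of
  subsets of affine spaces of dimension \<open>dim G\<^sub>d - 1\<close>, each contained in a hypersurface.
\<close>

lemma infinite_orbits:
  assumes card: "card (G_coords n d) \<le> card chart_coords" and i: "i \<in> {1..n}" and di: "d i > 0"
  shows "infinite (orbits (G_grp n d) (rep_lf n C c \<Omega> r) (G_act n C \<Omega> d :: _ \<Rightarrow> _ \<Rightarrow> rep_coord \<Rightarrow> 'k::alg_closed_field))"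
proof
  let ?V = "rep_lf n C c \<Omega> r :: (rep_coord \<Rightarrow> 'k) set" and ?S = chart_coords
  let ?act = "G_act n C \<Omega> d :: _ \<Rightarrow> _ \<Rightarrow> rep_coord \<Rightarrow> 'k"
  let ?Orb = "orbits (G_grp n d) ?V ?act"
  assume fin: "finite ?Orb"
  obtain M0 where "M0 \<in> ?V" using rep_lf_nonempty by blast
  then obtain H where H: "based H" "M0 \<in> chart_domain H" using rep_lf_chart_domain by blast
  have "\<forall>O'\<in>?Orb. \<exists>M. O' = orbit (G_grp n d) ?act M" unfolding orbits_def by blast
  then obtain m where m: "\<forall>O'\<in>?Orb. O' = orbit (G_grp n d) ?act (m O')" by (rule bchoice[THEN exE])
  \<comment> \<open>The normalized group elements that move the representative of O' into the chart.
    By \<open>orbit_normalized\<close>, for varying p and q they reach every point of the orbit in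
    the chart.\<close>
  define \<Gamma> where "\<Gamma> O' p q = {x \<in> G_var n d. x (i, p, q) = 1 \<and> mat_act (group_mat x) (m O') \<in> chart_domain H}" for O' p q
  define \<theta> where "\<theta> O' x = \<phi>_chart H (mat_act (group_mat x) (m O'))" for O' x
  define I where "I = ?Orb \<times> {..<d i} \<times> {..<d i}"
  have I: "finite I" using fin by (simp add: I_def)
  have "\<exists>F. F \<in> poly_fun ?S \<and> (\<exists>v\<in>affine_space ?S. F v \<noteq> 0) \<and>
      (\<forall>x\<in>\<Gamma> (fst z) (fst (snd z)) (snd (snd z)). F (\<theta> (fst z) x) = 0)" if z: "z \<in> I" for z
  proof -
    obtain O' p q where e: "z = (O', p, q)" by (cases z) auto
    have pq: "p < d i" "q < d i" using z by (auto simp: I_def e)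
    have "rat_on (G_coords n d) (\<Gamma> O' p q) (\<lambda>x. \<theta> O' x b)" if b: "b \<in> ?S" for b
      unfolding \<theta>_def
    proof (rule rat_on_comp[OF rat_on_\<phi>_chart[OF H(1) b]])
      show "rat_on (G_coords n d) (\<Gamma> O' p q) (\<lambda>x. mat_act (group_mat x) (m O') a)" if "a \<in> X" for a
        by (rule rat_on_mat_act[OF _ that]) (auto simp: \<Gamma>_def)
    qed (auto simp: \<Gamma>_def)
    \<comment> \<open>The normalized entry is the variable that is lost, so that it is enough for
      the chart to have at least the dimension of the group.\<close>
    then have "\<exists>F\<in>poly_fun ?S. (\<exists>v\<in>affine_space ?S. F v \<noteq> 0) \<and> (\<forall>x\<in>\<Gamma> O' p q. F (\<theta> O' x) = 0)"
      by (intro rational_relation[OF finite_G_coords _ finite_chart card, of "(i, p, q)"])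
        (use i pq in \<open>auto simp: G_coords_def \<Gamma>_def\<close>)
    then show ?thesis by (auto simp: e)
  qed
  then have "\<forall>z\<in>I. \<exists>F. F \<in> poly_fun ?S \<and> (\<exists>v\<in>affine_space ?S. F v \<noteq> 0) \<and>
      (\<forall>x\<in>\<Gamma> (fst z) (fst (snd z)) (snd (snd z)). F (\<theta> (fst z) x) = 0)" by blast
  then obtain F where F: "\<forall>z\<in>I. F z \<in> poly_fun ?S \<and> (\<exists>v\<in>affine_space ?S. F z v \<noteq> 0) \<and>
      (\<forall>x\<in>\<Gamma> (fst z) (fst (snd z)) (snd (snd z)). F z (\<theta> (fst z) x) = 0)"
    by (rule bchoice[THEN exE])
  have Fp: "F z \<in> poly_fun ?S" and F1: "\<exists>v\<in>affine_space ?S. F z v \<noteq> 0" if "z \<in> I" for z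
    using F that by auto
  have F0: "F (O', p, q) (\<theta> O' x) = 0" if "(O', p, q) \<in> I" "x \<in> \<Gamma> O' p q" for O' p q x
    using F that by force
  \<comment> \<open>The point a lies off all the hypersurfaces and b below lies in the range of the
    chart; some point of the line joining them has both properties and yields a representation that
    no orbit can contain.\<close>
  obtain a where a: "a \<in> affine_space ?S" "(\<Prod>z\<in>I. F z a) \<noteq> 0"
    using poly_fun_prod_nonzero[of I F, OF I Fp F1] by blast
  define b where "b = \<phi>_chart H M0"
  have b: "b \<in> chart_range H" unfolding b_def by (rule \<phi>_chart_range[OF H])
  then obtain \<delta> where \<delta>: "\<delta> \<in> poly_fun ?S" "\<delta> b \<noteq> 0" "{v \<in> affine_space ?S. \<delta> v \<noteq> 0} \<subseteq> chart_range H"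
    using openin_chart_range[of H] unfolding openin_zariski_iff by blast
  have "(\<lambda>v. \<Prod>z\<in>I. F z v) \<in> poly_fun ?S" by (intro poly_fun_prod Fp)
  from line_nonzero[OF this a(2) \<delta>(1,2)]
  obtain t where t: "(\<Prod>z\<in>I. F z (line a b t)) \<noteq> 0" "\<delta> (line a b t) \<noteq> 0" by blast
  define w where "w = line a b t"
  have "b \<in> affine_space ?S" using b by (simp add: chart_range_def)
  then have "w \<in> affine_space ?S" unfolding w_def by (rule line_affine_space[OF a(1)])
  then have w: "w \<in> chart_range H" using \<delta>(3) t(2) unfolding w_def by blast
  define M where "M = param (complete H w)"
  have Md: "M \<in> chart_domain H" unfolding M_def by (rule param_complete_domain[OF H(1) w])
  have Mw: "\<phi>_chart H M = w" unfolding M_def by (rule \<phi>_chart_param[OF H(1) w])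
  have MV: "M \<in> ?V" using Md by (simp add: chart_domain_def)
  define O' where "O' = orbit (G_grp n d) ?act M"
  have O: "O' \<in> ?Orb" unfolding O'_def orbits_def using MV by blast
  have "M \<in> O'" unfolding O'_def by (rule orbit_self) (use MV rep_lf_affine in blast)
  also have "O' = orbit (G_grp n d) ?act (m O')" using m O by (rule bspec)
  finally obtain g where g: "g \<in> carrier (G_grp n d)" "M = ?act g (m O')" unfolding orbit_def by blast
  obtain p q x where x: "p < d i" "q < d i" "x \<in> G_var n d" "x (i, p, q) = 1"
    "mat_act (group_mat x) (m O') = M"
    using orbit_normalized[OF g(1) i di, of "m O'"] unfolding g(2) by blast
  have z: "(O', p, q) \<in> I" using O x by (simp add: I_def)
  have "x \<in> \<Gamma> O' p q" using x Md by (simp add: \<Gamma>_def)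
  from F0[OF z this] have "F (O', p, q) w = 0" using x(5) Mw by (simp add: \<theta>_def)
  then have "(\<Prod>z\<in>I. F z w) = 0" using z I by (intro prod_zero) auto
  then show False using t(1) unfolding w_def by blast
qed

end

section \<open>Cartan matrices and orientations\<close>

text \<open>Dividing c_i |c_ij| = c_j |c_ji| by the greatest common divisor gives c_i f_ij = c_j
  f_ji with coprime f_ij and f_ji. Hence f_ji divides c_i, and the quotient k also satisfies c_j = k
  f_ij.\<close>

lemma orientation_exponents:
  assumes C: "cartan_matrix n C" "symmetrizer n C c" "orientation n C \<Omega>" and ij: "(i, j) \<in> \<Omega>"
  shows "i \<in> {1..n} \<and> j \<in> {1..n}" "C i j < 0"
    "\<exists>k. c i = k * ff C j i \<and> c j = k * ff C i j \<and> ff C i j > 0"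
proof -
  have v: "i \<in> {1..n}" "j \<in> {1..n}" using C(3) ij by (auto simp: orientation_def)
  then show "i \<in> {1..n} \<and> j \<in> {1..n}" by simp
  have "{(i, j), (j, i)} \<inter> \<Omega> \<noteq> {}" "{(j, i), (i, j)} \<inter> \<Omega> \<noteq> {}" using ij by auto
  then have neg: "C i j < 0" "C j i < 0" using C(3) v unfolding orientation_def by blast+
  then show "C i j < 0" by simp
  define a b where "a = nat \<bar>C i j\<bar>" and "b = nat \<bar>C j i\<bar>"
  have ab: "a > 0" "b > 0" "C i j = - int a" "C j i = - int b" using neg by (auto simp: a_def b_def)
  have "int (c i) * C i j = int (c j) * C j i" using C(2) v by (simp add: symmetrizer_def)
  then have cab: "c i * a = c j * b" unfolding ab(3,4) by (metis minus_mult_right neg_equal_iff_equal of_nat_eq_iff of_nat_mult)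
  have g: "gg C i j = gcd a b" "gg C j i = gcd a b"
    unfolding gg_def gcd_int_def a_def b_def by (simp, simp only: gcd.commute[of "nat \<bar>C j i\<bar>"] abs_of_nat nat_int)
  have f: "ff C i j = a div gcd a b" "ff C j i = b div gcd a b"
    unfolding ff_def g a_def b_def by simp_all
  have a': "a = gcd a b * ff C i j" and b': "b = gcd a b * ff C j i" by (simp_all add: f)
  have cop: "coprime (ff C i j) (ff C j i)" unfolding f using ab by (intro div_gcd_coprime) auto
  have "gcd a b * (c i * ff C i j) = c i * (gcd a b * ff C i j)" by (rule mult.left_commute)
  also have "\<dots> = c j * (gcd a b * ff C j i)" unfolding a'[symmetric] b'[symmetric] by (rule cab)
  also have "\<dots> = gcd a b * (c j * ff C j i)" by (rule mult.left_commute)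
  finally have "gcd a b * (c i * ff C i j) = gcd a b * (c j * ff C j i)" .
  then have e: "c i * ff C i j = c j * ff C j i" using ab by simp
  then have "ff C j i dvd c i * ff C i j" by simp
  then have "ff C j i dvd c i" using cop by (simp add: coprime_commute coprime_dvd_mult_left_iff)
  then obtain k where k: "c i = k * ff C j i" by (metis dvd_div_mult_self)
  have "gcd a b * ff C i j > 0" "gcd a b * ff C j i > 0"
    unfolding a'[symmetric] b'[symmetric] by (rule ab)+
  then have pos: "ff C i j > 0" "ff C j i > 0" by simp_all
  have "ff C j i * (k * ff C i j) = ff C j i * c j" using e unfolding k by (simp add: ac_simps)
  then have "c j = k * ff C i j" using pos by simp
  with k pos show "\<exists>k. c i = k * ff C j i \<and> c j = k * ff C i j \<and> ff C i j > 0" by blast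
qed

text \<open>The definition of \<open>rep_lf\<close> works with the function c r, which the given d
  equals at the vertices only; all objects depend on d through its values there.\<close>

lemma dimension_vector_cong:
  assumes d': "\<forall>i\<in>{1..n}. d i = d' i" and \<Omega>: "\<Omega> \<subseteq> {1..n} \<times> {1..n}"
  shows "rep_coords n C \<Omega> d = rep_coords n C \<Omega> d'" "loop_coords n d = loop_coords n d'"
    "G_coords n d = G_coords n d'" "rep_H n C c \<Omega> d = (rep_H n C c \<Omega> d' :: (rep_coord \<Rightarrow> 'k::field) set)"
    "pi_bar n d = (pi_bar n d' :: (rep_coord \<Rightarrow> 'k) \<Rightarrow> _)"
    "fibre_add n d = (fibre_add n d' :: (rep_coord \<Rightarrow> 'k) \<Rightarrow> _)"
    "fibre_scale n d = (fibre_scale n d' :: 'k \<Rightarrow> _)"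
    "G_var n d = (G_var n d' :: (_ \<Rightarrow> 'k) set)" "G_grp n d = (G_grp n d' :: (nat \<Rightarrow> 'k mat) monoid)"
    "G_act n C \<Omega> d = (G_act n C \<Omega> d' :: (nat \<Rightarrow> 'k mat) \<Rightarrow> _)"
proof -
  have d: "d i = d' i" if "i \<in> {1..n}" for i using d' that by blast
  have v: "source a \<in> {1..n} \<and> target a \<in> {1..n}" if "a \<in> arrows n C \<Omega>" for a
    using that \<Omega> by (auto simp: arrows_def)
  have ar: "Eps i \<in> arrows n C \<Omega>" if "i \<in> {1..n}" for i using that by (simp add: arrows_def)
  show 1: "rep_coords n C \<Omega> d = rep_coords n C \<Omega> d'"
    using v d by (auto simp: rep_coords_def entries_def)
  show 2: "loop_coords n d = loop_coords n d'" using d by (auto simp: loop_coords_def entries_def)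
  show 3: "G_coords n d = G_coords n d'" using d by (auto simp: G_coords_def)
  have A: "arrow_mat d M a = arrow_mat d' M a" if "a \<in> arrows n C \<Omega>" for M :: "rep_coord \<Rightarrow> 'k" and a
    using v[OF that] d by (simp add: arrow_mat_def)
  have AE: "arrow_mat d M (Eps i) = arrow_mat d' M (Eps i)" if "i \<in> {1..n}" for M :: "rep_coord \<Rightarrow> 'k" and i
    using A ar that by blast
  have AA: "arrow_mat d M (Alpha i j g) = arrow_mat d' M (Alpha i j g)"
    if "(i, j) \<in> \<Omega>" for M :: "rep_coord \<Rightarrow> 'k" and i j g
  proof -
    have "i \<in> {1..n}" "j \<in> {1..n}" using that \<Omega> by auto
    then show ?thesis using d by (simp add: arrow_mat_def)
  qed
  show "rep_H n C c \<Omega> d = (rep_H n C c \<Omega> d' :: (rep_coord \<Rightarrow> 'k) set)"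
    unfolding rep_H_def 1
  proof (intro Collect_cong conj_cong refl)
    fix M :: "rep_coord \<Rightarrow> 'k"
    show "(\<forall>i\<in>{1..n}. arrow_mat d M (Eps i) ^\<^sub>m c i = 0\<^sub>m (d i) (d i)) \<longleftrightarrow>
        (\<forall>i\<in>{1..n}. arrow_mat d' M (Eps i) ^\<^sub>m c i = 0\<^sub>m (d' i) (d' i))"
      by (intro ball_cong refl) (simp add: AE d)
    show "(\<forall>(i, j)\<in>\<Omega>. \<forall>g\<in>{1..gg C i j}. arrow_mat d M (Eps i) ^\<^sub>m ff C j i * arrow_mat d M (Alpha i j g) =
          arrow_mat d M (Alpha i j g) * arrow_mat d M (Eps j) ^\<^sub>m ff C i j) \<longleftrightarrow>
        (\<forall>(i, j)\<in>\<Omega>. \<forall>g\<in>{1..gg C i j}. arrow_mat d' M (Eps i) ^\<^sub>m ff C j i * arrow_mat d' M (Alpha i j g) =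
          arrow_mat d' M (Alpha i j g) * arrow_mat d' M (Eps j) ^\<^sub>m ff C i j)"
    proof (intro ball_cong refl, clarsimp simp only: split_beta)
      fix x assume "x \<in> \<Omega>"
      then have "(fst x, snd x) \<in> \<Omega>" "fst x \<in> {1..n}" "snd x \<in> {1..n}" using \<Omega> by auto
      then show "(\<forall>g\<in>{1..gg C (fst x) (snd x)}. arrow_mat d M (Eps (fst x)) ^\<^sub>m ff C (snd x) (fst x) * arrow_mat d M (Alpha (fst x) (snd x) g) =
          arrow_mat d M (Alpha (fst x) (snd x) g) * arrow_mat d M (Eps (snd x)) ^\<^sub>m ff C (fst x) (snd x)) \<longleftrightarrow>
        (\<forall>g\<in>{1..gg C (fst x) (snd x)}. arrow_mat d' M (Eps (fst x)) ^\<^sub>m ff C (snd x) (fst x) * arrow_mat d' M (Alpha (fst x) (snd x) g) =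
          arrow_mat d' M (Alpha (fst x) (snd x) g) * arrow_mat d' M (Eps (snd x)) ^\<^sub>m ff C (fst x) (snd x))"
        by (simp only: AE AA)
    qed
  qed
  show "pi_bar n d = (pi_bar n d' :: (rep_coord \<Rightarrow> 'k) \<Rightarrow> _)"
    "fibre_add n d = (fibre_add n d' :: (rep_coord \<Rightarrow> 'k) \<Rightarrow> _)"
    "fibre_scale n d = (fibre_scale n d' :: 'k \<Rightarrow> _)"
    by (simp_all add: fun_eq_iff pi_bar_def fibre_add_def fibre_scale_def 2)
  show "G_var n d = (G_var n d' :: (_ \<Rightarrow> 'k) set)"
    unfolding G_var_def 3 using d by (intro Collect_cong conj_cong ball_cong refl) simp
  show "G_grp n d = (G_grp n d' :: (nat \<Rightarrow> 'k mat) monoid)"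
    unfolding G_grp_def product_group_def using d by (auto intro!: PiE_cong simp: fun_eq_iff restrict_def)
  show "G_act n C \<Omega> d = (G_act n C \<Omega> d' :: (nat \<Rightarrow> 'k mat) \<Rightarrow> _)"
  proof (intro ext, clarify)
    fix g :: "nat \<Rightarrow> 'k mat" and M a p q
    show "G_act n C \<Omega> d g M (a, p, q) = G_act n C \<Omega> d' g M (a, p, q)"
    proof (cases "(a, p, q) \<in> rep_coords n C \<Omega> d'")
      case True
      then have a: "a \<in> arrows n C \<Omega>" by (simp add: rep_coords_def entries_def)
      then have "d (source a) = d' (source a)" using v d by blast
      then show ?thesis using A[OF a] by (simp add: G_act_def 1)
    qed (simp add: G_act_def 1)
  qed
qed

text \<open>For r = 0 the form q_H vanishes while V is a single point, so (ii) is stated for nonzero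
  rank vectors.\<close>

theorem proposition3p1:
  fixes n :: nat and C :: "nat \<Rightarrow> nat \<Rightarrow> int" and c :: "nat \<Rightarrow> nat"
    and \<Omega> :: "(nat \<times> nat) set" and d r :: "nat \<Rightarrow> nat"
    and R V :: "(rep_coord \<Rightarrow> 'k::alg_closed_field) set"
  assumes "cartan_matrix n C" and "symmetrizer n C c" and "orientation n C \<Omega>"
    and "\<forall>i\<in>{1..n}. c i dvd d i"
  defines "r \<equiv> \<lambda>i. d i div c i"
    and "R \<equiv> rep_H n C c \<Omega> d"
    and "V \<equiv> rep_lf n C c \<Omega> r"
  shows "V \<noteq> {} \<and> openin (var_top (rep_coords n C \<Omega> d) R) V
    \<and> vector_bundle (rep_coords n C \<Omega> d) V
        (loop_coords n d) (orbit_free n c r) (pi_bar n d) (fibre_add n d) (fibre_scale n d)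
        (\<Sum>(i, j)\<in>\<Omega>. c i * nat \<bar>C i j\<bar> * r i * r j)
    \<and> smooth_variety (rep_coords n C \<Omega> d) V
    \<and> irreducible_space (var_top (rep_coords n C \<Omega> d) V)
    \<and> (\<exists>m k. krull_dim (var_top (rep_coords n C \<Omega> d) V) = enat m
        \<and> krull_dim (var_top (G_coords n d) (G_var n d :: (nat \<times> nat \<times> nat \<Rightarrow> 'k) set)) = enat k
        \<and> int m = (\<Sum>i=1..n. int (c i) * (int (c i) - 1) * (int (r i))\<^sup>2)
                  + (\<Sum>(i, j)\<in>\<Omega>. int (c i) * \<bar>C i j\<bar> * int (r i) * int (r j))
        \<and> int m = int k - q_H n C c \<Omega> r)
    \<and> (q_H n C c \<Omega> r \<le> 0 \<and> (\<exists>i\<in>{1..n}. r i \<noteq> 0)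
        \<longrightarrow> infinite (orbits (G_grp n d) V (G_act n C \<Omega> d)))"
proof -
  note ori = orientation_exponents[OF assms(1-3)]
  have cpos: "c i > 0" if "i \<in> {1..n}" for i using assms(2) that by (auto simp: symmetrizer_def)
  define d' where "d' = (\<lambda>i. c i * r i)"
  have dd: "\<forall>i\<in>{1..n}. d i = d' i" using assms(4) by (simp add: d'_def r_def)
  have "\<Omega> \<subseteq> {1..n} \<times> {1..n}" using assms(3) by (simp add: orientation_def)
  note cong = dimension_vector_cong[OF dd this]
  interpret L: lf_data n C c r d' \<Omega>
    by unfold_locales (use cpos ori in \<open>auto simp: d'_def\<close>)
  let ?m = "card L.chart_coords" and ?k = "card (G_coords n d')"
  have m: "int ?m = (\<Sum>i=1..n. int (c i) * (int (c i) - 1) * (int (r i))\<^sup>2)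
      + (\<Sum>(i, j)\<in>\<Omega>. int (c i) * \<bar>C i j\<bar> * int (r i) * int (r j))"
  proof -
    have "int (\<Sum>i=1..n. c i * (c i - 1) * (r i)\<^sup>2) = (\<Sum>i=1..n. int (c i) * (int (c i) - 1) * (int (r i))\<^sup>2)"
      unfolding of_nat_sum using cpos by (intro sum.cong) (auto simp: of_nat_diff Suc_le_eq)
    moreover have "int (\<Sum>(i, j)\<in>\<Omega>. c i * nat \<bar>C i j\<bar> * r i * r j) =
        (\<Sum>(i, j)\<in>\<Omega>. int (c i) * \<bar>C i j\<bar> * int (r i) * int (r j))"
      unfolding of_nat_sum by (intro sum.cong) auto
    ultimately show ?thesis unfolding L.card_chart by simp
  qed
  \<comment> \<open>The group has dimension \<Sum> c_i^2 r_i^2, the loops contribute this minus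
    \<Sum> c_i r_i^2, and |c_ij| = - c_ij on \<Omega>.\<close>
  have k: "int ?m = int ?k - q_H n C c \<Omega> r"
  proof -
    have "int ?k = (\<Sum>i=1..n. (int (c i) * int (r i)) * (int (c i) * int (r i)))"
      unfolding L.card_G_coords by (simp add: d'_def)
    moreover have "(\<Sum>(i, j)\<in>\<Omega>. int (c i) * \<bar>C i j\<bar> * int (r i) * int (r j)) =
        - (\<Sum>(i, j)\<in>\<Omega>. int (c i) * C i j * int (r j) * int (r i))"
      unfolding sum_negf[symmetric] using ori(2) by (intro sum.cong) fastforce+
    moreover have "(\<Sum>i=1..n. int (c i) * (int (c i) - 1) * (int (r i))\<^sup>2) =
        (\<Sum>i=1..n. (int (c i) * int (r i)) * (int (c i) * int (r i))) - (\<Sum>i=1..n. int (c i) * (int (r i))\<^sup>2)"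
      unfolding sum_subtractf[symmetric] by (intro sum.cong) (auto simp: algebra_simps power2_eq_square)
    ultimately show ?thesis unfolding m q_H_def by simp
  qed
  have "infinite (orbits (G_grp n d') V (G_act n C \<Omega> d'))"
    if q: "q_H n C c \<Omega> r \<le> 0" and r: "\<exists>i\<in>{1..n}. r i \<noteq> 0"
  proof -
    obtain i where "i \<in> {1..n}" "r i \<noteq> 0" using r by blast
    moreover have "?k \<le> ?m" using k q by linarith
    ultimately show ?thesis unfolding V_def by (intro L.infinite_orbits) (auto simp: d'_def cpos)
  qed
  then show ?thesis
    unfolding cong R_def V_def L.card_alpha[symmetric]
    by (intro conjI impI exI[of _ ?m] exI[of _ ?k] L.rep_lf_nonempty L.openin_rep_lf L.vector_bundle_rep_lf
        L.smooth_rep_lf L.irreducible_rep_lf L.krull_dim_rep_lf L.krull_dim_G_var m k) blast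
qed

end
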